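(* Let $\Omega\subset\mathbb{R}^n$, $n\in\{2,3\}$, be a bounded convex polytopal domain (no periodic boundaries), let $\mathrm{Re}>0$, and let the finite-dimensional spaces below form a discrete Stokes complex with strongly imposed boundary conditions, as described in the context. (3D) Let $(\alpha,\boldsymbol\omega,\mathbf{u},p)$ be a solution, with values in $\mathbb{A}_0\times\mathbb{W}_0\times\mathbb{U}_0\times\mathbb{P}$ at each time $t$, of $$0=(\boldsymbol\omega,\nabla\beta),$$ $$(\operatorname{curl}\boldsymbol\omega,\operatorname{curl}\boldsymbol\chi)=2(\varepsilon\mathbf{u},\varepsilon\operatorname{curl}\boldsymbol\chi)-(\nabla\alpha,\boldsymbol\chi),$$ $$(\partial_t\mathbf{u},\mathbf{v})=(\mathbf{u}\times\boldsymbol\omega,\mathbf{v})+\left(\tfrac12|\mathbf{u}|^2+p,\operatorname{div}\mathbf{v}\right)-\tfrac{2}{\mathrm{Re}}(\varepsilon\mathbf{u},\varepsilon\mathbf{v}),$$ $$0=(\operatorname{div}\mathbf{u},q),$$ for all $(\beta,\boldsymbol\chi,\mathbf{v},q)\in\mathbb{A}_0\times\mathbb{W}_0\times\mathbb{U}_0\times\mathbb{P}$. (2D) Let $(\omega,\mathbf{u},p)$ be a solution, with values in $\mathbb{W}_0\times\mathbb{U}_0\times\mathbb{P}$ at each time $t$, of $$(\nabla\omega,\nabla\chi)=-2(\varepsilon\mathbf{u},\varepsilon\nabla^\perp\chi),$$ $$(\partial_t\mathbf{u},\mathbf{v})=-(\omega\mathbf{u}^\perp,\mathbf{v})+\left(\tfrac12|\mathbf{u}|^2+p,\operatorname{div}\mathbf{v}\right)-\tfrac{2}{\mathrm{Re}}(\varepsilon\mathbf{u},\varepsilon\mathbf{v}),$$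 $$0=(\operatorname{div}\mathbf{u},q),$$ for all $(\chi,\mathbf{v},q)\in\mathbb{W}_0\times\mathbb{U}_0\times\mathbb{P}$. Then, in both cases, the energy $\mathcal{K}(\mathbf{u}):=\tfrac12\|\mathbf{u}\|^2$ and the enstrophy $\mathcal{E}(\mathbf{u}):=\|\varepsilon\mathbf{u}\|^2$ satisfy $$\partial_t\mathcal{K}=-\frac{2}{\mathrm{Re}}\,\mathcal{E}(\mathbf{u})\le 0,$$ $$\partial_t\mathcal{E}=\int_\Omega\mathbf{u}\cdot(\boldsymbol\omega\times\operatorname{curl}\boldsymbol\omega)-\frac{1}{\mathrm{Re}}\|\operatorname{curl}\boldsymbol\omega\|^2 .$$ Moreover, in 2D the advective term $\int_\Omega\mathbf{u}\cdot(\boldsymbol\omega\times\operatorname{curl}\boldsymbol\omega)$ vanishes, so that the enstrophy $\mathcal{E}$ is dissipated (non-increasing in time).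
   Context: $(\cdot,\cdot)$ and $\|\cdot\|$ denote the $L^2(\Omega)$ inner product and norm (for scalar, vector and matrix fields); $\varepsilon\mathbf{u}:=\operatorname{sym}\operatorname{grad}\mathbf{u}$ is the symmetric gradient; $\mathbf{n}$ is the outward unit normal on $\partial\Omega$. For a differential operator $\mathrm{d}$, $H(\mathrm{d}):=\{u\in L^2:\mathrm{d}u\in L^2\}$; boldface denotes vector-valued fields/spaces. $H^1_0$, $\mathbf{H}_0(\operatorname{curl})$, $\mathbf{H}_0(\operatorname{div})$ are the subspaces of $H^1$, $\mathbf{H}(\operatorname{curl})$, $\mathbf{H}(\operatorname{div})$ with, respectively, $u=0$, $\mathbf{u}\times\mathbf{n}=\mathbf{0}$, $\mathbf{u}\cdot\mathbf{n}=0$ on $\partial\Omega$. Discrete Stokes complex, 3D: finite-dimensional spaces $\mathbb{A}_0\subset H^1_0$, $\mathbb{W}_0\subset\mathbf{H}(\operatorname{grad}\operatorname{curl})\cap\mathbf{H}_0(\operatorname{curl})$, $\mathbb{U}_0\subset\mathbf{H}^1\cap\mathbf{H}_0(\operatorname{div})$, $\mathbb{P}\subset L^2$ with $\nabla\mathbb{A}_0\subset\mathbb{W}_0$, $\operatorname{curl}\mathbb{W}_0\subset\mathbb{U}_0$, $\operatorname{div}\mathbb{U}_0\subset\mathbb{P}$. Discrete Stokes complex, 2D: finite-dimensional spaces $\mathbb{W}_0\subset H^2\cap H^1_0$, $\mathbb{U}_0\subset\mathbf{H}^1\cap\mathbf{H}_0(\operatorname{div})$, $\mathbb{P}\subset L^2$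 with $\nabla^\perp\mathbb{W}_0\subset\mathbb{U}_0$, $\operatorname{div}\mathbb{U}_0\subset\mathbb{P}$. Standing assumption on the complex: its discrete cohomology is that of the domain, i.e. the space of discrete harmonic $k$-forms $\mathfrak{H}^k_0$ (elements of the $k$-th space in the kernel of the outgoing map and $L^2$-orthogonal to the image of the incoming map) has dimension equal to the Betti number $b_{n-k}(\Omega)$. For the contractible domains considered here, this means in particular that every $\mathbf{u}\in\mathbb{U}_0$ with $\operatorname{div}\mathbf{u}=0$ equals $\operatorname{curl}\boldsymbol\psi$ for some $\boldsymbol\psi\in\mathbb{W}_0$ (3D), respectively $-\nabla^\perp\psi$ for some $\psi\in\mathbb{W}_0$ (2D). 2D conventions: $(u,v)^\perp:=(-v,u)$, $\nabla^\perp\phi:=(-\partial_y\phi,\partial_x\phi)$. The vorticity $\omega$ is a scalar, $\operatorname{curl}\omega:=-\nabla^\perp\omega$, and $\mathbf{u}\cdot(\boldsymbol\omega\times\operatorname{curl}\boldsymbol\omega)$ is read by identifying $\omega$ with the vector $\omega\mathbf{e}_z$ normal to the plane, i.e. it equals $\omega\,\mathbf{u}\cdot\nabla\omega$. Solutions are assumed to be continuously differentiable in time in the $\mathbf{u}$ component. *)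

theory Defs
  imports "HOL-Analysis.Analysis" "HOL-Homology.Homology"
begin

section \<open>Domain\<close>

definition convex_polytopal_domain :: "(real^'n) set \<Rightarrow> bool" where
  "convex_polytopal_domain \<Omega> \<longleftrightarrow>
     open \<Omega> \<and> \<Omega> \<noteq> {} \<and> bounded \<Omega> \<and> convex \<Omega> \<and> polytope (closure \<Omega>)"

text \<open>The Betti number is the rank of the integral singular homology group: the largest r for
  which \<open>\<int>^r\<close> embeds into it.\<close>

definition betti :: "nat \<Rightarrow> 'a topology \<Rightarrow> nat" where
  "betti k X =
     (GREATEST r. \<exists>h. h \<in> mon (free_Abelian_group {..<r}) (homology_group (int k) X))"

section \<open>The space \<open>L^2\<close>\<close>

text \<open>Elements of \<open>L^2(\<Omega>)\<close> are represented by functions on the whole space; only their values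
  almost everywhere on \<open>\<Omega>\<close> matter. A set of such functions stands for a subspace of \<open>L^2\<close> when it is
  a union of classes modulo equality almost everywhere, see \<open>L2_dim\<close> below. Matrices carry the
  Frobenius inner product.\<close>

definition L2 :: "(real^'n) set \<Rightarrow> (real^'n \<Rightarrow> 'b::euclidean_space) set" where
  "L2 \<Omega> = {f \<in> borel_measurable (lebesgue_on \<Omega>).
             integrable (lebesgue_on \<Omega>) (\<lambda>x. (norm (f x))\<^sup>2)}"

definition l2_inner ::
  "(real^'n) set \<Rightarrow> (real^'n \<Rightarrow> 'b::euclidean_space) \<Rightarrow> (real^'n \<Rightarrow> 'b) \<Rightarrow> real" where
  "l2_inner \<Omega> f g = (\<integral>x. f x \<bullet> g x \<partial>(lebesgue_on \<Omega>))"

definition l2_norm :: "(real^'n) set \<Rightarrow> (real^'n \<Rightarrow> 'b::euclidean_space) \<Rightarrow> real" where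
  "l2_norm \<Omega> f = sqrt (l2_inner \<Omega> f f)"

text \<open>\<open>L2_dim \<Omega> V d\<close>: \<open>V\<close> is a linear subspace of \<open>L^2(\<Omega>)\<close> (closed under equality
  almost everywhere) of dimension \<open>d\<close>.\<close>

definition L2_dim :: "(real^'n) set \<Rightarrow> (real^'n \<Rightarrow> 'b::euclidean_space) set \<Rightarrow> nat \<Rightarrow> bool" where
  "L2_dim \<Omega> V d \<longleftrightarrow>
     (\<exists>b :: nat \<Rightarrow> real^'n \<Rightarrow> 'b.
        (\<forall>i<d. b i \<in> L2 \<Omega>) \<and>
        (\<forall>c :: nat \<Rightarrow> real. (AE x in lebesgue_on \<Omega>. (\<Sum>i<d. c i *\<^sub>R b i x) = 0)
             \<longrightarrow> (\<forall>i<d. c i = 0)) \<and>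
        V = {f \<in> L2 \<Omega>. \<exists>c :: nat \<Rightarrow> real.
               AE x in lebesgue_on \<Omega>. f x = (\<Sum>i<d. c i *\<^sub>R b i x)})"

definition finite_dim :: "(real^'n) set \<Rightarrow> (real^'n \<Rightarrow> 'b::euclidean_space) set \<Rightarrow> bool" where
  "finite_dim \<Omega> V \<longleftrightarrow> (\<exists>d. L2_dim \<Omega> V d)"

section \<open>Classical differential operators and test fields\<close>

definition pd :: "'n::finite \<Rightarrow> (real^'n \<Rightarrow> 'b::real_normed_vector) \<Rightarrow> real^'n \<Rightarrow> 'b" where
  "pd i f x = frechet_derivative f (at x) (axis i 1)"

text \<open>For a vector field \<open>v\<close>, \<open>grad v x $ j $ i\<close> is the derivative of \<open>v\<^sub>i\<close> in direction \<open>j\<close>,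
  the transpose of the Jacobian matrix; \<open>dvg\<close> is minus the formal adjoint of \<open>grad\<close>.\<close>

definition grad :: "(real^'n \<Rightarrow> 'b::real_normed_vector) \<Rightarrow> real^'n \<Rightarrow> 'b^'n" where
  "grad f x = (\<chi> j. pd j f x)"

definition dvg :: "(real^'n \<Rightarrow> 'b::real_normed_vector^'n) \<Rightarrow> real^'n \<Rightarrow> 'b" where
  "dvg \<Phi> x = (\<Sum>j\<in>UNIV. pd j (\<lambda>y. \<Phi> y $ j) x)"

definition curl :: "(real^3 \<Rightarrow> real^3) \<Rightarrow> real^3 \<Rightarrow> real^3" where
  "curl v x = vector
     [pd 2 (\<lambda>y. v y $ 3) x - pd 3 (\<lambda>y. v y $ 2) x,
      pd 3 (\<lambda>y. v y $ 1) x - pd 1 (\<lambda>y. v y $ 3) x,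
      pd 1 (\<lambda>y. v y $ 2) x - pd 2 (\<lambda>y. v y $ 1) x]"

primrec C_k :: "nat \<Rightarrow> (real^'n \<Rightarrow> 'b::real_normed_vector) \<Rightarrow> bool" where
  "C_k 0 f \<longleftrightarrow> continuous_on UNIV f"
| "C_k (Suc k) f \<longleftrightarrow> (\<forall>x. f differentiable (at x)) \<and> (\<forall>i. C_k k (pd i f))"

definition test_fields :: "(real^'n) set \<Rightarrow> (real^'n \<Rightarrow> 'b::real_normed_vector) set" where
  "test_fields \<Omega> =
     {\<phi>. (\<forall>k. C_k k \<phi>) \<and> compact (closure {x. \<phi> x \<noteq> 0}) \<and> closure {x. \<phi> x \<noteq> 0} \<subseteq> \<Omega>}"

section \<open>Weak differential operators and the spaces \<open>H(d)\<close>, \<open>H\<^sub>0(d)\<close>\<close>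

text \<open>A differential operator \<open>d\<close> acts on \<open>L^2\<close> fields in the sense of distributions, through its
  formal adjoint \<open>ds\<close> on test fields. The value \<open>weak ds \<Omega> u\<close> is determined up to equality almost
  everywhere, and it is meaningful for \<open>u\<close> in \<open>H ds \<Omega>\<close>.\<close>

definition is_weak ::
  "((real^'n \<Rightarrow> 'c) \<Rightarrow> real^'n \<Rightarrow> 'b) \<Rightarrow> (real^'n) set \<Rightarrow>
   (real^'n \<Rightarrow> 'b::euclidean_space) \<Rightarrow> (real^'n \<Rightarrow> 'c::euclidean_space) \<Rightarrow> bool" where
  "is_weak ds \<Omega> u w \<longleftrightarrow> w \<in> L2 \<Omega> \<and> (\<forall>\<phi>\<in>test_fields \<Omega>. l2_inner \<Omega> u (ds \<phi>) = l2_inner \<Omega> w \<phi>)"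

definition weak ::
  "((real^'n \<Rightarrow> 'c) \<Rightarrow> real^'n \<Rightarrow> 'b) \<Rightarrow> (real^'n) set \<Rightarrow>
   (real^'n \<Rightarrow> 'b::euclidean_space) \<Rightarrow> real^'n \<Rightarrow> 'c::euclidean_space" where
  "weak ds \<Omega> u = (SOME w. is_weak ds \<Omega> u w)"

definition H ::
  "((real^'n \<Rightarrow> 'c::euclidean_space) \<Rightarrow> real^'n \<Rightarrow> 'b) \<Rightarrow> (real^'n) set \<Rightarrow>
   (real^'n \<Rightarrow> 'b::euclidean_space) set" where
  "H ds \<Omega> = {u \<in> L2 \<Omega>. \<exists>w. is_weak ds \<Omega> u w}"

text \<open>The homogeneous boundary condition belonging to \<open>d\<close> (vanishing trace for the gradient,
  tangential trace for the curl, normal trace for the divergence) is imposed by taking the closure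
  of the test fields in the graph norm of \<open>d\<close>.\<close>

definition H0 ::
  "((real^'n \<Rightarrow> 'b) \<Rightarrow> real^'n \<Rightarrow> 'c::euclidean_space) \<Rightarrow> ((real^'n \<Rightarrow> 'c) \<Rightarrow> real^'n \<Rightarrow> 'b) \<Rightarrow> (real^'n) set \<Rightarrow>
   (real^'n \<Rightarrow> 'b::euclidean_space) set" where
  "H0 d ds \<Omega> = {u \<in> H ds \<Omega>. \<exists>\<phi> :: nat \<Rightarrow> real^'n \<Rightarrow> 'b.
      (\<forall>k. \<phi> k \<in> test_fields \<Omega>) \<and>
      (\<lambda>k. l2_norm \<Omega> (\<lambda>x. \<phi> k x - u x)) \<longlonglongrightarrow> 0 \<and>
      (\<lambda>k. l2_norm \<Omega> (\<lambda>x. d (\<phi> k) x - weak ds \<Omega> u x)) \<longlonglongrightarrow> 0}"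

definition grad_adj :: "(real^'n \<Rightarrow> 'b::real_normed_vector^'n) \<Rightarrow> real^'n \<Rightarrow> 'b" where
  "grad_adj \<Phi> = (\<lambda>x. - dvg \<Phi> x)"

definition dvg_adj :: "(real^'n \<Rightarrow> 'b::real_normed_vector) \<Rightarrow> real^'n \<Rightarrow> 'b^'n" where
  "dvg_adj \<phi> = (\<lambda>x. - grad \<phi> x)"

definition w_grad ::
  "(real^'n) set \<Rightarrow> (real^'n \<Rightarrow> 'b::euclidean_space) \<Rightarrow> real^'n \<Rightarrow> 'b^'n" where
  "w_grad = weak grad_adj"

definition w_div :: "(real^'n) set \<Rightarrow> (real^'n \<Rightarrow> real^'n) \<Rightarrow> real^'n \<Rightarrow> real" where
  "w_div = weak dvg_adj"

definition w_curl :: "(real^3) set \<Rightarrow> (real^3 \<Rightarrow> real^3) \<Rightarrow> real^3 \<Rightarrow> real^3" where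
  "w_curl = weak curl"

definition H1 :: "(real^'n) set \<Rightarrow> (real^'n \<Rightarrow> 'b::euclidean_space) set" where
  "H1 = H grad_adj"

definition H1_0 :: "(real^'n) set \<Rightarrow> (real^'n \<Rightarrow> real) set" where
  "H1_0 = H0 grad grad_adj"

definition H2 :: "(real^'n) set \<Rightarrow> (real^'n \<Rightarrow> real) set" where
  "H2 \<Omega> = {u \<in> H1 \<Omega>. w_grad \<Omega> u \<in> H1 \<Omega>}"

definition Hdiv_0 :: "(real^'n) set \<Rightarrow> (real^'n \<Rightarrow> real^'n) set" where
  "Hdiv_0 = H0 dvg dvg_adj"

definition Hcurl_0 :: "(real^3) set \<Rightarrow> (real^3 \<Rightarrow> real^3) set" where
  "Hcurl_0 = H0 curl curl"

definition Hgradcurl :: "(real^3) set \<Rightarrow> (real^3 \<Rightarrow> real^3) set" where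
  "Hgradcurl = H (\<lambda>\<Phi> :: real^3 \<Rightarrow> real^3^3. curl (grad_adj \<Phi>))"

definition sym_grad ::
  "(real^'n) set \<Rightarrow> (real^'n \<Rightarrow> real^'n) \<Rightarrow> real^'n \<Rightarrow> real^'n^'n" where
  "sym_grad \<Omega> u x = (1/2) *\<^sub>R (w_grad \<Omega> u x + transpose (w_grad \<Omega> u x))"

definition perp :: "real^2 \<Rightarrow> real^2" where
  "perp v = vector [- (v $ 2), v $ 1]"

definition grad_perp :: "(real^2) set \<Rightarrow> (real^2 \<Rightarrow> real) \<Rightarrow> real^2 \<Rightarrow> real^2" where
  "grad_perp \<Omega> \<phi> x = perp (w_grad \<Omega> \<phi> x)"

definition curl_2d :: "(real^2) set \<Rightarrow> (real^2 \<Rightarrow> real) \<Rightarrow> real^2 \<Rightarrow> real^2" where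
  "curl_2d \<Omega> \<phi> x = - grad_perp \<Omega> \<phi> x"

section \<open>Discrete Stokes complexes\<close>

text \<open>The last clauses say that the spaces of discrete harmonic k-forms, \<open>k = 0, \<dots>, n\<close>, have
  dimension \<open>b\<^bsub>n-k\<^esub>(\<Omega>)\<close>.\<close>

definition stokes_complex_3d ::
  "(real^3) set \<Rightarrow> (real^3 \<Rightarrow> real) set \<Rightarrow> (real^3 \<Rightarrow> real^3) set \<Rightarrow>
   (real^3 \<Rightarrow> real^3) set \<Rightarrow> (real^3 \<Rightarrow> real) set \<Rightarrow> bool" where
  "stokes_complex_3d \<Omega> A W U P \<longleftrightarrow>
     finite_dim \<Omega> A \<and> finite_dim \<Omega> W \<and> finite_dim \<Omega> U \<and> finite_dim \<Omega> P \<and>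
     A \<subseteq> H1_0 \<Omega> \<and> W \<subseteq> Hgradcurl \<Omega> \<inter> Hcurl_0 \<Omega> \<and> U \<subseteq> H1 \<Omega> \<inter> Hdiv_0 \<Omega> \<and> P \<subseteq> L2 \<Omega> \<and>
     w_grad \<Omega> ` A \<subseteq> W \<and> w_curl \<Omega> ` W \<subseteq> U \<and> w_div \<Omega> ` U \<subseteq> P \<and>
     L2_dim \<Omega> {\<alpha>\<in>A. AE x in lebesgue_on \<Omega>. w_grad \<Omega> \<alpha> x = 0} (betti 3 (top_of_set \<Omega>)) \<and>
     L2_dim \<Omega> {\<xi>\<in>W. (AE x in lebesgue_on \<Omega>. w_curl \<Omega> \<xi> x = 0) \<and>
                    (\<forall>\<beta>\<in>A. l2_inner \<Omega> \<xi> (w_grad \<Omega> \<beta>) = 0)} (betti 2 (top_of_set \<Omega>)) \<and>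
     L2_dim \<Omega> {v\<in>U. (AE x in lebesgue_on \<Omega>. w_div \<Omega> v x = 0) \<and>
                    (\<forall>\<xi>\<in>W. l2_inner \<Omega> v (w_curl \<Omega> \<xi>) = 0)} (betti 1 (top_of_set \<Omega>)) \<and>
     L2_dim \<Omega> {q\<in>P. \<forall>v\<in>U. l2_inner \<Omega> q (w_div \<Omega> v) = 0} (betti 0 (top_of_set \<Omega>))"

definition stokes_complex_2d ::
  "(real^2) set \<Rightarrow> (real^2 \<Rightarrow> real) set \<Rightarrow> (real^2 \<Rightarrow> real^2) set \<Rightarrow> (real^2 \<Rightarrow> real) set \<Rightarrow> bool" where
  "stokes_complex_2d \<Omega> W U P \<longleftrightarrow>
     finite_dim \<Omega> W \<and> finite_dim \<Omega> U \<and> finite_dim \<Omega> P \<and>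
     W \<subseteq> H2 \<Omega> \<inter> H1_0 \<Omega> \<and> U \<subseteq> H1 \<Omega> \<inter> Hdiv_0 \<Omega> \<and> P \<subseteq> L2 \<Omega> \<and>
     grad_perp \<Omega> ` W \<subseteq> U \<and> w_div \<Omega> ` U \<subseteq> P \<and>
     L2_dim \<Omega> {\<psi>\<in>W. AE x in lebesgue_on \<Omega>. grad_perp \<Omega> \<psi> x = 0} (betti 2 (top_of_set \<Omega>)) \<and>
     L2_dim \<Omega> {v\<in>U. (AE x in lebesgue_on \<Omega>. w_div \<Omega> v x = 0) \<and>
                    (\<forall>\<psi>\<in>W. l2_inner \<Omega> v (grad_perp \<Omega> \<psi>) = 0)} (betti 1 (top_of_set \<Omega>)) \<and>
     L2_dim \<Omega> {q\<in>P. \<forall>v\<in>U. l2_inner \<Omega> q (w_div \<Omega> v) = 0} (betti 0 (top_of_set \<Omega>))"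

section \<open>Semi-discrete solutions\<close>

text \<open>\<open>du\<close> is a continuous time derivative of \<open>u\<close> on \<open>T\<close> with respect to the \<open>L^2\<close> norm; on a
  finite-dimensional space all norms give the same notion.\<close>

definition C1_in_time ::
  "(real^'n) set \<Rightarrow> real set \<Rightarrow> (real \<Rightarrow> real^'n \<Rightarrow> 'b::euclidean_space) \<Rightarrow>
   (real \<Rightarrow> real^'n \<Rightarrow> 'b) \<Rightarrow> bool" where
  "C1_in_time \<Omega> T u du \<longleftrightarrow> (\<forall>t\<in>T. du t \<in> L2 \<Omega> \<and>
     ((\<lambda>s. l2_norm \<Omega> (\<lambda>x. (u s x - u t x) /\<^sub>R (s - t) - du t x)) \<longlongrightarrow> 0) (at t within T) \<and>
     ((\<lambda>s. l2_norm \<Omega> (\<lambda>x. du s x - du t x)) \<longlongrightarrow> 0) (at t within T))"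

text \<open>The nonlinear terms below need not consist of products of two \<open>L^2\<close> fields; the integrals
  converge by the embedding of \<open>H^1\<close> into \<open>L^6\<close>.\<close>

definition solution_3d ::
  "(real^3) set \<Rightarrow> real \<Rightarrow> real set \<Rightarrow>
   (real^3 \<Rightarrow> real) set \<Rightarrow> (real^3 \<Rightarrow> real^3) set \<Rightarrow> (real^3 \<Rightarrow> real^3) set \<Rightarrow> (real^3 \<Rightarrow> real) set \<Rightarrow>
   (real \<Rightarrow> real^3 \<Rightarrow> real) \<Rightarrow> (real \<Rightarrow> real^3 \<Rightarrow> real^3) \<Rightarrow> (real \<Rightarrow> real^3 \<Rightarrow> real^3) \<Rightarrow>
   (real \<Rightarrow> real^3 \<Rightarrow> real) \<Rightarrow> bool" where
  "solution_3d \<Omega> Rey T A W U P \<alpha> \<omega> u p \<longleftrightarrow>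
     (\<forall>t\<in>T. \<alpha> t \<in> A \<and> \<omega> t \<in> W \<and> u t \<in> U \<and> p t \<in> P) \<and>
     (\<exists>du. C1_in_time \<Omega> T u du \<and>
       (\<forall>t\<in>T. \<forall>\<beta>\<in>A. \<forall>\<xi>\<in>W. \<forall>v\<in>U. \<forall>q\<in>P.
          0 = l2_inner \<Omega> (\<omega> t) (w_grad \<Omega> \<beta>) \<and>
          l2_inner \<Omega> (w_curl \<Omega> (\<omega> t)) (w_curl \<Omega> \<xi>) =
            2 * l2_inner \<Omega> (sym_grad \<Omega> (u t)) (sym_grad \<Omega> (w_curl \<Omega> \<xi>))
            - l2_inner \<Omega> (w_grad \<Omega> (\<alpha> t)) \<xi> \<and>
          l2_inner \<Omega> (du t) v =
            l2_inner \<Omega> (\<lambda>x. cross3 (u t x) (\<omega> t x)) v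
            + l2_inner \<Omega> (\<lambda>x. (1/2) * (norm (u t x))\<^sup>2 + p t x) (w_div \<Omega> v)
            - (2/Rey) * l2_inner \<Omega> (sym_grad \<Omega> (u t)) (sym_grad \<Omega> v) \<and>
          0 = l2_inner \<Omega> (w_div \<Omega> (u t)) q))"

definition solution_2d ::
  "(real^2) set \<Rightarrow> real \<Rightarrow> real set \<Rightarrow>
   (real^2 \<Rightarrow> real) set \<Rightarrow> (real^2 \<Rightarrow> real^2) set \<Rightarrow> (real^2 \<Rightarrow> real) set \<Rightarrow>
   (real \<Rightarrow> real^2 \<Rightarrow> real) \<Rightarrow> (real \<Rightarrow> real^2 \<Rightarrow> real^2) \<Rightarrow> (real \<Rightarrow> real^2 \<Rightarrow> real) \<Rightarrow> bool" where
  "solution_2d \<Omega> Rey T W U P \<omega> u p \<longleftrightarrow>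
     (\<forall>t\<in>T. \<omega> t \<in> W \<and> u t \<in> U \<and> p t \<in> P) \<and>
     (\<exists>du. C1_in_time \<Omega> T u du \<and>
       (\<forall>t\<in>T. \<forall>\<xi>\<in>W. \<forall>v\<in>U. \<forall>q\<in>P.
          l2_inner \<Omega> (w_grad \<Omega> (\<omega> t)) (w_grad \<Omega> \<xi>) =
            - 2 * l2_inner \<Omega> (sym_grad \<Omega> (u t)) (sym_grad \<Omega> (grad_perp \<Omega> \<xi>)) \<and>
          l2_inner \<Omega> (du t) v =
            - l2_inner \<Omega> (\<lambda>x. \<omega> t x *\<^sub>R perp (u t x)) v
            + l2_inner \<Omega> (\<lambda>x. (1/2) * (norm (u t x))\<^sup>2 + p t x) (w_div \<Omega> v)
            - (2/Rey) * l2_inner \<Omega> (sym_grad \<Omega> (u t)) (sym_grad \<Omega> v) \<and>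
          0 = l2_inner \<Omega> (w_div \<Omega> (u t)) q))"

section \<open>Energy, enstrophy and the advective term\<close>

definition energy :: "(real^'n) set \<Rightarrow> (real^'n \<Rightarrow> real^'n) \<Rightarrow> real" where
  "energy \<Omega> u = (1/2) * (l2_norm \<Omega> u)\<^sup>2"

definition enstrophy :: "(real^'n) set \<Rightarrow> (real^'n \<Rightarrow> real^'n) \<Rightarrow> real" where
  "enstrophy \<Omega> u = (l2_norm \<Omega> (sym_grad \<Omega> u))\<^sup>2"

definition advection_3d :: "(real^3) set \<Rightarrow> (real^3 \<Rightarrow> real^3) \<Rightarrow> (real^3 \<Rightarrow> real^3) \<Rightarrow> real" where
  "advection_3d \<Omega> u \<omega> = (\<integral>x. u x \<bullet> cross3 (\<omega> x) (w_curl \<Omega> \<omega> x) \<partial>(lebesgue_on \<Omega>))"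

text \<open>In two dimensions the plane is embedded into space, with scalar vorticity normal to it.\<close>

definition in_plane :: "real^2 \<Rightarrow> real^3" where
  "in_plane v = vector [v $ 1, v $ 2, 0]"

definition normal_to_plane :: "real \<Rightarrow> real^3" where
  "normal_to_plane s = vector [0, 0, s]"

definition advection_2d :: "(real^2) set \<Rightarrow> (real^2 \<Rightarrow> real^2) \<Rightarrow> (real^2 \<Rightarrow> real) \<Rightarrow> real" where
  "advection_2d \<Omega> u \<omega> =
     (\<integral>x. in_plane (u x) \<bullet> cross3 (normal_to_plane (\<omega> x)) (in_plane (curl_2d \<Omega> \<omega> x))
        \<partial>(lebesgue_on \<Omega>))"

end

theory Submission
  imports Defs
begin

text \<open>The time derivative of the velocity stays in the finite dimensional space \<open>U\<close> and stays
  divergence free. Testing the momentum equation with \<open>u\<close> kills the rotational term pointwise and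
  the pressure term because \<open>div u = 0\<close>; the energy balance remains. On a convex domain the first
  Betti number vanishes (\<open>betti_convex\<close>), so there are no discrete harmonic fields, and
  \<open>\<partial>\<^sub>t u = curl \<psi>\<close> for a discrete potential \<open>\<psi>\<close> (\<open>exists_potential\<close>). Hence the vorticity equation
  applies to the derivative of the enstrophy and gives, with \<open>E\<close> for the symmetric gradient,
  \<open>2 (E u, E \<partial>\<^sub>t u) = (curl \<omega>, curl \<psi>) = (\<partial>\<^sub>t u, curl \<omega>)\<close>, and the momentum equation tested with
  \<open>curl \<omega>\<close> evaluates the right hand side. In three dimensions the Lagrange multiplier drops out,
  since the field \<open>grad \<alpha>\<close> is an admissible test field without curl.

  In two dimensions the advective term is the integral of \<open>\<omega> u \<bullet> grad \<omega>\<close>, that is, of \<open>u\<close> against the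
  gradient of \<open>\<omega>\<^sup>2/2\<close>. As the product is not known beforehand to be integrable, \<open>\<omega>\<^sup>2/2\<close> is replaced
  by the bounded \<open>(1 - cos(\<epsilon> \<omega>))/\<epsilon>\<^sup>2\<close>, for which approximation of \<open>\<omega>\<close> by test fields is harmless, and
  \<open>\<epsilon>\<close> tends to zero (\<open>integral_transport_eq_0\<close>).

  All of this needs the weak operators to be linear. Their values are chosen representatives, so
  linearity holds almost everywhere and rests on the uniqueness of weak derivatives, which is the
  fundamental lemma of the calculus of variations (\<open>fundamental_lemma\<close>). The identities
  \<open>div curl = 0\<close> and \<open>curl grad = 0\<close> for weak operators reduce to the symmetry of second derivatives
  of test fields (\<open>pd_commute\<close>). Finite dimensionality enters through orthogonal projections
  (\<open>exists_orthogonal_projection\<close>), which make linear operators bounded and subspaces closed, and so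
  allow differentiation in time under the symmetric gradient and the divergence.\<close>

section \<open>The Hilbert space structure of square integrable fields\<close>

lemma L2_measurable: "f \<in> L2 \<Omega> \<Longrightarrow> f \<in> borel_measurable (lebesgue_on \<Omega>)"
  by (simp add: L2_def)

lemma L2_integrable_inner:
  assumes "f \<in> L2 \<Omega>" "g \<in> L2 \<Omega>"
  shows "integrable (lebesgue_on \<Omega>) (\<lambda>x. f x \<bullet> g x)"
proof (rule Bochner_Integration.integrable_bound)
  show "integrable (lebesgue_on \<Omega>) (\<lambda>x. (norm (f x))\<^sup>2 + (norm (g x))\<^sup>2)"
    using assms by (intro Bochner_Integration.integrable_add) (auto simp: L2_def)
  show "(\<lambda>x. f x \<bullet> g x) \<in> borel_measurable (lebesgue_on \<Omega>)"
    using assms by (intro borel_measurable_inner) (auto simp: L2_def)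
  have "norm (f x \<bullet> g x) \<le> norm ((norm (f x))\<^sup>2 + (norm (g x))\<^sup>2)" for x
  proof -
    have "\<bar>f x \<bullet> g x\<bar> \<le> norm (f x) * norm (g x)"
      by (rule Cauchy_Schwarz_ineq2)
    also have "\<dots> \<le> (norm (f x))\<^sup>2 + (norm (g x))\<^sup>2"
      using sum_squares_bound[of "norm (f x)" "norm (g x)"]
        mult_nonneg_nonneg[OF norm_ge_zero[of "f x"] norm_ge_zero[of "g x"]] by linarith
    finally show ?thesis by simp
  qed
  then show "AE x in lebesgue_on \<Omega>. norm (f x \<bullet> g x) \<le> norm ((norm (f x))\<^sup>2 + (norm (g x))\<^sup>2)"
    by simp
qed

lemma L2_I:
  assumes "f \<in> borel_measurable (lebesgue_on \<Omega>)" "integrable (lebesgue_on \<Omega>) (\<lambda>x. f x \<bullet> f x)"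
  shows "f \<in> L2 \<Omega>"
  using assms by (simp add: L2_def power2_norm_eq_inner)

lemma L2_add:
  assumes "f \<in> L2 \<Omega>" "g \<in> L2 \<Omega>"
  shows "(\<lambda>x. f x + g x) \<in> L2 \<Omega>"
proof (rule L2_I)
  show "(\<lambda>x. f x + g x) \<in> borel_measurable (lebesgue_on \<Omega>)"
    using assms by (intro borel_measurable_add) (auto simp: L2_def)
  have "integrable (lebesgue_on \<Omega>) (\<lambda>x. (f x \<bullet> f x + f x \<bullet> g x) + (g x \<bullet> f x + g x \<bullet> g x))"
    using assms by (intro Bochner_Integration.integrable_add L2_integrable_inner)
  then show "integrable (lebesgue_on \<Omega>) (\<lambda>x. (f x + g x) \<bullet> (f x + g x))"
    by (simp add: inner_add_left inner_add_right algebra_simps)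
qed

lemma L2_linear:
  fixes L :: "'b::euclidean_space \<Rightarrow> 'c::euclidean_space"
  assumes "bounded_linear L" "f \<in> L2 \<Omega>"
  shows "(\<lambda>x. L (f x)) \<in> L2 \<Omega>"
proof -
  have meas: "(\<lambda>x. L (f x)) \<in> borel_measurable (lebesgue_on \<Omega>)"
    using assms L2_measurable
    by (intro borel_measurable_continuous_on[of L])
       (auto intro: linear_continuous_on)
  obtain K where K: "\<And>y. norm (L y) \<le> norm y * K"
    using assms(1) bounded_linear.bounded by blast
  have "integrable (lebesgue_on \<Omega>) (\<lambda>x. K\<^sup>2 * (norm (f x))\<^sup>2)"
    using assms(2) by (auto simp: L2_def)
  then have "integrable (lebesgue_on \<Omega>) (\<lambda>x. (norm (L (f x)))\<^sup>2)"
  proof (rule Bochner_Integration.integrable_bound)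
    show "(\<lambda>x. (norm (L (f x)))\<^sup>2) \<in> borel_measurable (lebesgue_on \<Omega>)"
      using meas by measurable
    have "(norm (L (f x)))\<^sup>2 \<le> K\<^sup>2 * (norm (f x))\<^sup>2" for x
      using power_mono[OF K[of "f x"], of 2] by (simp add: power_mult_distrib mult.commute)
    then show "AE x in lebesgue_on \<Omega>. norm ((norm (L (f x)))\<^sup>2) \<le> norm (K\<^sup>2 * (norm (f x))\<^sup>2)"
      by simp
  qed
  with meas show ?thesis by (simp add: L2_def)
qed

lemma L2_scaleR: "f \<in> L2 \<Omega> \<Longrightarrow> (\<lambda>x. c *\<^sub>R f x) \<in> L2 \<Omega>"
  by (rule L2_linear[of "\<lambda>y. c *\<^sub>R y"]) (auto intro: bounded_linear_scaleR_right)

lemma L2_uminus: "f \<in> L2 \<Omega> \<Longrightarrow> (\<lambda>x. - f x) \<in> L2 \<Omega>"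
  using L2_scaleR[of f \<Omega> "-1"] by simp

lemma L2_diff: "f \<in> L2 \<Omega> \<Longrightarrow> g \<in> L2 \<Omega> \<Longrightarrow> (\<lambda>x. f x - g x) \<in> L2 \<Omega>"
  using L2_add[OF _ L2_uminus] by fastforce

lemma L2_zero: "(\<lambda>x. 0) \<in> L2 \<Omega>"
  by (simp add: L2_def)

lemma L2_sum: "(\<And>i. i \<in> I \<Longrightarrow> f i \<in> L2 \<Omega>) \<Longrightarrow> (\<lambda>x. \<Sum>i\<in>I. f i x) \<in> L2 \<Omega>"
  by (induction I rule: infinite_finite_induct) (auto simp: L2_zero L2_add)

lemma l2_inner_commute: "l2_inner \<Omega> f g = l2_inner \<Omega> g f"
  by (simp add: l2_inner_def inner_commute)

lemma l2_inner_add_left: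
  assumes "f \<in> L2 \<Omega>" "g \<in> L2 \<Omega>" "h \<in> L2 \<Omega>"
  shows "l2_inner \<Omega> (\<lambda>x. f x + g x) h = l2_inner \<Omega> f h + l2_inner \<Omega> g h"
  using assms by (simp add: l2_inner_def inner_add_left L2_integrable_inner)

lemma l2_inner_scaleR_left: "l2_inner \<Omega> (\<lambda>x. c *\<^sub>R f x) g = c * l2_inner \<Omega> f g"
  by (simp add: l2_inner_def)

lemma l2_inner_diff_left:
  assumes "f \<in> L2 \<Omega>" "g \<in> L2 \<Omega>" "h \<in> L2 \<Omega>"
  shows "l2_inner \<Omega> (\<lambda>x. f x - g x) h = l2_inner \<Omega> f h - l2_inner \<Omega> g h"
  using assms by (simp add: l2_inner_def inner_diff_left L2_integrable_inner)

lemma l2_inner_zero_left [simp]: "l2_inner \<Omega> (\<lambda>x. 0) g = 0"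
  by (simp add: l2_inner_def)

lemma l2_inner_sum_left:
  assumes "\<And>i. i \<in> I \<Longrightarrow> f i \<in> L2 \<Omega>" "g \<in> L2 \<Omega>"
  shows "l2_inner \<Omega> (\<lambda>x. \<Sum>i\<in>I. f i x) g = (\<Sum>i\<in>I. l2_inner \<Omega> (f i) g)"
  using assms
  by (induction I rule: infinite_finite_induct) (auto simp: l2_inner_add_left L2_sum)

lemma l2_inner_add_right:
  assumes "f \<in> L2 \<Omega>" "g \<in> L2 \<Omega>" "h \<in> L2 \<Omega>"
  shows "l2_inner \<Omega> h (\<lambda>x. f x + g x) = l2_inner \<Omega> h f + l2_inner \<Omega> h g"
  using l2_inner_add_left[OF assms] by (simp add: l2_inner_commute)

lemma l2_inner_scaleR_right: "l2_inner \<Omega> g (\<lambda>x. c *\<^sub>R f x) = c * l2_inner \<Omega> g f"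
  by (simp add: l2_inner_def)

lemma l2_inner_diff_right:
  assumes "f \<in> L2 \<Omega>" "g \<in> L2 \<Omega>" "h \<in> L2 \<Omega>"
  shows "l2_inner \<Omega> h (\<lambda>x. f x - g x) = l2_inner \<Omega> h f - l2_inner \<Omega> h g"
  using l2_inner_diff_left[OF assms] by (simp add: l2_inner_commute)

lemma l2_inner_cong_AE:
  assumes "f \<in> L2 \<Omega>" "f' \<in> L2 \<Omega>" "g \<in> L2 \<Omega>" "g' \<in> L2 \<Omega>"
    and "AE x in lebesgue_on \<Omega>. f x = f' x" "AE x in lebesgue_on \<Omega>. g x = g' x"
  shows "l2_inner \<Omega> f g = l2_inner \<Omega> f' g'"
  unfolding l2_inner_def
proof (rule integral_cong_AE)
  show "AE x in lebesgue_on \<Omega>. f x \<bullet> g x = f' x \<bullet> g' x"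
    using assms(5,6) by eventually_elim simp
qed (use assms in \<open>auto intro!: borel_measurable_inner simp: L2_def\<close>)

text \<open>This disposes of the pressure term, in which \<open>|u|\<^sup>2/2 + p\<close> is paired with a divergence that
  vanishes almost everywhere.\<close>

lemma l2_inner_zero_AE:
  assumes "AE x in lebesgue_on \<Omega>. g x = 0"
  shows "l2_inner \<Omega> f g = 0"
  unfolding l2_inner_def using assms by (intro integral_eq_zero_AE) auto

lemma l2_inner_self_nonneg: "l2_inner \<Omega> f f \<ge> 0"
  by (simp add: l2_inner_def)

lemma l2_norm_power2: "(l2_norm \<Omega> f)\<^sup>2 = l2_inner \<Omega> f f"
  by (simp add: l2_norm_def l2_inner_self_nonneg)

lemma l2_norm_nonneg [simp]: "l2_norm \<Omega> f \<ge> 0"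
  by (simp add: l2_norm_def l2_inner_self_nonneg)

lemma l2_inner_self_eq_0_iff:
  assumes "f \<in> L2 \<Omega>"
  shows "l2_inner \<Omega> f f = 0 \<longleftrightarrow> (AE x in lebesgue_on \<Omega>. f x = 0)"
  using integral_nonneg_eq_0_iff_AE[OF L2_integrable_inner[OF assms assms]]
  by (simp add: l2_inner_def)

lemma l2_norm_eq_0_iff:
  assumes "f \<in> L2 \<Omega>"
  shows "l2_norm \<Omega> f = 0 \<longleftrightarrow> (AE x in lebesgue_on \<Omega>. f x = 0)"
  using l2_inner_self_eq_0_iff[OF assms] by (simp add: l2_norm_def)

lemma l2_norm_zero [simp]: "l2_norm \<Omega> (\<lambda>x. 0) = 0"
  by (simp add: l2_norm_def)

lemma l2_norm_cong_AE:
  assumes "f \<in> L2 \<Omega>" "f' \<in> L2 \<Omega>" "AE x in lebesgue_on \<Omega>. f x = f' x"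
  shows "l2_norm \<Omega> f = l2_norm \<Omega> f'"
  using l2_inner_cong_AE[OF assms(1,2) assms(1,2) assms(3,3)] by (simp add: l2_norm_def)

lemma l2_norm_scaleR: "l2_norm \<Omega> (\<lambda>x. c *\<^sub>R f x) = \<bar>c\<bar> * l2_norm \<Omega> f"
proof -
  have "l2_inner \<Omega> (\<lambda>x. c *\<^sub>R f x) (\<lambda>x. c *\<^sub>R f x) = c\<^sup>2 * l2_inner \<Omega> f f"
    by (simp only: l2_inner_scaleR_left l2_inner_scaleR_right power2_eq_square mult.assoc)
  then show ?thesis by (simp add: l2_norm_def real_sqrt_mult)
qed

lemma l2_inner_expand:
  assumes "f \<in> L2 \<Omega>" "g \<in> L2 \<Omega>"
  shows "l2_inner \<Omega> (\<lambda>x. f x + c *\<^sub>R g x) (\<lambda>x. f x + c *\<^sub>R g x) =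
    l2_inner \<Omega> f f + 2 * c * l2_inner \<Omega> f g + c\<^sup>2 * l2_inner \<Omega> g g"
proof -
  have cg: "(\<lambda>x. c *\<^sub>R g x) \<in> L2 \<Omega>" using assms by (simp add: L2_scaleR)
  show ?thesis
    using assms cg l2_inner_commute[of \<Omega> g f]
    by (simp add: l2_inner_add_left l2_inner_add_right L2_add l2_inner_scaleR_left
        l2_inner_scaleR_right power2_eq_square algebra_simps)
qed

lemma l2_Cauchy_Schwarz:
  assumes "f \<in> L2 \<Omega>" "g \<in> L2 \<Omega>"
  shows "\<bar>l2_inner \<Omega> f g\<bar> \<le> l2_norm \<Omega> f * l2_norm \<Omega> g"
proof (cases "l2_inner \<Omega> g g = 0")
  case True
  then have "l2_inner \<Omega> f g = 0"
    using l2_inner_self_eq_0_iff[OF assms(2)] l2_inner_zero_AE by blast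
  then show ?thesis by simp
next
  case False
  define a b c where "a = l2_inner \<Omega> f f" and "b = l2_inner \<Omega> f g" and "c = l2_inner \<Omega> g g"
  have c: "c > 0" using False l2_inner_self_nonneg[of \<Omega> g] by (simp add: c_def)
  have "0 \<le> l2_inner \<Omega> (\<lambda>x. f x + (- b / c) *\<^sub>R g x) (\<lambda>x. f x + (- b / c) *\<^sub>R g x)"
    by (rule l2_inner_self_nonneg)
  also have "\<dots> = a + 2 * (- b / c) * b + (- b / c)\<^sup>2 * c"
    unfolding a_def b_def c_def by (rule l2_inner_expand[OF assms])
  also have "\<dots> = a - b\<^sup>2 / c"
    using c by (simp add: field_simps power2_eq_square)
  finally have "b\<^sup>2 \<le> a * c"
    using c by (simp add: field_simps)
  then have "\<bar>b\<bar> \<le> sqrt (a * c)"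
    using real_le_rsqrt by (metis power2_abs)
  then show ?thesis by (simp add: a_def b_def c_def l2_norm_def real_sqrt_mult)
qed

lemma l2_norm_triangle:
  assumes "f \<in> L2 \<Omega>" "g \<in> L2 \<Omega>"
  shows "l2_norm \<Omega> (\<lambda>x. f x + g x) \<le> l2_norm \<Omega> f + l2_norm \<Omega> g"
proof (rule power2_le_imp_le)
  have "(l2_norm \<Omega> (\<lambda>x. f x + g x))\<^sup>2 = (l2_norm \<Omega> f)\<^sup>2 + 2 * l2_inner \<Omega> f g + (l2_norm \<Omega> g)\<^sup>2"
    using l2_inner_expand[OF assms, of 1] by (simp add: l2_norm_power2)
  also have "\<dots> \<le> (l2_norm \<Omega> f + l2_norm \<Omega> g)\<^sup>2"
    using l2_Cauchy_Schwarz[OF assms] by (simp add: power2_sum abs_le_iff)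
  finally show "(l2_norm \<Omega> (\<lambda>x. f x + g x))\<^sup>2 \<le> (l2_norm \<Omega> f + l2_norm \<Omega> g)\<^sup>2" .
qed simp

lemma l2_norm_sum:
  assumes "\<And>i. i \<in> I \<Longrightarrow> f i \<in> L2 \<Omega>"
  shows "l2_norm \<Omega> (\<lambda>x. \<Sum>i\<in>I. f i x) \<le> (\<Sum>i\<in>I. l2_norm \<Omega> (f i))"
  using assms
proof (induction I rule: infinite_finite_induct)
  case (insert i I)
  have "l2_norm \<Omega> (\<lambda>x. f i x + (\<Sum>j\<in>I. f j x)) \<le> l2_norm \<Omega> (f i) + l2_norm \<Omega> (\<lambda>x. \<Sum>j\<in>I. f j x)"
    using insert.prems by (intro l2_norm_triangle L2_sum) auto
  then show ?case using insert by force
qed simp_all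

section \<open>Calculus of smooth fields\<close>

abbreviation C_infinity :: "(real^'n \<Rightarrow> 'b::real_normed_vector) \<Rightarrow> bool" where
  "C_infinity f \<equiv> \<forall>k. C_k k f"

lemma C_infinity_differentiable: "C_infinity f \<Longrightarrow> f differentiable (at x)"
  by (metis C_k.simps(2))

lemma C_infinity_pd: "C_infinity f \<Longrightarrow> C_infinity (pd i f)"
  by (metis C_k.simps(2))

lemma C_infinity_continuous: "C_infinity f \<Longrightarrow> continuous_on UNIV f"
  by (metis C_k.simps(1))

lemma pd_eqI: "(f has_derivative f') (at x) \<Longrightarrow> pd i f x = f' (axis i 1)"
  unfolding pd_def by (metis frechet_derivative_at)

lemma differentiable_has_derivative:
  "f differentiable (at x) \<Longrightarrow> (f has_derivative frechet_derivative f (at x)) (at x)"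
  by (simp add: frechet_derivative_works)

lemma pd_add:
  assumes "f differentiable (at x)" "g differentiable (at x)"
  shows "pd i (\<lambda>y. f y + g y) x = pd i f x + pd i g x"
  using pd_eqI[OF has_derivative_add[OF assms[THEN differentiable_has_derivative]]]
  by (simp add: pd_def)

lemma pd_linear:
  assumes "bounded_linear L" "f differentiable (at x)"
  shows "pd i (\<lambda>y. L (f y)) x = L (pd i f x)"
  using pd_eqI[OF bounded_linear.has_derivative[OF assms(1) differentiable_has_derivative[OF assms(2)]]]
  by (simp add: pd_def)

lemma pd_scaleR:
  fixes f :: "real^'n \<Rightarrow> real"
  assumes "f differentiable (at x)" "g differentiable (at x)"
  shows "pd i (\<lambda>y. f y *\<^sub>R g y) x = f x *\<^sub>R pd i g x + pd i f x *\<^sub>R g x"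
  using pd_eqI[OF has_derivative_scaleR[OF assms[THEN differentiable_has_derivative]]]
  by (simp add: pd_def)

lemma C_k_const: "C_k k (\<lambda>x :: real^'n. c)"
proof (induction k arbitrary: c)
  case (Suc k)
  have "pd i (\<lambda>x :: real^'n. c) = (\<lambda>x. 0)" for i
    using pd_eqI[OF has_derivative_const] by fastforce
  then show ?case using Suc by simp
qed simp

lemma C_k_add: "C_k k f \<Longrightarrow> C_k k g \<Longrightarrow> C_k k (\<lambda>x. f x + g x)"
proof (induction k arbitrary: f g)
  case (Suc k)
  have "pd i (\<lambda>y. f y + g y) = (\<lambda>x. pd i f x + pd i g x)" for i
    using Suc.prems by (intro ext pd_add) auto
  then show ?case using Suc by (auto intro: differentiable_add)
qed (auto intro: continuous_on_add)

lemma C_k_linear: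
  assumes "bounded_linear L"
  shows "C_k k f \<Longrightarrow> C_k k (\<lambda>x. L (f x))"
proof (induction k arbitrary: f)
  case 0
  then show ?case
    using bounded_linear.continuous_on[OF assms, of UNIV f] by simp
next
  case (Suc k)
  have "pd i (\<lambda>y. L (f y)) = (\<lambda>x. L (pd i f x))" for i
    using Suc.prems by (intro ext pd_linear assms) auto
  moreover have "(\<lambda>y. L (f y)) differentiable (at x)" for x
    using bounded_linear.has_derivative[OF assms differentiable_has_derivative[of f x]] Suc.prems
    by (auto simp: differentiable_def)
  ultimately show ?case using Suc by auto
qed

lemma C_k_sum: "(\<And>i. i \<in> I \<Longrightarrow> C_k k (f i)) \<Longrightarrow> C_k k (\<lambda>x. \<Sum>i\<in>I. f i x)"
  by (induction I rule: infinite_finite_induct) (auto simp: C_k_const C_k_add)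

lemma C_k_SucD: "C_k (Suc k) f \<Longrightarrow> C_k k f"
proof (induction k arbitrary: f)
  case 0
  then show ?case
    by (simp add: continuous_on_eq_continuous_at differentiable_imp_continuous_within)
qed simp

lemma C_k_scaleR:
  fixes f :: "real^'n \<Rightarrow> real"
  shows "C_k k f \<Longrightarrow> C_k k g \<Longrightarrow> C_k k (\<lambda>x. f x *\<^sub>R g x)"
proof (induction k arbitrary: f g)
  case 0
  then show ?case by (simp add: continuous_on_scaleR)
next
  case (Suc k)
  have "pd i (\<lambda>y. f y *\<^sub>R g y) = (\<lambda>x. f x *\<^sub>R pd i g x + pd i f x *\<^sub>R g x)" for i
    using Suc.prems by (intro ext pd_scaleR) auto
  moreover have "(\<lambda>y. f y *\<^sub>R g y) differentiable (at x)" for x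
    using Suc.prems by (intro differentiable_scaleR) auto
  moreover have "C_k k (\<lambda>x. f x *\<^sub>R pd i g x + pd i f x *\<^sub>R g x)" for i
    using Suc.prems C_k_SucD[OF Suc.prems(1)] C_k_SucD[OF Suc.prems(2)]
    by (intro C_k_add Suc.IH) auto
  ultimately show ?case by simp
qed

text \<open>The derivatives of sine and cosine of \<open>f\<close> are products of the two with derivatives of \<open>f\<close>, so
  that both claims have to go through the induction together.\<close>

lemma C_k_sin_cos:
  fixes f :: "real^'n \<Rightarrow> real"
  assumes "C_infinity f"
  shows "C_k k (\<lambda>x. sin (f x)) \<and> C_k k (\<lambda>x. cos (f x))"
proof (induction k)
  case 0
  then show ?case
    using C_infinity_continuous[OF assms] by (auto intro!: continuous_intros)
next
  case (Suc k)
  note f' = differentiable_has_derivative[OF C_infinity_differentiable[OF assms]]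
  have ds: "((\<lambda>x. sin (f x)) has_derivative (\<lambda>h. frechet_derivative f (at x) h * cos (f x))) (at x)" for x
    by (rule has_derivative_sin[OF f'])
  have dc: "((\<lambda>x. cos (f x)) has_derivative (\<lambda>h. frechet_derivative f (at x) h * - sin (f x))) (at x)" for x
    by (rule has_derivative_cos[OF f'])
  have "pd i (\<lambda>x. sin (f x)) = (\<lambda>x. cos (f x) *\<^sub>R pd i f x)"
    "pd i (\<lambda>x. cos (f x)) = (\<lambda>x. - (sin (f x) *\<^sub>R pd i f x))" for i
    using pd_eqI[OF ds] pd_eqI[OF dc] by (auto simp: pd_def mult.commute)
  moreover have "C_k k (\<lambda>x. cos (f x) *\<^sub>R pd i f x)" "C_k k (\<lambda>x. - (sin (f x) *\<^sub>R pd i f x))" for i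
    using Suc C_infinity_pd[OF assms]
    by (auto intro!: C_k_scaleR C_k_linear[OF bounded_linear_minus[OF bounded_linear_ident]]
        simp del: real_scaleR_def)
  moreover have "(\<lambda>x. sin (f x)) differentiable (at x)" "(\<lambda>x. cos (f x)) differentiable (at x)" for x
    using ds dc unfolding differentiable_def by blast+
  ultimately show ?case by simp
qed

lemma C_infinity_prod:
  fixes f :: "'i \<Rightarrow> real^'n \<Rightarrow> real"
  assumes "\<And>i. i \<in> I \<Longrightarrow> C_infinity (f i)"
  shows "C_infinity (\<lambda>x. \<Prod>i\<in>I. f i x)"
  using assms
proof (induction I rule: infinite_finite_induct)
  case (insert i I)
  then show ?case
    using C_k_scaleR[of _ "f i" "\<lambda>x. \<Prod>i\<in>I. f i x"] by simp
qed (simp_all add: C_k_const)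

lemma bounded_linear_axis: "bounded_linear (axis i :: 'b::real_normed_vector \<Rightarrow> 'b^'n)"
proof
  show "axis i (x + y) = axis i x + axis i y" for x y :: 'b
    by (simp add: vec_eq_iff axis_def)
  show "axis i (r *\<^sub>R x) = r *\<^sub>R axis i x" for r and x :: 'b
    by (simp add: vec_eq_iff axis_def)
  have "norm (axis i x) \<le> norm x * 1" for x :: 'b
  proof -
    have "norm (axis i x) \<le> (\<Sum>j\<in>UNIV. norm (axis i x $ j))"
      unfolding norm_vec_def by (rule L2_set_le_sum) simp
    also have "\<dots> = (\<Sum>j\<in>UNIV. if j = i then norm x else 0)"
      by (intro sum.cong) (auto simp: axis_def)
    finally show ?thesis by simp
  qed
  then show "\<exists>K. \<forall>x :: 'b. norm (axis i x) \<le> norm x * K" by blast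
qed

text \<open>A field of vectors is the sum of its embedded components, so linear maps and sums suffice.\<close>

lemma C_k_vec:
  assumes "\<And>j. C_k k (f j)"
  shows "C_k k (\<lambda>x. \<chi> j. f j x)"
proof -
  have "(\<chi> j. f j x) = (\<Sum>j\<in>UNIV. axis j (f j x))" for x
    by (simp add: vec_eq_iff axis_def)
  then show ?thesis
    using assms by (simp add: C_k_sum C_k_linear[OF bounded_linear_axis])
qed

lemma C_infinity_component:
  assumes "C_infinity f"
  shows "C_infinity (\<lambda>x. f x $ i)"
  using assms C_k_linear[OF bounded_linear_vec_nth] by blast

lemma has_real_derivative_along_axis:
  fixes f :: "real^'n \<Rightarrow> real"
  assumes "f differentiable (at (y + s *\<^sub>R axis i 1))"
  shows "((\<lambda>s. f (y + s *\<^sub>R axis i 1)) has_real_derivative pd i f (y + s *\<^sub>R axis i 1)) (at s)"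
proof -
  let ?D = "frechet_derivative f (at (y + s *\<^sub>R axis i 1))"
  have D: "(f has_derivative ?D) (at (y + s *\<^sub>R axis i 1))"
    using assms by (rule differentiable_has_derivative)
  have "((\<lambda>s. y + s *\<^sub>R axis i 1) has_derivative (\<lambda>h. h *\<^sub>R axis i 1)) (at s)"
    by (auto intro!: derivative_eq_intros)
  from has_derivative_compose[OF this D]
  have "((\<lambda>s. f (y + s *\<^sub>R axis i 1)) has_derivative (\<lambda>h. ?D (h *\<^sub>R axis i 1))) (at s)" .
  moreover have "?D (h *\<^sub>R axis i 1) = pd i f (y + s *\<^sub>R axis i 1) * h" for h
    using linear_cmul[OF has_derivative_linear[OF D]] by (simp add: pd_def)
  ultimately show ?thesis
    by (simp add: has_field_derivative_def)
qed

text \<open>The second difference of \<open>f\<close> over a small square is a value of either mixed second derivative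
  near the corner: this is the classical source of their symmetry.\<close>

lemma second_difference_mean_value:
  fixes f :: "real^'n \<Rightarrow> real"
  assumes f: "C_infinity f" and h: "h > 0"
  obtains y where "norm (y - x) \<le> 2 * h"
    and "f (x + h *\<^sub>R axis i 1 + h *\<^sub>R axis j 1) - f (x + h *\<^sub>R axis i 1)
       - (f (x + h *\<^sub>R axis j 1) - f x) = h * (h * pd j (pd i f) y)"
proof -
  define g where "g s = f ((x + h *\<^sub>R axis j 1) + s *\<^sub>R axis i 1) - f (x + s *\<^sub>R axis i 1)" for s
  have dg: "(g has_real_derivative
      pd i f ((x + h *\<^sub>R axis j 1) + s *\<^sub>R axis i 1) - pd i f (x + s *\<^sub>R axis i 1)) (at s)" for s
    unfolding g_def
    by (intro DERIV_diff has_real_derivative_along_axis C_infinity_differentiable f)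
  obtain s where s: "0 < s" "s < h" "g h - g 0 =
      (h - 0) * (pd i f ((x + h *\<^sub>R axis j 1) + s *\<^sub>R axis i 1) - pd i f (x + s *\<^sub>R axis i 1))"
    using MVT2[OF h dg] by blast
  have dk: "((\<lambda>r. pd i f ((x + s *\<^sub>R axis i 1) + r *\<^sub>R axis j 1)) has_real_derivative
      pd j (pd i f) ((x + s *\<^sub>R axis i 1) + r *\<^sub>R axis j 1)) (at r)" for r
    by (intro has_real_derivative_along_axis C_infinity_differentiable C_infinity_pd f)
  obtain r where r: "0 < r" "r < h" "pd i f ((x + s *\<^sub>R axis i 1) + h *\<^sub>R axis j 1)
      - pd i f ((x + s *\<^sub>R axis i 1) + 0 *\<^sub>R axis j 1) =
      (h - 0) * pd j (pd i f) ((x + s *\<^sub>R axis i 1) + r *\<^sub>R axis j 1)"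
    using MVT2[OF h dk] by blast
  let ?y = "(x + s *\<^sub>R axis i 1) + r *\<^sub>R axis j 1"
  have "norm (?y - x) \<le> norm (s *\<^sub>R (axis i 1 :: real^'n)) + norm (r *\<^sub>R (axis j 1 :: real^'n))"
    using norm_triangle_ineq[of "s *\<^sub>R (axis i 1 :: real^'n)" "r *\<^sub>R axis j 1"]
    by (simp add: algebra_simps)
  also have "\<dots> \<le> 2 * h" using s r by simp
  finally have "norm (?y - x) \<le> 2 * h" .
  moreover have "f (x + h *\<^sub>R axis i 1 + h *\<^sub>R axis j 1) - f (x + h *\<^sub>R axis i 1)
       - (f (x + h *\<^sub>R axis j 1) - f x) = h * (h * pd j (pd i f) ?y)"
    using s(3) r(3) by (simp add: g_def algebra_simps)
  ultimately show thesis using that by blast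
qed

text \<open>The second difference is symmetric in the two directions. Hence both mixed derivatives take equal
  values at points tending to \<open>x\<close>, and they are continuous.\<close>

lemma pd_commute:
  fixes f :: "real^'n \<Rightarrow> real"
  assumes f: "C_infinity f"
  shows "pd j (pd i f) x = pd i (pd j f) x"
proof -
  define h where "h n = 1 / real (Suc n)" for n
  have h: "h n > 0" for n by (simp add: h_def)
  have h0: "(\<lambda>n. 2 * h n) \<longlonglongrightarrow> 0"
    unfolding h_def using tendsto_mult_right_zero[OF LIMSEQ_inverse_real_of_nat]
    by (simp add: inverse_eq_divide)
  define \<Delta> where "\<Delta> n = f (x + h n *\<^sub>R axis i 1 + h n *\<^sub>R axis j 1) - f (x + h n *\<^sub>R axis i 1)
       - (f (x + h n *\<^sub>R axis j 1) - f x)" for n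
  have "\<exists>y. norm (y - x) \<le> 2 * h n \<and> \<Delta> n = h n * (h n * pd j (pd i f) y)" for n
    unfolding \<Delta>_def by (rule second_difference_mean_value[OF f h]) blast
  then obtain y where y: "\<And>n. norm (y n - x) \<le> 2 * h n"
      "\<And>n. \<Delta> n = h n * (h n * pd j (pd i f) (y n))"
    by metis
  have "\<exists>y. norm (y - x) \<le> 2 * h n \<and> \<Delta> n = h n * (h n * pd i (pd j f) y)" for n
  proof -
    obtain z where "norm (z - x) \<le> 2 * h n" and
      "f (x + h n *\<^sub>R axis j 1 + h n *\<^sub>R axis i 1) - f (x + h n *\<^sub>R axis j 1)
       - (f (x + h n *\<^sub>R axis i 1) - f x) = h n * (h n * pd i (pd j f) z)"
      using second_difference_mean_value[OF f h] by metis
    then show ?thesis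
      unfolding \<Delta>_def by (intro exI[of _ z]) (simp add: algebra_simps)
  qed
  then obtain z where z: "\<And>n. norm (z n - x) \<le> 2 * h n"
      "\<And>n. \<Delta> n = h n * (h n * pd i (pd j f) (z n))"
    by metis
  have lim: "(\<lambda>n. pd a (pd b f) (w n)) \<longlonglongrightarrow> pd a (pd b f) x"
    if "\<And>n. norm (w n - x) \<le> 2 * h n" for a b and w :: "nat \<Rightarrow> real^'n"
  proof -
    have "w \<longlonglongrightarrow> x"
    proof (rule LIM_zero_cancel)
      show "(\<lambda>n. w n - x) \<longlonglongrightarrow> 0"
        using that by (intro Lim_null_comparison[OF _ h0] always_eventually) blast
    qed
    moreover have "isCont (pd a (pd b f)) x"
      using C_infinity_continuous[OF C_infinity_pd[OF C_infinity_pd[OF f]]]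
      by (simp add: continuous_on_eq_continuous_at)
    ultimately show ?thesis by (rule isCont_tendsto_compose[rotated])
  qed
  have "pd j (pd i f) (y n) = pd i (pd j f) (z n)" for n
    using y(2)[of n] z(2)[of n] h[of n] by simp
  then have "(\<lambda>n. pd i (pd j f) (z n)) \<longlonglongrightarrow> pd j (pd i f) x"
    using lim[of y j i, OF y(1)] by simp
  then show ?thesis
    using lim[of z i j, OF z(1)] by (rule LIMSEQ_unique)
qed

section \<open>Test fields\<close>

lemma test_fields_C_infinity: "\<phi> \<in> test_fields \<Omega> \<Longrightarrow> C_infinity \<phi>"
  by (simp add: test_fields_def)

text \<open>Everything built locally from a test field inherits its support condition.\<close>

lemma test_fieldsI:
  assumes "\<phi> \<in> test_fields \<Omega>" "C_infinity g"
    and "\<And>x. x \<notin> closure {x. \<phi> x \<noteq> 0} \<Longrightarrow> g x = 0"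
  shows "g \<in> test_fields \<Omega>"
proof -
  have "closure {x. g x \<noteq> 0} \<subseteq> closure {x. \<phi> x \<noteq> 0}"
    using assms(3) by (intro closure_minimal) auto
  moreover have "compact (closure {x. \<phi> x \<noteq> 0})" "closure {x. \<phi> x \<noteq> 0} \<subseteq> \<Omega>"
    using assms(1) by (auto simp: test_fields_def)
  ultimately show ?thesis
    using assms(2) compact_Int_closed[of "closure {x. \<phi> x \<noteq> 0}" "closure {x. g x \<noteq> 0}"]
    by (auto simp: test_fields_def Int_absorb1)
qed

lemma pd_eq_0_off_support:
  assumes "x \<notin> closure {x. f x \<noteq> 0}"
  shows "pd i f x = 0"
proof -
  have "(f has_derivative (\<lambda>h. 0)) (at x)"
  proof (rule has_derivative_transform_within_open[of "\<lambda>x. 0"])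
    show "open (- closure {x. f x \<noteq> 0})" by (intro open_Compl closed_closure)
    show "0 = f y" if "y \<in> - closure {x. f x \<noteq> 0}" for y
      using that closure_subset[of "{x. f x \<noteq> 0}"] by fastforce
  qed (use assms in auto)
  from pd_eqI[OF this] show ?thesis by simp
qed

lemma component_eq_0_off_support:
  fixes \<Phi> :: "real^'n \<Rightarrow> 'b::real_normed_vector^'m"
  assumes "x \<notin> closure {x. \<Phi> x \<noteq> 0}"
  shows "x \<notin> closure {x. \<Phi> x $ j \<noteq> 0}"
proof -
  have "{x. \<Phi> x $ j \<noteq> 0} \<subseteq> {x. \<Phi> x \<noteq> 0}" by auto
  then show ?thesis using assms closure_mono by blast
qed

lemma test_fields_linear:
  assumes "bounded_linear L" "\<phi> \<in> test_fields \<Omega>"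
  shows "(\<lambda>x. L (\<phi> x)) \<in> test_fields \<Omega>"
proof (rule test_fieldsI[OF assms(2)])
  show "C_infinity (\<lambda>x. L (\<phi> x))"
    using C_k_linear[OF assms(1)] test_fields_C_infinity[OF assms(2)] by blast
  show "L (\<phi> x) = 0" if "x \<notin> closure {x. \<phi> x \<noteq> 0}" for x
  proof -
    have "\<phi> x = 0" using that closure_subset[of "{x. \<phi> x \<noteq> 0}"] by blast
    then show ?thesis by (simp add: linear_simps(3)[OF assms(1)])
  qed
qed

lemma test_fields_grad:
  assumes "\<phi> \<in> test_fields \<Omega>"
  shows "grad \<phi> \<in> test_fields \<Omega>"
proof (rule test_fieldsI[OF assms])
  show "C_infinity (grad \<phi>)"
    unfolding grad_def using C_infinity_pd[OF test_fields_C_infinity[OF assms]]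
    by (auto intro!: C_k_vec)
qed (simp add: grad_def pd_eq_0_off_support vec_eq_iff)

lemma test_fields_dvg:
  assumes "\<Phi> \<in> test_fields \<Omega>"
  shows "dvg \<Phi> \<in> test_fields \<Omega>"
proof (rule test_fieldsI[OF assms])
  show "C_infinity (dvg \<Phi>)"
    unfolding dvg_def
    using C_infinity_pd[OF C_infinity_component[OF test_fields_C_infinity[OF assms]]]
    by (auto intro!: C_k_sum)
  show "dvg \<Phi> x = 0" if "x \<notin> closure {x. \<Phi> x \<noteq> 0}" for x
    unfolding dvg_def
    by (intro sum.neutral ballI pd_eq_0_off_support component_eq_0_off_support that)
qed

lemma test_fields_uminus: "\<phi> \<in> test_fields \<Omega> \<Longrightarrow> (\<lambda>x. - \<phi> x) \<in> test_fields \<Omega>"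
  by (rule test_fields_linear[OF bounded_linear_minus[OF bounded_linear_ident]])

lemma test_fields_grad_adj: "\<Phi> \<in> test_fields \<Omega> \<Longrightarrow> grad_adj \<Phi> \<in> test_fields \<Omega>"
  unfolding grad_adj_def by (intro test_fields_uminus test_fields_dvg)

lemma test_fields_dvg_adj: "\<phi> \<in> test_fields \<Omega> \<Longrightarrow> dvg_adj \<phi> \<in> test_fields \<Omega>"
  unfolding dvg_adj_def by (intro test_fields_uminus test_fields_grad)

lemma C_infinity_diff: "C_infinity f \<Longrightarrow> C_infinity g \<Longrightarrow> C_infinity (\<lambda>x. f x - g x)"
  using C_k_add[of _ f "\<lambda>x. - g x"] C_k_linear[OF bounded_linear_minus[OF bounded_linear_ident], of _ g]
  by simp

lemma vector3_eq_chi: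
  "vector [a, b, c] = (\<chi> i :: 3. if i = 1 then a else if i = 2 then b else c)"
  by (simp add: vec_eq_iff forall_3)

lemma test_fields_curl:
  assumes "\<phi> \<in> test_fields \<Omega>"
  shows "curl \<phi> \<in> test_fields \<Omega>"
proof (rule test_fieldsI[OF assms])
  have *: "C_infinity (\<lambda>x. pd i (\<lambda>y. \<phi> y $ j) x - pd k (\<lambda>y. \<phi> y $ l) x)" for i j k l
    by (intro C_infinity_diff C_infinity_pd C_infinity_component test_fields_C_infinity[OF assms])
  have **: "C_k m (\<lambda>x. if i = 1 then pd 2 (\<lambda>y. \<phi> y $ 3) x - pd 3 (\<lambda>y. \<phi> y $ 2) x
      else if i = 2 then pd 3 (\<lambda>y. \<phi> y $ 1) x - pd 1 (\<lambda>y. \<phi> y $ 3) x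
      else pd 1 (\<lambda>y. \<phi> y $ 2) x - pd 2 (\<lambda>y. \<phi> y $ 1) x)" for m and i :: 3
    using * by (cases "i = 1"; cases "i = 2") simp_all
  show "C_infinity (curl \<phi>)"
    unfolding curl_def vector3_eq_chi using ** by (intro allI C_k_vec)
  show "curl \<phi> x = 0" if "x \<notin> closure {x. \<phi> x \<noteq> 0}" for x
    using pd_eq_0_off_support[OF component_eq_0_off_support[OF that]]
    by (simp add: curl_def vec_eq_iff forall_3)
qed

lemma test_fields_L2:
  fixes \<phi> :: "real^'n \<Rightarrow> 'b::euclidean_space"
  assumes "open \<Omega>" "bounded \<Omega>" "\<phi> \<in> test_fields \<Omega>"
  shows "\<phi> \<in> L2 \<Omega>"
proof -
  have meas: "\<phi> \<in> borel_measurable (lebesgue_on \<Omega>)"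
    using C_infinity_continuous[OF test_fields_C_infinity[OF assms(3)]] assms(1)
    by (intro continuous_imp_measurable_on_sets_lebesgue)
       (auto intro: continuous_on_subset borel_open)
  interpret finite_measure "lebesgue_on \<Omega>"
    using assms(1,2) by (intro finite_measure_lebesgue_on lmeasurable_open)
  have "compact (\<phi> ` closure {x. \<phi> x \<noteq> 0})"
    using C_infinity_continuous[OF test_fields_C_infinity[OF assms(3)]] assms(3)
    by (intro compact_continuous_image) (auto intro: continuous_on_subset simp: test_fields_def)
  then obtain B where B: "\<And>y. y \<in> \<phi> ` closure {x. \<phi> x \<noteq> 0} \<Longrightarrow> norm y \<le> B"
    using compact_imp_bounded bounded_iff by metis
  have "norm (\<phi> x) \<le> \<bar>B\<bar>" for x
  proof (cases "\<phi> x = 0")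
    case False
    then have "x \<in> closure {x. \<phi> x \<noteq> 0}" using closure_subset[of "{x. \<phi> x \<noteq> 0}"] by blast
    then show ?thesis using B[of "\<phi> x"] by fastforce
  qed simp
  then have "norm ((norm (\<phi> x))\<^sup>2) \<le> \<bar>B\<bar>\<^sup>2" for x
    using power_mono[of "norm (\<phi> x)" "\<bar>B\<bar>" 2] by simp
  then have "integrable (lebesgue_on \<Omega>) (\<lambda>x. (norm (\<phi> x))\<^sup>2)"
    using meas by (intro integrable_const_bound[where B = "\<bar>B\<bar>\<^sup>2"]) (auto, measurable)
  with meas show ?thesis by (simp add: L2_def)
qed

lemma dvg_curl_eq_0:
  assumes "C_infinity \<phi>"
  shows "dvg (curl \<phi>) x = 0"
proof -
  have c: "C_infinity (pd i (\<lambda>y. \<phi> y $ j))" for i j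
    by (intro C_infinity_pd C_infinity_component assms)
  have d: "pd i (\<lambda>x. pd k (\<lambda>y. \<phi> y $ l) x - pd m (\<lambda>y. \<phi> y $ n) x) x
      = pd i (pd k (\<lambda>y. \<phi> y $ l)) x - pd i (pd m (\<lambda>y. \<phi> y $ n)) x" for i k l m n
    using pd_eqI[OF has_derivative_diff[OF
        differentiable_has_derivative[OF C_infinity_differentiable[OF c]]
        differentiable_has_derivative[OF C_infinity_differentiable[OF c]]]]
    by (simp add: pd_def)
  show ?thesis
    using pd_commute[OF C_infinity_component[OF assms], of 1 2 3 x]
      pd_commute[OF C_infinity_component[OF assms], of 2 3 1 x]
      pd_commute[OF C_infinity_component[OF assms], of 1 3 2 x]
    by (simp add: dvg_def curl_def sum_3 d)
qed

lemma curl_grad_eq_0: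
  assumes "C_infinity (\<phi> :: real^3 \<Rightarrow> real)"
  shows "curl (grad \<phi>) x = 0"
  using pd_commute[OF assms] by (simp add: curl_def grad_def vec_eq_iff forall_3)

lemma bounded_linear_perp: "bounded_linear perp"
proof -
  have "linear perp"
    by (rule linearI) (simp_all add: perp_def vec_eq_iff forall_2)
  then show ?thesis by (simp add: linear_conv_bounded_linear)
qed

lemma dvg_perp_grad_eq_0:
  assumes "C_infinity (\<phi> :: real^2 \<Rightarrow> real)"
  shows "dvg (\<lambda>y. perp (grad \<phi> y)) x = 0"
proof -
  have "pd 1 (\<lambda>y. - pd 2 \<phi> y) x = - pd 1 (pd 2 \<phi>) x"
    using assms
    by (intro pd_linear[OF bounded_linear_minus[OF bounded_linear_ident]] C_infinity_differentiable
        C_infinity_pd)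
  then show ?thesis
    using pd_commute[OF assms, of 1 2 x]
    by (simp add: dvg_def perp_def grad_def sum_2)
qed

section \<open>Bump functions and the fundamental lemma of the calculus of variations\<close>

text \<open>The functions \<open>exp(-\<epsilon>/y)/y^n\<close>, extended by zero to \<open>y \<le> 0\<close>, are closed under
  differentiation up to linear combinations, which makes their smoothness a direct induction.\<close>

definition flat_exp :: "real \<Rightarrow> nat \<Rightarrow> real \<Rightarrow> real" where
  "flat_exp \<epsilon> n y = (if y > 0 then exp (- \<epsilon> * inverse y) * inverse y ^ n else 0)"

text \<open>The bound comes from \<open>exp z = exp (z/m)^m \<ge> (z/m)^m\<close> with \<open>m = n + 2\<close>. A quadratic bound is what
  is needed for the derivative at the origin to vanish.\<close>

lemma flat_exp_le_square:
  assumes "\<epsilon> > 0"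
  shows "\<bar>flat_exp \<epsilon> n y\<bar> \<le> (real (n + 2) / \<epsilon>) ^ (n + 2) * y\<^sup>2"
proof (cases "y > 0")
  case True
  let ?m = "n + 2"
  have "\<epsilon> * inverse y / real ?m \<le> exp (\<epsilon> * inverse y / real ?m)"
    using exp_ge_add_one_self[of "\<epsilon> * inverse y / real ?m"] by linarith
  then have "(\<epsilon> * inverse y / real ?m) ^ ?m \<le> exp (\<epsilon> * inverse y / real ?m) ^ ?m"
    using True assms by (intro power_mono) auto
  also have "\<dots> = exp (\<epsilon> * inverse y)"
    by (rule exp_divide_power_eq) simp
  finally have "inverse (exp (\<epsilon> * inverse y)) \<le> inverse ((\<epsilon> * inverse y / real ?m) ^ ?m)"
    using True assms by (intro le_imp_inverse_le zero_less_power) auto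
  also have "inverse ((\<epsilon> * inverse y / real ?m) ^ ?m) = (inverse (\<epsilon> * inverse y / real ?m)) ^ ?m"
    by (rule power_inverse[symmetric])
  also have "inverse (\<epsilon> * inverse y / real ?m) = real ?m / \<epsilon> * y"
    using True assms by (simp add: field_simps)
  also have "(real ?m / \<epsilon> * y) ^ ?m = (real ?m / \<epsilon>) ^ ?m * y ^ ?m"
    by (rule power_mult_distrib)
  finally have "exp (- \<epsilon> * inverse y) \<le> (real ?m / \<epsilon>) ^ ?m * y ^ ?m"
    by (simp add: exp_minus)
  then have "exp (- \<epsilon> * inverse y) * inverse y ^ n \<le> (real ?m / \<epsilon>) ^ ?m * y ^ ?m * inverse y ^ n"
    using True by (intro mult_right_mono) auto
  also have "\<dots> = (real ?m / \<epsilon>) ^ ?m * y\<^sup>2"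
  proof -
    have "y ^ ?m * inverse y ^ n = y\<^sup>2"
      using True by (simp add: power_add power_inverse del: power_Suc add_2_eq_Suc')
    then show ?thesis by (simp only: mult.assoc)
  qed
  finally show ?thesis using True by (simp add: flat_exp_def)
qed (use assms in \<open>simp add: flat_exp_def\<close>)

lemma flat_exp_has_derivative:
  assumes "\<epsilon> > 0"
  shows "(flat_exp \<epsilon> n has_real_derivative
           \<epsilon> * flat_exp \<epsilon> (n + 2) y - real n * flat_exp \<epsilon> (n + 1) y) (at y)"
proof (cases y "0::real" rule: linorder_cases)
  case greater
  have "((\<lambda>y. exp (- \<epsilon> * inverse y) * inverse y ^ n) has_real_derivative
      \<epsilon> * flat_exp \<epsilon> (n + 2) y - real n * flat_exp \<epsilon> (n + 1) y) (at y)"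
  proof -
    have "((\<lambda>y. exp (- \<epsilon> * inverse y)) has_real_derivative
        exp (- \<epsilon> * inverse y) * (\<epsilon> * (inverse y)\<^sup>2)) (at y)"
      using greater by (auto intro!: derivative_eq_intros simp: power2_eq_square)
    moreover have "((\<lambda>y. inverse y ^ n) has_real_derivative - (real n * inverse y ^ (n + 1))) (at y)"
    proof -
      have "((\<lambda>y. inverse y ^ n) has_real_derivative
          real n * (- (inverse y ^ Suc (Suc 0)) * inverse y ^ (n - Suc 0))) (at y)"
        using greater by (intro DERIV_power DERIV_inverse) simp
      moreover have "real n * (- (inverse y ^ Suc (Suc 0)) * inverse y ^ (n - Suc 0))
          = - (real n * inverse y ^ (n + 1))"
        by (cases n) (simp_all add: mult_ac)
      ultimately show ?thesis by (simp only:)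
    qed
    ultimately have "((\<lambda>y. exp (- \<epsilon> * inverse y) * inverse y ^ n) has_real_derivative
        exp (- \<epsilon> * inverse y) * (\<epsilon> * (inverse y)\<^sup>2) * inverse y ^ n
        + - (real n * inverse y ^ (n + 1)) * exp (- \<epsilon> * inverse y)) (at y)"
      by (rule DERIV_mult)
    then show ?thesis
      using greater by (simp add: flat_exp_def power2_eq_square mult_ac)
  qed
  then show ?thesis
    by (rule has_field_derivative_transform_within_open[where S = "{0<..}"])
       (use greater in \<open>simp_all add: flat_exp_def\<close>)
next
  case less
  have "((\<lambda>y. 0) has_real_derivative
      \<epsilon> * flat_exp \<epsilon> (n + 2) y - real n * flat_exp \<epsilon> (n + 1) y) (at y)"
    using less by (simp add: flat_exp_def)
  then show ?thesis
    by (rule has_field_derivative_transform_within_open[where S = "{..<0}"])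
       (use less in \<open>simp_all add: flat_exp_def\<close>)
next
  case equal
  let ?C = "(real (n + 2) / \<epsilon>) ^ (n + 2)"
  have "(\<lambda>h. (flat_exp \<epsilon> n (0 + h) - flat_exp \<epsilon> n 0) / h) \<midarrow>0\<rightarrow> 0"
  proof (rule Lim_null_comparison)
    have "norm ((flat_exp \<epsilon> n (0 + h) - flat_exp \<epsilon> n 0) / h) \<le> ?C * \<bar>h\<bar>" if "h \<noteq> 0" for h
      using flat_exp_le_square[OF assms, of n h] that
      by (simp add: flat_exp_def divide_le_eq power2_eq_square mult.assoc)
    then show "\<forall>\<^sub>F h in at 0. norm ((flat_exp \<epsilon> n (0 + h) - flat_exp \<epsilon> n 0) / h) \<le> ?C * \<bar>h\<bar>"
      by (simp add: eventually_at_filter)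
    show "((\<lambda>h. ?C * \<bar>h\<bar>) \<longlongrightarrow> 0) (at 0)"
      by (intro tendsto_mult_right_zero tendsto_rabs_zero tendsto_ident_at)
  qed
  then have "(flat_exp \<epsilon> n has_real_derivative 0) (at 0)"
    by (simp add: DERIV_def)
  then show ?thesis using equal by (simp add: flat_exp_def)
qed

lemma C_k_flat_exp:
  assumes "\<epsilon> > 0"
  shows "C_k k (\<lambda>x :: real^'n. flat_exp \<epsilon> n (s * x $ i + c))"
proof (induction k arbitrary: n)
  case 0
  have "isCont (flat_exp \<epsilon> n) y" for y
    using flat_exp_has_derivative[OF assms] by (rule DERIV_isCont)
  then have "continuous_on UNIV (flat_exp \<epsilon> n)"
    by (simp add: continuous_on_eq_continuous_at)
  then show ?case
    by (auto intro!: continuous_on_compose2[of UNIV "flat_exp \<epsilon> n"] continuous_intros)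
next
  case (Suc k)
  let ?D = "\<lambda>x :: real^'n. \<epsilon> * flat_exp \<epsilon> (n + 2) (s * x $ i + c)
      - real n * flat_exp \<epsilon> (n + 1) (s * x $ i + c)"
  have d: "((\<lambda>x :: real^'n. flat_exp \<epsilon> n (s * x $ i + c)) has_derivative
      (\<lambda>h. ?D x * (s * h $ i))) (at x)" for x
  proof -
    have "((\<lambda>x :: real^'n. s * x $ i + c) has_derivative (\<lambda>h. s * h $ i)) (at x)"
      by (auto intro!: derivative_eq_intros bounded_linear.has_derivative[OF bounded_linear_vec_nth])
    from has_derivative_compose[OF this
        flat_exp_has_derivative[OF assms, of n, unfolded has_field_derivative_def]]
    show ?thesis .
  qed
  have "pd j (\<lambda>x :: real^'n. flat_exp \<epsilon> n (s * x $ i + c)) = (\<lambda>x. ?D x * (s * axis j 1 $ i))" for j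
    using pd_eqI[OF d] by blast
  moreover have "C_k k (\<lambda>x. ?D x * (s * axis j 1 $ i))" for j
  proof -
    have "C_k k (\<lambda>x :: real^'n. r * flat_exp \<epsilon> m (s * x $ i + c))" for r m
      by (intro C_k_linear[OF bounded_linear_mult_right] Suc.IH)
    from C_k_add[OF this[of \<epsilon> "n + 2"] this[of "- real n" "n + 1"]]
    have "C_k k ?D" by simp
    then show ?thesis by (intro C_k_linear[OF bounded_linear_mult_left])
  qed
  ultimately show ?case
    using d by (auto simp: differentiable_def)
qed

text \<open>The factors \<open>exp(-\<epsilon>/y)\<close> increase to one as \<open>\<epsilon>\<close> decreases to zero, so these functions
  approximate the indicator of the box from below. The arguments are in the form \<open>s * y + c\<close> for
  which smoothness of the factors is known.\<close>

definition box_bump :: "real \<Rightarrow> real^'n \<Rightarrow> real^'n \<Rightarrow> real^'n \<Rightarrow> real" where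
  "box_bump \<epsilon> a b x =
     (\<Prod>i\<in>UNIV. flat_exp \<epsilon> 0 (1 * x $ i + (- a $ i)) * flat_exp \<epsilon> 0 ((-1) * x $ i + b $ i))"

lemma box_bump_outside:
  assumes "x \<notin> box a b"
  shows "box_bump \<epsilon> a b x = 0"
proof -
  obtain i where "\<not> (a $ i < x $ i \<and> x $ i < b $ i)"
    using assms by (auto simp: mem_box_cart)
  then have "flat_exp \<epsilon> 0 (1 * x $ i + (- a $ i)) * flat_exp \<epsilon> 0 ((-1) * x $ i + b $ i) = 0"
    by (auto simp: flat_exp_def)
  then show ?thesis
    unfolding box_bump_def by (intro prod_zero) (auto intro: exI[of _ i])
qed

lemma flat_exp_0_bounds: "\<epsilon> > 0 \<Longrightarrow> 0 \<le> flat_exp \<epsilon> 0 y \<and> flat_exp \<epsilon> 0 y \<le> 1"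
  by (auto simp: flat_exp_def)

lemma box_bump_bounds:
  assumes "\<epsilon> > 0"
  shows "0 \<le> box_bump \<epsilon> a b x" "box_bump \<epsilon> a b x \<le> 1"
  unfolding box_bump_def using flat_exp_0_bounds[OF assms]
  by (auto intro!: prod_nonneg prod_le_1 mult_nonneg_nonneg mult_le_one)

lemma C_infinity_box_bump:
  fixes a b :: "real^'n"
  assumes "\<epsilon> > 0"
  shows "C_infinity (box_bump \<epsilon> a b)"
proof -
  have "C_infinity (\<lambda>x :: real^'n. flat_exp \<epsilon> 0 (1 * x $ i + (- a $ i)) *\<^sub>R flat_exp \<epsilon> 0 ((-1) * x $ i + b $ i))" for i
    by (intro allI C_k_scaleR C_k_flat_exp assms)
  then show ?thesis
    using C_infinity_prod[of UNIV "\<lambda>i (x :: real^'n). flat_exp \<epsilon> 0 (1 * x $ i + (- a $ i)) *\<^sub>R flat_exp \<epsilon> 0 ((-1) * x $ i + b $ i)"]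
    unfolding box_bump_def real_scaleR_def by blast
qed

lemma box_bump_test_field:
  fixes e :: "'b::real_normed_vector"
  assumes "\<epsilon> > 0" "cbox a b \<subseteq> \<Omega>"
  shows "(\<lambda>x. box_bump \<epsilon> a b x *\<^sub>R e) \<in> test_fields \<Omega>"
proof -
  let ?S = "{x. box_bump \<epsilon> a b x *\<^sub>R e \<noteq> 0}"
  have "?S \<subseteq> box a b" using box_bump_outside by fastforce
  then have "closure ?S \<subseteq> cbox a b"
    by (intro closure_minimal subset_trans[OF _ box_subset_cbox] closed_cbox)
  moreover have "compact (cbox a b \<inter> closure ?S)" by (intro compact_Int_closed) auto
  moreover have "C_infinity (\<lambda>x. box_bump \<epsilon> a b x *\<^sub>R e)"
    using C_k_linear[OF bounded_linear_scaleR_left] C_infinity_box_bump[OF assms(1)] by blast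
  ultimately show ?thesis using assms(2) by (auto simp: test_fields_def Int_absorb1)
qed

lemma box_bump_tendsto_indicator:
  "(\<lambda>m. box_bump (1 / real (Suc m)) a b x) \<longlonglongrightarrow> indicator (box a b) x"
proof (cases "x \<in> box a b")
  case True
  have "(\<lambda>m. flat_exp (1 / real (Suc m)) 0 y) \<longlonglongrightarrow> 1" if "y > 0" for y
  proof -
    have "(\<lambda>m. inverse (real (Suc m)) * inverse y) \<longlonglongrightarrow> 0"
      by (rule tendsto_mult_left_zero[OF LIMSEQ_inverse_real_of_nat])
    then have "(\<lambda>m. exp (- (inverse (real (Suc m)) * inverse y))) \<longlonglongrightarrow> exp (- 0)"
      by (intro tendsto_exp tendsto_minus)
    then show ?thesis using that by (simp add: flat_exp_def inverse_eq_divide)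
  qed
  then have "(\<lambda>m. box_bump (1 / real (Suc m)) a b x) \<longlonglongrightarrow> (\<Prod>i\<in>(UNIV :: 'a set). 1 * 1)"
    unfolding box_bump_def using True
    by (intro tendsto_prod tendsto_mult) (auto simp: mem_box_cart)
  then show ?thesis using True by simp
qed (simp add: box_bump_outside)

lemma L2_integrable:
  assumes "open \<Omega>" "bounded \<Omega>" "w \<in> L2 \<Omega>"
  shows "integrable (lebesgue_on \<Omega>) w"
proof -
  interpret finite_measure "lebesgue_on \<Omega>"
    using assms(1,2) by (intro finite_measure_lebesgue_on lmeasurable_open)
  have "integrable (lebesgue_on \<Omega>) (\<lambda>x. 1 + (norm (w x))\<^sup>2)"
    using assms(3) by (auto simp: L2_def)
  then show ?thesis
  proof (rule Bochner_Integration.integrable_bound)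
    show "w \<in> borel_measurable (lebesgue_on \<Omega>)"
      using assms(3) by (rule L2_measurable)
    have "norm (w x) \<le> norm (1 + (norm (w x))\<^sup>2)" for x
    proof -
      have "norm (w x) \<le> 1 + (norm (w x))\<^sup>2"
        using sum_squares_bound[of 1 "norm (w x)", simplified] norm_ge_zero[of "w x"] by linarith
      then show ?thesis by simp
    qed
    then show "AE x in lebesgue_on \<Omega>. norm (w x) \<le> norm (1 + (norm (w x))\<^sup>2)"
      by simp
  qed
qed

text \<open>Dominated convergence replaces the bump functions by the indicator of the open box; the boundary
  of the box is negligible.\<close>

lemma has_integral_box_0_if_orthogonal_to_test_fields:
  fixes w :: "real^'n \<Rightarrow> 'b::euclidean_space"
  assumes \<Omega>: "open \<Omega>" "bounded \<Omega>" and w: "w \<in> L2 \<Omega>"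
    and orth: "\<And>\<phi>. \<phi> \<in> test_fields \<Omega> \<Longrightarrow> l2_inner \<Omega> w \<phi> = 0"
    and ab: "cbox a b \<subseteq> \<Omega>"
  shows "((\<lambda>x. if x \<in> \<Omega> then w x else 0) has_integral 0) (cbox a b)"
proof -
  let ?M = "lebesgue_on \<Omega>"
  have int: "integrable ?M w" using L2_integrable[OF \<Omega> w] .
  have \<Omega>s: "\<Omega> \<in> sets lebesgue" using \<Omega> by (simp add: borel_open)
  have sub: "box a b \<subseteq> \<Omega>" using ab box_subset_cbox by blast
  have boxs: "box a b \<in> sets ?M"
    using sub \<Omega>s by (simp add: sets_restrict_space_iff)
  have meas: "(\<lambda>x. indicat_real (box a b) x *\<^sub>R w x) \<in> borel_measurable ?M"
    using boxs int by (intro borel_measurable_scaleR borel_measurable_indicator) auto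
  have g: "integrable ?M (\<lambda>x. indicat_real (box a b) x *\<^sub>R w x)"
    using boxs int by (intro integrable_mult_indicator)
  have "(\<integral>x. indicat_real (box a b) x *\<^sub>R w x \<partial>?M) \<bullet> e = 0" for e
  proof -
    have "(\<lambda>m. \<integral>x. w x \<bullet> (box_bump (1 / real (Suc m)) a b x *\<^sub>R e) \<partial>?M)
        \<longlonglongrightarrow> (\<integral>x. (indicat_real (box a b) x *\<^sub>R w x) \<bullet> e \<partial>?M)"
    proof (rule integral_dominated_convergence[where w = "\<lambda>x. norm (w x) * norm e"])
      show "(\<lambda>x. (indicat_real (box a b) x *\<^sub>R w x) \<bullet> e) \<in> borel_measurable ?M"
        using meas by (intro borel_measurable_inner) auto
      show "(\<lambda>x. w x \<bullet> (box_bump (1 / real (Suc m)) a b x *\<^sub>R e)) \<in> borel_measurable ?M" for m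
        using L2_measurable[OF w]
          L2_measurable[OF test_fields_L2[OF \<Omega> box_bump_test_field[OF _ ab]], of "1 / real (Suc m)"]
        by (intro borel_measurable_inner) auto
      show "integrable ?M (\<lambda>x. norm (w x) * norm e)" using int by simp
      have "(\<lambda>m. box_bump (1 / real (Suc m)) a b x * (w x \<bullet> e)) \<longlonglongrightarrow> indicator (box a b) x * (w x \<bullet> e)" for x
        by (intro tendsto_mult box_bump_tendsto_indicator tendsto_const)
      then show "AE x in ?M. (\<lambda>m. w x \<bullet> (box_bump (1 / real (Suc m)) a b x *\<^sub>R e))
          \<longlonglongrightarrow> (indicat_real (box a b) x *\<^sub>R w x) \<bullet> e"
        by simp
      have "norm (w x \<bullet> (box_bump (1 / real (Suc m)) a b x *\<^sub>R e)) \<le> norm (w x) * norm e" for m x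
      proof -
        have "\<bar>box_bump (1 / real (Suc m)) a b x\<bar> * \<bar>w x \<bullet> e\<bar> \<le> 1 * (norm (w x) * norm e)"
          using box_bump_bounds[of "1 / real (Suc m)" a b x]
          by (intro mult_mono Cauchy_Schwarz_ineq2) auto
        then show ?thesis by (simp add: abs_mult)
      qed
      then show "AE x in ?M. norm (w x \<bullet> (box_bump (1 / real (Suc m)) a b x *\<^sub>R e)) \<le> norm (w x) * norm e" for m
        by simp
    qed
    moreover have "(\<integral>x. w x \<bullet> (box_bump (1 / real (Suc m)) a b x *\<^sub>R e) \<partial>?M) = 0" for m
      using orth[OF box_bump_test_field[OF _ ab, of "1 / real (Suc m)" e]] by (simp add: l2_inner_def)
    ultimately have "(\<integral>x. (indicat_real (box a b) x *\<^sub>R w x) \<bullet> e \<partial>?M) = 0"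
      using LIMSEQ_unique[OF _ tendsto_const] by (simp only:)
    then show ?thesis using g by (subst integral_inner_left[symmetric]) auto
  qed
  then have "(\<integral>x. indicat_real (box a b) x *\<^sub>R w x \<partial>?M) = 0"
    using inner_eq_zero_iff by blast
  then have "((\<lambda>x. indicat_real (box a b) x *\<^sub>R w x) has_integral 0) \<Omega>"
    using has_integral_integral_lebesgue_on[OF g \<Omega>s] by simp
  then have "((\<lambda>x. if x \<in> \<Omega> then indicat_real (box a b) x *\<^sub>R w x else 0) has_integral 0) UNIV"
    by (simp only: has_integral_restrict_UNIV)
  also have "(\<lambda>x. if x \<in> \<Omega> then indicat_real (box a b) x *\<^sub>R w x else 0) =
      (\<lambda>x. if x \<in> box a b then (if x \<in> \<Omega> then w x else 0) else 0)"
    by (auto simp: indicator_def)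
  finally show ?thesis
    by (simp only: has_integral_restrict_UNIV has_integral_open_interval)
qed

text \<open>The averages of \<open>w\<close> over small cubes in \<open>\<Omega>\<close> vanish because bump functions approximate their
  indicators, and almost everywhere these averages converge to \<open>w\<close>.\<close>

lemma fundamental_lemma:
  fixes w :: "real^'n \<Rightarrow> 'b::euclidean_space"
  assumes \<Omega>: "open \<Omega>" "bounded \<Omega>" and w: "w \<in> L2 \<Omega>"
    and orth: "\<And>\<phi>. \<phi> \<in> test_fields \<Omega> \<Longrightarrow> l2_inner \<Omega> w \<phi> = 0"
  shows "AE x in lebesgue_on \<Omega>. w x = 0"
proof -
  let ?f = "\<lambda>x. if x \<in> \<Omega> then w x else 0"
  have \<Omega>s: "\<Omega> \<in> sets lebesgue" using \<Omega> by (simp add: borel_open)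
  have "?f integrable_on UNIV"
    using has_integral_integral_lebesgue_on[OF L2_integrable[OF \<Omega> w] \<Omega>s]
    by (simp add: integrable_restrict_UNIV) blast
  then have intf: "?f integrable_on cbox a b" for a b
    by (rule integrable_on_subcbox) simp
  obtain N where N: "negligible N" and lim: "\<And>x e. \<lbrakk>x \<notin> N; 0 < e\<rbrakk> \<Longrightarrow>
      \<exists>d>0. \<forall>h. 0 < h \<and> h < d \<longrightarrow>
        norm (integral (cbox x (x + h *\<^sub>R One)) ?f /\<^sub>R h ^ DIM(real^'n) - ?f x) < e"
    by (rule integrable_ccontinuous_explicit[OF intf]) (rule that, assumption+)
  have "w x = 0" if x: "x \<in> \<Omega>" "x \<notin> N" for x
  proof (rule ccontr)
    assume "w x \<noteq> 0"
    then obtain d where d: "d > 0" and small: "\<And>h. 0 < h \<Longrightarrow> h < d \<Longrightarrow>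
        norm (integral (cbox x (x + h *\<^sub>R One)) ?f /\<^sub>R h ^ DIM(real^'n) - ?f x) < norm (w x)"
      using lim[OF x(2), of "norm (w x)"] by auto
    obtain r where r: "r > 0" "cball x r \<subseteq> \<Omega>"
      using \<Omega>(1) x(1) open_contains_cball by metis
    define h where "h = min (d / 2) (r / DIM(real^'n))"
    have h: "0 < h" "h < d" "DIM(real^'n) * h \<le> r"
      using d r by (auto simp: h_def min_def field_simps)
    have "cbox x (x + h *\<^sub>R One) \<subseteq> cball x r"
    proof
      fix y assume y: "y \<in> cbox x (x + h *\<^sub>R One)"
      have "norm (y - x) \<le> (\<Sum>i\<in>Basis. \<bar>(y - x) \<bullet> i\<bar>)" by (rule norm_le_l1)
      also have "\<dots> \<le> (\<Sum>i\<in>(Basis :: (real^'n) set). h)"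
        using y by (intro sum_mono) (auto simp: mem_box inner_diff_left inner_add_left)
      also have "\<dots> \<le> r" using h by simp
      finally show "y \<in> cball x r" by (simp add: dist_norm norm_minus_commute)
    qed
    then have "cbox x (x + h *\<^sub>R One) \<subseteq> \<Omega>" using r by blast
    then have "integral (cbox x (x + h *\<^sub>R One)) ?f = 0"
      using has_integral_box_0_if_orthogonal_to_test_fields[OF \<Omega> w orth] by blast
    then show False using small[OF h(1,2)] x(1) by simp
  qed
  moreover have "N \<in> null_sets lebesgue" using N by (simp add: negligible_iff_null_sets)
  then have "AE x in lebesgue. x \<notin> N" by (rule AE_not_in)
  ultimately have "AE x in lebesgue. x \<in> \<Omega> \<longrightarrow> w x = 0"
    by (auto elim!: eventually_mono)
  then show ?thesis
    using \<Omega>s by (simp add: AE_restrict_space_iff)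
qed

section \<open>Weak differential operators\<close>

text \<open>The weak operators choose an arbitrary representative of their value, so that they are linear
  only up to null sets. Finite combinations on both sides make the notion directly applicable to the
  coefficients of a field in a basis.\<close>

definition ae_linear_on ::
  "(real^'n) set \<Rightarrow> (real^'n \<Rightarrow> 'b::euclidean_space) set \<Rightarrow>
   ((real^'n \<Rightarrow> 'b) \<Rightarrow> real^'n \<Rightarrow> 'c::euclidean_space) \<Rightarrow> bool" where
  "ae_linear_on \<Omega> V D \<longleftrightarrow> (\<forall>f\<in>V. D f \<in> L2 \<Omega>) \<and>
     (\<forall>(d::nat) b c f. (\<forall>i<d. b i \<in> V) \<longrightarrow> f \<in> V \<longrightarrow>
        (AE x in lebesgue_on \<Omega>. f x = (\<Sum>i<d. c i *\<^sub>R b i x)) \<longrightarrow>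
        (AE x in lebesgue_on \<Omega>. D f x = (\<Sum>i<d. c i *\<^sub>R D (b i) x)))"

lemma ae_linear_on_L2: "ae_linear_on \<Omega> V D \<Longrightarrow> f \<in> V \<Longrightarrow> D f \<in> L2 \<Omega>"
  by (simp add: ae_linear_on_def)

lemma ae_linear_on_sum:
  assumes "ae_linear_on \<Omega> V D" "\<And>i. i < d \<Longrightarrow> b i \<in> V" "f \<in> V"
    and "AE x in lebesgue_on \<Omega>. f x = (\<Sum>i<d::nat. c i *\<^sub>R b i x)"
  shows "AE x in lebesgue_on \<Omega>. D f x = (\<Sum>i<d. c i *\<^sub>R D (b i) x)"
  using assms unfolding ae_linear_on_def by blast

lemma ae_linear_on_combination:
  assumes D: "ae_linear_on \<Omega> V D" and V: "f \<in> V" "g \<in> V" "h \<in> V"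
    and h: "AE x in lebesgue_on \<Omega>. h x = a *\<^sub>R f x + b *\<^sub>R g x"
  shows "AE x in lebesgue_on \<Omega>. D h x = a *\<^sub>R D f x + b *\<^sub>R D g x"
proof -
  have "AE x in lebesgue_on \<Omega>. D h x =
      (\<Sum>i<2::nat. (if i = 0 then a else b) *\<^sub>R D (if i = 0 then f else g) x)"
    by (rule ae_linear_on_sum[OF D]) (use V h in \<open>auto simp: numeral_2_eq_2\<close>)
  then show ?thesis by (simp add: numeral_2_eq_2)
qed

lemma ae_linear_on_cong:
  assumes D: "ae_linear_on \<Omega> V D" and V: "f \<in> V" "g \<in> V"
    and fg: "AE x in lebesgue_on \<Omega>. f x = g x"
  shows "AE x in lebesgue_on \<Omega>. D f x = D g x"
  using ae_linear_on_combination[OF D V(2,2,1), of 1 0] fg by simp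

lemma ae_linear_on_zero:
  assumes D: "ae_linear_on \<Omega> V D" and V: "f \<in> V"
    and f: "AE x in lebesgue_on \<Omega>. f x = 0"
  shows "AE x in lebesgue_on \<Omega>. D f x = 0"
  using ae_linear_on_combination[OF D V V V, of 0 0] f by simp

lemma ae_linear_on_compose:
  assumes L: "bounded_linear L" and D: "ae_linear_on \<Omega> V D"
  shows "ae_linear_on \<Omega> V (\<lambda>f x. L (D f x))"
  unfolding ae_linear_on_def
proof (intro conjI ballI allI impI)
  fix f assume "f \<in> V"
  then show "(\<lambda>x. L (D f x)) \<in> L2 \<Omega>"
    using L2_linear[OF L] ae_linear_on_L2[OF D] by blast
next
  fix d :: nat and b c f
  assume "\<forall>i<d. b i \<in> V" "f \<in> V" "AE x in lebesgue_on \<Omega>. f x = (\<Sum>i<d. c i *\<^sub>R b i x)"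
  then have "AE x in lebesgue_on \<Omega>. D f x = (\<Sum>i<d. c i *\<^sub>R D (b i) x)"
    using ae_linear_on_sum[OF D] by blast
  then show "AE x in lebesgue_on \<Omega>. L (D f x) = (\<Sum>i<d. c i *\<^sub>R L (D (b i) x))"
    by eventually_elim
       (simp add: linear_sum[OF bounded_linear.linear[OF L]] linear_cmul[OF bounded_linear.linear[OF L]])
qed

text \<open>The assumption on \<open>ds\<close> says that the defining pairings of a weak derivative are integrals of
  products of square integrable fields, and hence bilinear.\<close>

locale weak_operator =
  fixes \<Omega> :: "(real^'n) set"
    and ds :: "(real^'n \<Rightarrow> 'c::euclidean_space) \<Rightarrow> real^'n \<Rightarrow> 'b::euclidean_space"
  assumes open_domain: "open \<Omega>" and bounded_domain: "bounded \<Omega>"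
    and adjoint_L2: "\<phi> \<in> test_fields \<Omega> \<Longrightarrow> ds \<phi> \<in> L2 \<Omega>"
begin

lemma is_weak_weak: "u \<in> H ds \<Omega> \<Longrightarrow> is_weak ds \<Omega> u (weak ds \<Omega> u)"
  unfolding H_def weak_def using someI_ex[of "is_weak ds \<Omega> u"] by blast

lemma weak_L2: "u \<in> H ds \<Omega> \<Longrightarrow> weak ds \<Omega> u \<in> L2 \<Omega>"
  using is_weak_weak by (auto simp: is_weak_def)

lemma H_L2: "u \<in> H ds \<Omega> \<Longrightarrow> u \<in> L2 \<Omega>"
  by (simp add: H_def)

lemma weak_adjoint:
  "u \<in> H ds \<Omega> \<Longrightarrow> \<phi> \<in> test_fields \<Omega> \<Longrightarrow> l2_inner \<Omega> (weak ds \<Omega> u) \<phi> = l2_inner \<Omega> u (ds \<phi>)"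
  using is_weak_weak by (auto simp: is_weak_def)

text \<open>The choice in the definition of the weak operators is harmless exactly because of this uniqueness,
  which the fundamental lemma provides.\<close>

lemma weak_unique:
  assumes "is_weak ds \<Omega> u w" "is_weak ds \<Omega> u w'"
  shows "AE x in lebesgue_on \<Omega>. w x = w' x"
proof -
  have w: "w \<in> L2 \<Omega>" "w' \<in> L2 \<Omega>" using assms by (auto simp: is_weak_def)
  have "AE x in lebesgue_on \<Omega>. w x - w' x = 0"
  proof (rule fundamental_lemma[OF open_domain bounded_domain L2_diff[OF w]])
    fix \<phi> :: "real^'n \<Rightarrow> 'c" assume "\<phi> \<in> test_fields \<Omega>"
    then have "l2_inner \<Omega> w \<phi> = l2_inner \<Omega> w' \<phi>" and "\<phi> \<in> L2 \<Omega>"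
      using assms test_fields_L2[OF open_domain bounded_domain] by (auto simp: is_weak_def)
    then show "l2_inner \<Omega> (\<lambda>x. w x - w' x) \<phi> = 0"
      using w by (simp add: l2_inner_diff_left)
  qed
  then show ?thesis by simp
qed

lemma weak_AE_eqI:
  assumes "is_weak ds \<Omega> u w"
  shows "AE x in lebesgue_on \<Omega>. weak ds \<Omega> u x = w x"
  using weak_unique[OF someI[of "is_weak ds \<Omega> u", OF assms] assms] by (simp add: weak_def)

lemma ae_linear_on_weak:
  assumes "V \<subseteq> H ds \<Omega>"
  shows "ae_linear_on \<Omega> V (weak ds \<Omega>)"
  unfolding ae_linear_on_def
proof (intro conjI ballI allI impI)
  fix d :: nat and b c f
  assume b: "\<forall>i<d. b i \<in> V" and f: "f \<in> V"
    and eq: "AE x in lebesgue_on \<Omega>. f x = (\<Sum>i<d. c i *\<^sub>R b i x)"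
  have bH: "b i \<in> H ds \<Omega>" if "i < d" for i using b that assms by blast
  have bL2: "b i \<in> L2 \<Omega>" if "i < d" for i using bH[OF that] by (rule H_L2)
  have fL2: "f \<in> L2 \<Omega>" using f assms H_L2 by blast
  show "AE x in lebesgue_on \<Omega>. weak ds \<Omega> f x = (\<Sum>i<d. c i *\<^sub>R weak ds \<Omega> (b i) x)"
  proof (rule weak_AE_eqI)
    have "l2_inner \<Omega> f (ds \<phi>) = l2_inner \<Omega> (\<lambda>x. \<Sum>i<d. c i *\<^sub>R weak ds \<Omega> (b i) x) \<phi>"
      if \<phi>: "\<phi> \<in> test_fields \<Omega>" for \<phi>
    proof -
      have "l2_inner \<Omega> f (ds \<phi>) = l2_inner \<Omega> (\<lambda>x. \<Sum>i<d. c i *\<^sub>R b i x) (ds \<phi>)"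
        using fL2 eq adjoint_L2[OF \<phi>] bL2
        by (intro l2_inner_cong_AE L2_sum L2_scaleR) auto
      also have "\<dots> = (\<Sum>i<d. c i * l2_inner \<Omega> (b i) (ds \<phi>))"
        using adjoint_L2[OF \<phi>] bL2
        by (subst l2_inner_sum_left) (auto intro: L2_scaleR simp: l2_inner_scaleR_left)
      also have "\<dots> = (\<Sum>i<d. c i * l2_inner \<Omega> (weak ds \<Omega> (b i)) \<phi>)"
        using bH \<phi> by (intro sum.cong) (auto simp: weak_adjoint)
      also have "\<dots> = l2_inner \<Omega> (\<lambda>x. \<Sum>i<d. c i *\<^sub>R weak ds \<Omega> (b i) x) \<phi>"
        using test_fields_L2[OF open_domain bounded_domain \<phi>] weak_L2[OF bH]
        by (subst l2_inner_sum_left) (auto intro: L2_scaleR simp: l2_inner_scaleR_left)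
      finally show ?thesis .
    qed
    moreover have "(\<lambda>x. \<Sum>i<d. c i *\<^sub>R weak ds \<Omega> (b i) x) \<in> L2 \<Omega>"
      using bH by (intro L2_sum L2_scaleR weak_L2) auto
    ultimately show "is_weak ds \<Omega> f (\<lambda>x. \<Sum>i<d. c i *\<^sub>R weak ds \<Omega> (b i) x)"
      by (simp add: is_weak_def)
  qed
qed (use assms weak_L2 in blast)

end

lemma weak_operator_grad_adj: "open \<Omega> \<Longrightarrow> bounded \<Omega> \<Longrightarrow> weak_operator \<Omega> grad_adj"
  by unfold_locales (auto intro: test_fields_L2 test_fields_grad_adj)

lemma weak_operator_dvg_adj: "open \<Omega> \<Longrightarrow> bounded \<Omega> \<Longrightarrow> weak_operator \<Omega> dvg_adj"
  by unfold_locales (auto intro: test_fields_L2 test_fields_dvg_adj)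

lemma weak_operator_curl: "open \<Omega> \<Longrightarrow> bounded \<Omega> \<Longrightarrow> weak_operator \<Omega> curl"
  by unfold_locales (auto intro: test_fields_L2 test_fields_curl)

section \<open>Finite dimensional spaces of fields\<close>

text \<open>Gram-Schmidt, for families that may be dependent: if the new field lies in the span of the
  previous ones, its residual \<open>g\<close> vanishes almost everywhere and is orthogonal to everything.\<close>

lemma exists_orthogonal_projection:
  assumes "\<And>i. i < d \<Longrightarrow> b i \<in> L2 \<Omega>" "v \<in> L2 \<Omega>"
  shows "\<exists>c. \<forall>j<d::nat. l2_inner \<Omega> (\<lambda>x. v x - (\<Sum>i<d. c i *\<^sub>R b i x)) (b j) = 0"
  using assms
proof (induction d arbitrary: v)
  case (Suc d)
  have bL2: "b i \<in> L2 \<Omega>" if "i < Suc d" for i using Suc.prems that by blast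
  obtain c where c: "\<And>j. j < d \<Longrightarrow> l2_inner \<Omega> (\<lambda>x. v x - (\<Sum>i<d. c i *\<^sub>R b i x)) (b j) = 0"
    using Suc.IH[of v] Suc.prems by auto
  obtain e where e: "\<And>j. j < d \<Longrightarrow> l2_inner \<Omega> (\<lambda>x. b d x - (\<Sum>i<d. e i *\<^sub>R b i x)) (b j) = 0"
    using Suc.IH[of "b d"] Suc.prems by auto
  define r where "r = (\<lambda>x. v x - (\<Sum>i<d. c i *\<^sub>R b i x))"
  define g where "g = (\<lambda>x. b d x - (\<Sum>i<d. e i *\<^sub>R b i x))"
  have rL2: "r \<in> L2 \<Omega>" and gL2: "g \<in> L2 \<Omega>"
    unfolding r_def g_def using Suc.prems(2) bL2 by (intro L2_diff L2_sum L2_scaleR; simp)+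
  define t where "t = (if l2_inner \<Omega> g g = 0 then 0 else l2_inner \<Omega> r g / l2_inner \<Omega> g g)"
  define s where "s = (\<lambda>x. r x - t *\<^sub>R g x)"
  have sL2: "s \<in> L2 \<Omega>" unfolding s_def by (intro L2_diff L2_scaleR rL2 gL2)
  have s_orth: "l2_inner \<Omega> s (b j) = 0" if "j < d" for j
    using c[OF that] e[OF that] bL2[of j] that rL2 gL2
    by (simp add: s_def l2_inner_diff_left L2_scaleR l2_inner_scaleR_left
        flip: r_def g_def)
  have "l2_inner \<Omega> s g = l2_inner \<Omega> r g - t * l2_inner \<Omega> g g"
    using rL2 gL2 by (simp add: s_def l2_inner_diff_left L2_scaleR l2_inner_scaleR_left)
  moreover have "l2_inner \<Omega> r g = 0" if "l2_inner \<Omega> g g = 0"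
    using that l2_inner_self_eq_0_iff[OF gL2] l2_inner_zero_AE by blast
  ultimately have sg: "l2_inner \<Omega> s g = 0" by (simp add: t_def)
  have "l2_inner \<Omega> s (b d) = l2_inner \<Omega> s (\<lambda>x. g x + (\<Sum>i<d. e i *\<^sub>R b i x))"
    by (simp add: g_def)
  also have "\<dots> = l2_inner \<Omega> s g + l2_inner \<Omega> s (\<lambda>x. \<Sum>i<d. e i *\<^sub>R b i x)"
    using gL2 sL2 bL2 by (intro l2_inner_add_right L2_sum L2_scaleR) auto
  also have "l2_inner \<Omega> s (\<lambda>x. \<Sum>i<d. e i *\<^sub>R b i x) = (\<Sum>i<d. e i * l2_inner \<Omega> (b i) s)"
    using sL2 bL2
    by (subst l2_inner_commute, subst l2_inner_sum_left) (auto intro: L2_scaleR simp: l2_inner_scaleR_left)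
  also have "\<dots> = 0"
    using s_orth by (intro sum.neutral) (simp add: l2_inner_commute)
  finally have "l2_inner \<Omega> s (b d) = 0" using sg by simp
  then have "l2_inner \<Omega> s (b j) = 0" if "j < Suc d" for j
    using s_orth that by (cases "j = d") auto
  moreover have "s = (\<lambda>x. v x - (\<Sum>i<Suc d. (if i = d then t else c i - t * e i) *\<^sub>R b i x))"
  proof
    fix x
    have "(\<Sum>i<d. (if i = d then t else c i - t * e i) *\<^sub>R b i x)
        = (\<Sum>i<d. c i *\<^sub>R b i x) - t *\<^sub>R (\<Sum>i<d. e i *\<^sub>R b i x)"
      by (simp add: sum_subtractf scaleR_diff_left scaleR_sum_right)
    then show "s x = v x - (\<Sum>i<Suc d. (if i = d then t else c i - t * e i) *\<^sub>R b i x)"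
      by (simp add: s_def r_def g_def scaleR_diff_right)
  qed
  ultimately have "\<forall>j<Suc d. l2_inner \<Omega>
      (\<lambda>x. v x - (\<Sum>i<Suc d. (if i = d then t else c i - t * e i) *\<^sub>R b i x)) (b j) = 0"
    by simp
  then show ?case by (intro exI[of _ "\<lambda>i. if i = d then t else c i - t * e i"])
qed simp

definition L2_basis ::
  "(real^'n) set \<Rightarrow> (real^'n \<Rightarrow> 'b::euclidean_space) set \<Rightarrow> nat \<Rightarrow> (nat \<Rightarrow> real^'n \<Rightarrow> 'b) \<Rightarrow> bool" where
  "L2_basis \<Omega> V d b \<longleftrightarrow>
     (\<forall>i<d. b i \<in> L2 \<Omega>) \<and>
     (\<forall>c :: nat \<Rightarrow> real. (AE x in lebesgue_on \<Omega>. (\<Sum>i<d. c i *\<^sub>R b i x) = 0) \<longrightarrow> (\<forall>i<d. c i = 0)) \<and>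
     V = {f \<in> L2 \<Omega>. \<exists>c :: nat \<Rightarrow> real. AE x in lebesgue_on \<Omega>. f x = (\<Sum>i<d. c i *\<^sub>R b i x)}"

lemma finite_dim_basis: "finite_dim \<Omega> V \<longleftrightarrow> (\<exists>d b. L2_basis \<Omega> V d b)"
  by (simp add: finite_dim_def L2_dim_def L2_basis_def)

lemma L2_basis_L2: "L2_basis \<Omega> V d b \<Longrightarrow> i < d \<Longrightarrow> b i \<in> L2 \<Omega>"
  by (simp add: L2_basis_def)

lemma L2_basis_independent:
  assumes "L2_basis \<Omega> V d b" "AE x in lebesgue_on \<Omega>. (\<Sum>i<d. c i *\<^sub>R b i x) = 0" "i < d"
  shows "c i = 0"
  using assms unfolding L2_basis_def by blast

lemma L2_basis_coefficients:
  assumes "L2_basis \<Omega> V d b" "f \<in> V"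
  obtains c where "AE x in lebesgue_on \<Omega>. f x = (\<Sum>i<d. c i *\<^sub>R b i x)"
  using assms unfolding L2_basis_def by blast

lemma L2_basis_combination:
  assumes "L2_basis \<Omega> V d b" "f \<in> L2 \<Omega>" "AE x in lebesgue_on \<Omega>. f x = (\<Sum>i<d. c i *\<^sub>R b i x)"
  shows "f \<in> V"
  using assms unfolding L2_basis_def by blast

lemma L2_basis_in:
  assumes "L2_basis \<Omega> V d b" "i < d"
  shows "b i \<in> V"
proof (rule L2_basis_combination[OF assms(1) L2_basis_L2[OF assms]])
  have "(\<Sum>j<d. (if j = i then 1 else 0) *\<^sub>R b j x) = (\<Sum>j<d. if j = i then b j x else 0)" for x
    by (intro sum.cong) auto
  then show "AE x in lebesgue_on \<Omega>. b i x = (\<Sum>j<d. (if j = i then 1 else 0) *\<^sub>R b j x)"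
    using assms(2) by simp
qed

lemma finite_dim_subset_L2: "finite_dim \<Omega> V \<Longrightarrow> V \<subseteq> L2 \<Omega>"
  unfolding finite_dim_basis L2_basis_def by blast

lemma finite_dim_combination:
  assumes V: "finite_dim \<Omega> V" and fg: "f \<in> V" "g \<in> V"
  shows "(\<lambda>x. a *\<^sub>R f x + a' *\<^sub>R g x) \<in> V"
proof -
  have fgL2: "f \<in> L2 \<Omega>" "g \<in> L2 \<Omega>" using finite_dim_subset_L2[OF V] fg by auto
  obtain d b where bas: "L2_basis \<Omega> V d b" using V finite_dim_basis by blast
  obtain c where c: "AE x in lebesgue_on \<Omega>. f x = (\<Sum>i<d. c i *\<^sub>R b i x)"
    using L2_basis_coefficients[OF bas fg(1)] .
  obtain e where e: "AE x in lebesgue_on \<Omega>. g x = (\<Sum>i<d. e i *\<^sub>R b i x)"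
    using L2_basis_coefficients[OF bas fg(2)] .
  have "AE x in lebesgue_on \<Omega>. a *\<^sub>R f x + a' *\<^sub>R g x = (\<Sum>i<d. (a * c i + a' * e i) *\<^sub>R b i x)"
    using c e by eventually_elim (simp add: scaleR_sum_right scaleR_add_left sum.distrib)
  then show ?thesis
    by (rule L2_basis_combination[OF bas L2_add[OF L2_scaleR[OF fgL2(1)] L2_scaleR[OF fgL2(2)]]])
qed

lemma finite_dim_diff:
  "finite_dim \<Omega> V \<Longrightarrow> f \<in> V \<Longrightarrow> g \<in> V \<Longrightarrow> (\<lambda>x. f x - g x) \<in> V"
  using finite_dim_combination[of \<Omega> V f g 1 "-1"] by simp

text \<open>The residual of projecting one basis field onto the others is dual to that field, so that it
  reads off the coefficient by a bounded functional.\<close>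

lemma coefficient_bound:
  assumes bas: "L2_basis \<Omega> V d b" and k: "k < d"
  shows "\<exists>C. \<forall>c. \<bar>c k\<bar> \<le> C * l2_norm \<Omega> (\<lambda>x. \<Sum>i<d. c i *\<^sub>R b i x)"
proof -
  have b: "b i \<in> L2 \<Omega>" if "i < d" for i using L2_basis_L2[OF bas that] .
  \<comment> \<open>Putting zero for the field \<open>k\<close> projects onto the others without renumbering them.\<close>
  define b' where "b' i = (if i = k then (\<lambda>x. 0) else b i)" for i
  have b': "b' i \<in> L2 \<Omega>" if "i < d" for i using b that by (simp add: b'_def L2_zero)
  obtain e where e: "\<And>j. j < d \<Longrightarrow> l2_inner \<Omega> (\<lambda>x. b k x - (\<Sum>i<d. e i *\<^sub>R b' i x)) (b' j) = 0"
    using exists_orthogonal_projection[of d b' \<Omega> "b k"] b' b k by blast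
  define r where "r = (\<lambda>x. b k x - (\<Sum>i<d. e i *\<^sub>R b' i x))"
  have rL2: "r \<in> L2 \<Omega>" unfolding r_def using b b' k by (intro L2_diff L2_sum L2_scaleR) auto
  have orth: "l2_inner \<Omega> r (b j) = 0" if "j < d" "j \<noteq> k" for j
  proof -
    have "l2_inner \<Omega> r (b' j) = 0" unfolding r_def by (rule e[OF that(1)])
    then show ?thesis using that(2) by (simp add: b'_def)
  qed
  have "r x = (\<Sum>i<d. (if i = k then 1 else - e i) *\<^sub>R b i x)" for x
  proof -
    have "(\<Sum>i<d. (if i = k then 1 else - e i) *\<^sub>R b i x)
        = (\<Sum>i<d. (if i = k then b i x else 0) - e i *\<^sub>R b' i x)"
      by (intro sum.cong) (auto simp: b'_def)
    also have "\<dots> = r x" using k by (simp add: sum_subtractf r_def)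
    finally show ?thesis by simp
  qed
  then have "(AE x in lebesgue_on \<Omega>. r x = 0) \<Longrightarrow> (if k = k then 1 else - e k) = 0"
    by (intro L2_basis_independent[OF bas _ k, where c = "\<lambda>i. if i = k then 1 else - e i"]) simp
  then have "\<not> (AE x in lebesgue_on \<Omega>. r x = 0)" by auto
  then have rr: "l2_inner \<Omega> r r > 0"
    using l2_inner_self_eq_0_iff[OF rL2] l2_inner_self_nonneg[of \<Omega> r] by linarith
  have "l2_inner \<Omega> (b k) r = l2_inner \<Omega> (\<lambda>x. r x + (\<Sum>i<d. e i *\<^sub>R b' i x)) r"
    by (simp add: r_def)
  also have "\<dots> = l2_inner \<Omega> r r + (\<Sum>i<d. e i * l2_inner \<Omega> (b' i) r)"
    using rL2 b'
    by (subst l2_inner_add_left; (subst l2_inner_sum_left)?)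
       (auto intro!: L2_sum L2_scaleR simp: l2_inner_scaleR_left)
  also have "(\<Sum>i<d. e i * l2_inner \<Omega> (b' i) r) = 0"
    using e by (intro sum.neutral) (simp add: l2_inner_commute flip: r_def)
  finally have bk: "l2_inner \<Omega> (b k) r = l2_inner \<Omega> r r" by simp
  have "\<bar>c k\<bar> \<le> l2_norm \<Omega> r / l2_inner \<Omega> r r * l2_norm \<Omega> (\<lambda>x. \<Sum>i<d. c i *\<^sub>R b i x)" for c
  proof -
    have "l2_inner \<Omega> (\<lambda>x. \<Sum>i<d. c i *\<^sub>R b i x) r = (\<Sum>i<d. c i * l2_inner \<Omega> (b i) r)"
      using rL2 b by (subst l2_inner_sum_left) (auto intro: L2_scaleR simp: l2_inner_scaleR_left)
    also have "\<dots> = (\<Sum>i<d. if i = k then c k * l2_inner \<Omega> r r else 0)"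
      using orth bk by (intro sum.cong) (auto simp: l2_inner_commute)
    finally have "c k * l2_inner \<Omega> r r = l2_inner \<Omega> (\<lambda>x. \<Sum>i<d. c i *\<^sub>R b i x) r"
      using k by simp
    then have "\<bar>c k\<bar> * l2_inner \<Omega> r r = \<bar>l2_inner \<Omega> (\<lambda>x. \<Sum>i<d. c i *\<^sub>R b i x) r\<bar>"
      using rr by (metis abs_mult abs_of_pos)
    also have "\<dots> \<le> l2_norm \<Omega> (\<lambda>x. \<Sum>i<d. c i *\<^sub>R b i x) * l2_norm \<Omega> r"
      using rL2 b by (intro l2_Cauchy_Schwarz L2_sum L2_scaleR) auto
    finally show ?thesis using rr by (simp add: field_simps)
  qed
  then show ?thesis by blast
qed

text \<open>All operators on a finite dimensional space are bounded, which is how the symmetric gradient and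
  the divergence commute with the time derivative.\<close>

lemma finite_dim_bounded_operator:
  assumes V: "finite_dim \<Omega> V" and D: "ae_linear_on \<Omega> V D"
  shows "\<exists>C. \<forall>f\<in>V. l2_norm \<Omega> (D f) \<le> C * l2_norm \<Omega> f"
proof -
  obtain d b where bas: "L2_basis \<Omega> V d b" using V finite_dim_basis by blast
  note b = L2_basis_L2[OF bas] L2_basis_in[OF bas]
  have "\<forall>k. \<exists>C. k < d \<longrightarrow> (\<forall>c. \<bar>c k\<bar> \<le> C * l2_norm \<Omega> (\<lambda>x. \<Sum>i<d. c i *\<^sub>R b i x))"
  proof
    fix k
    show "\<exists>C. k < d \<longrightarrow> (\<forall>c. \<bar>c k\<bar> \<le> C * l2_norm \<Omega> (\<lambda>x. \<Sum>i<d. c i *\<^sub>R b i x))"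
      using coefficient_bound[OF bas, of k] by (cases "k < d") simp_all
  qed
  from choice[OF this] obtain C
    where C: "\<forall>k. k < d \<longrightarrow> (\<forall>c. \<bar>c k\<bar> \<le> C k * l2_norm \<Omega> (\<lambda>x. \<Sum>i<d. c i *\<^sub>R b i x))" ..
  have "l2_norm \<Omega> (D f) \<le> (\<Sum>i<d. C i * l2_norm \<Omega> (D (b i))) * l2_norm \<Omega> f" if f: "f \<in> V" for f
  proof -
    have fL2: "f \<in> L2 \<Omega>" using f finite_dim_subset_L2[OF V] by blast
    obtain c where c: "AE x in lebesgue_on \<Omega>. f x = (\<Sum>i<d. c i *\<^sub>R b i x)"
      using L2_basis_coefficients[OF bas f] .
    have Db: "D (b i) \<in> L2 \<Omega>" if "i < d" for i using ae_linear_on_L2[OF D b(2)[OF that]] .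
    have nf: "l2_norm \<Omega> f = l2_norm \<Omega> (\<lambda>x. \<Sum>i<d. c i *\<^sub>R b i x)"
      using fL2 b c by (intro l2_norm_cong_AE L2_sum L2_scaleR) auto
    have "l2_norm \<Omega> (D f) = l2_norm \<Omega> (\<lambda>x. \<Sum>i<d. c i *\<^sub>R D (b i) x)"
      using ae_linear_on_sum[OF D b(2) f c] ae_linear_on_L2[OF D f] Db
      by (intro l2_norm_cong_AE L2_sum L2_scaleR) auto
    also have "\<dots> \<le> (\<Sum>i<d. l2_norm \<Omega> (\<lambda>x. c i *\<^sub>R D (b i) x))"
      using Db by (intro l2_norm_sum L2_scaleR) auto
    also have "\<dots> = (\<Sum>i<d. \<bar>c i\<bar> * l2_norm \<Omega> (D (b i)))"
      by (simp add: l2_norm_scaleR)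
    also have "\<dots> \<le> (\<Sum>i<d. C i * l2_norm \<Omega> f * l2_norm \<Omega> (D (b i)))"
      unfolding nf using C by (intro sum_mono mult_right_mono) auto
    also have "\<dots> = (\<Sum>i<d. C i * l2_norm \<Omega> (D (b i))) * l2_norm \<Omega> f"
      unfolding sum_distrib_right by (intro sum.cong) (simp_all add: mult_ac)
    finally show ?thesis .
  qed
  then show ?thesis by blast
qed

text \<open>The residual of the projection onto \<open>V\<close> is orthogonal to \<open>V\<close>, so its norm is at most the
  distance of \<open>f\<close> to any element of \<open>V\<close>.\<close>

lemma finite_dim_closed:
  assumes V: "finite_dim \<Omega> V" and f: "f \<in> L2 \<Omega>"
    and approx: "\<And>\<epsilon>. \<epsilon> > 0 \<Longrightarrow> \<exists>g\<in>V. l2_norm \<Omega> (\<lambda>x. g x - f x) < \<epsilon>"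
  shows "f \<in> V"
proof -
  obtain d b where bas: "L2_basis \<Omega> V d b" using V finite_dim_basis by blast
  note b = L2_basis_L2[OF bas]
  obtain c where c: "\<And>j. j < d \<Longrightarrow> l2_inner \<Omega> (\<lambda>x. f x - (\<Sum>i<d. c i *\<^sub>R b i x)) (b j) = 0"
    using exists_orthogonal_projection[of d b \<Omega> f] b f by blast
  define r where "r = (\<lambda>x. f x - (\<Sum>i<d. c i *\<^sub>R b i x))"
  have rL2: "r \<in> L2 \<Omega>" unfolding r_def using b f by (intro L2_diff L2_sum L2_scaleR) auto
  have comb: "l2_inner \<Omega> r (\<lambda>x. \<Sum>i<d. e i *\<^sub>R b i x) = 0" for e
  proof -
    have "l2_inner \<Omega> r (\<lambda>x. \<Sum>i<d. e i *\<^sub>R b i x) = (\<Sum>i<d. e i * l2_inner \<Omega> (b i) r)"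
      using rL2 b
      by (subst l2_inner_commute, subst l2_inner_sum_left) (auto intro: L2_scaleR simp: l2_inner_scaleR_left)
    also have "\<dots> = 0"
      using c by (intro sum.neutral) (simp add: l2_inner_commute flip: r_def)
    finally show ?thesis .
  qed
  have orth: "l2_inner \<Omega> r g = 0" if g: "g \<in> V" for g
  proof -
    obtain e where e: "AE x in lebesgue_on \<Omega>. g x = (\<Sum>i<d. e i *\<^sub>R b i x)"
      using L2_basis_coefficients[OF bas g] .
    moreover have "g \<in> L2 \<Omega>" using g finite_dim_subset_L2[OF V] by blast
    ultimately have "l2_inner \<Omega> r g = l2_inner \<Omega> r (\<lambda>x. \<Sum>i<d. e i *\<^sub>R b i x)"
      using rL2 b by (intro l2_inner_cong_AE L2_sum L2_scaleR) auto
    then show ?thesis using comb by simp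
  qed
  have rf: "l2_inner \<Omega> r r = l2_inner \<Omega> r f"
  proof -
    have "l2_inner \<Omega> r r = l2_inner \<Omega> r (\<lambda>x. f x - (\<Sum>i<d. c i *\<^sub>R b i x))"
      by (simp add: r_def)
    also have "\<dots> = l2_inner \<Omega> r f - l2_inner \<Omega> r (\<lambda>x. \<Sum>i<d. c i *\<^sub>R b i x)"
      using f rL2 b by (intro l2_inner_diff_right L2_sum L2_scaleR) auto
    finally show ?thesis using comb by simp
  qed
  have "l2_norm \<Omega> r \<le> \<epsilon>" if \<epsilon>: "\<epsilon> > 0" for \<epsilon>
  proof (cases "l2_norm \<Omega> r = 0")
    case False
    obtain g where g: "g \<in> V" "l2_norm \<Omega> (\<lambda>x. g x - f x) < \<epsilon>" using approx[OF \<epsilon>] by blast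
    have gL2: "g \<in> L2 \<Omega>" using finite_dim_subset_L2[OF V] g by blast
    have "(l2_norm \<Omega> r)\<^sup>2 = l2_inner \<Omega> r f" by (simp add: l2_norm_power2 rf)
    also have "\<dots> = - l2_inner \<Omega> r (\<lambda>x. g x - f x)"
      using f rL2 gL2 orth[OF g(1)] by (simp add: l2_inner_diff_right)
    also have "\<dots> \<le> l2_norm \<Omega> r * l2_norm \<Omega> (\<lambda>x. g x - f x)"
      using l2_Cauchy_Schwarz[OF rL2 L2_diff[OF gL2 f]] by linarith
    finally have "l2_norm \<Omega> r \<le> l2_norm \<Omega> (\<lambda>x. g x - f x)"
      using False l2_norm_nonneg[of \<Omega> r] by (simp add: power2_eq_square)
    then show ?thesis using g(2) by simp
  qed (use \<epsilon> in simp)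
  then have "l2_norm \<Omega> r = 0"
    by (meson antisym dense_ge l2_norm_nonneg)
  then have "AE x in lebesgue_on \<Omega>. r x = 0"
    by (simp add: l2_norm_eq_0_iff[OF rL2])
  then have "AE x in lebesgue_on \<Omega>. f x = (\<Sum>i<d. c i *\<^sub>R b i x)"
    by (simp add: r_def)
  then show ?thesis by (rule L2_basis_combination[OF bas f])
qed

text \<open>The range is spanned by the images of a basis, which may be dependent.\<close>

lemma exists_projection_onto_range:
  assumes W: "finite_dim \<Omega> W" and D: "ae_linear_on \<Omega> W D" and v: "v \<in> L2 \<Omega>"
  shows "\<exists>\<psi>\<in>W. \<forall>\<xi>\<in>W. l2_inner \<Omega> (\<lambda>x. v x - D \<psi> x) (D \<xi>) = 0"
proof -
  obtain d b where bas: "L2_basis \<Omega> W d b" using W finite_dim_basis by blast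
  note b = L2_basis_L2[OF bas] L2_basis_in[OF bas]
  have Db: "D (b i) \<in> L2 \<Omega>" if "i < d" for i using ae_linear_on_L2[OF D b(2)[OF that]] .
  have D_sum: "AE x in lebesgue_on \<Omega>. D f x = (\<Sum>i<d. c i *\<^sub>R D (b i) x)"
    if "f \<in> W" "AE x in lebesgue_on \<Omega>. f x = (\<Sum>i<d. c i *\<^sub>R b i x)" for f c
    by (rule ae_linear_on_sum[where b = b and d = d and c = c, OF D _ that]) (rule b(2))
  from exists_orthogonal_projection[of d "\<lambda>i. D (b i)" \<Omega> v, OF Db v]
  obtain c where c: "\<forall>j<d. l2_inner \<Omega> (\<lambda>x. v x - (\<Sum>i<d. c i *\<^sub>R D (b i) x)) (D (b j)) = 0"
    by auto
  define \<psi> where "\<psi> = (\<lambda>x. \<Sum>i<d. c i *\<^sub>R b i x)"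
  have "\<psi> \<in> L2 \<Omega>" unfolding \<psi>_def using b(1) by (intro L2_sum L2_scaleR) auto
  then have \<psi>: "\<psi> \<in> W" by (rule L2_basis_combination[OF bas, of _ c]) (simp add: \<psi>_def)
  have D\<psi>: "AE x in lebesgue_on \<Omega>. D \<psi> x = (\<Sum>i<d. c i *\<^sub>R D (b i) x)"
    by (rule D_sum[OF \<psi>]) (simp add: \<psi>_def)
  define r where "r = (\<lambda>x. v x - D \<psi> x)"
  have rL2: "r \<in> L2 \<Omega>" unfolding r_def by (intro L2_diff v ae_linear_on_L2[OF D \<psi>])
  have r: "l2_inner \<Omega> r (D (b j)) = 0" if "j < d" for j
  proof -
    have "l2_inner \<Omega> r (D (b j)) = l2_inner \<Omega> (\<lambda>x. v x - (\<Sum>i<d. c i *\<^sub>R D (b i) x)) (D (b j))"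
    proof (rule l2_inner_cong_AE)
      show "(\<lambda>x. v x - (\<Sum>i<d. c i *\<^sub>R D (b i) x)) \<in> L2 \<Omega>"
        using Db v by (intro L2_diff L2_sum L2_scaleR) auto
      show "AE x in lebesgue_on \<Omega>. r x = v x - (\<Sum>i<d. c i *\<^sub>R D (b i) x)"
        using D\<psi> by eventually_elim (simp add: r_def)
    qed (use rL2 Db[OF that] in simp_all)
    then show ?thesis using c that by simp
  qed
  have "l2_inner \<Omega> r (D \<xi>) = 0" if \<xi>: "\<xi> \<in> W" for \<xi>
  proof -
    obtain e where "AE x in lebesgue_on \<Omega>. \<xi> x = (\<Sum>i<d. e i *\<^sub>R b i x)"
      using L2_basis_coefficients[OF bas \<xi>] .
    then have "AE x in lebesgue_on \<Omega>. D \<xi> x = (\<Sum>i<d. e i *\<^sub>R D (b i) x)"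
      by (rule D_sum[OF \<xi>])
    then have "l2_inner \<Omega> r (D \<xi>) = l2_inner \<Omega> r (\<lambda>x. \<Sum>i<d. e i *\<^sub>R D (b i) x)"
      using rL2 Db ae_linear_on_L2[OF D \<xi>] by (intro l2_inner_cong_AE L2_sum L2_scaleR) auto
    also have "\<dots> = (\<Sum>i<d. e i * l2_inner \<Omega> (D (b i)) r)"
      using rL2 Db
      by (subst l2_inner_commute, subst l2_inner_sum_left) (auto intro: L2_scaleR simp: l2_inner_scaleR_left)
    also have "\<dots> = 0"
      using r by (intro sum.neutral) (simp add: l2_inner_commute)
    finally show ?thesis .
  qed
  then show ?thesis using \<psi> unfolding r_def by blast
qed


section \<open>Time derivatives\<close>

definition has_L2_derivative ::
  "(real^'n) set \<Rightarrow> real set \<Rightarrow> real \<Rightarrow> (real \<Rightarrow> real^'n \<Rightarrow> 'b::euclidean_space) \<Rightarrow>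
   (real^'n \<Rightarrow> 'b) \<Rightarrow> bool" where
  "has_L2_derivative \<Omega> T t u u' \<longleftrightarrow>
     ((\<lambda>s. l2_norm \<Omega> (\<lambda>x. (u s x - u t x) /\<^sub>R (s - t) - u' x)) \<longlongrightarrow> 0) (at t within T)"

text \<open>Writing \<open>u s = u t + (s - t)(u' + R s)\<close> with \<open>\<parallel>R s\<parallel> \<rightarrow> 0\<close>, the difference quotient of the
  square of the norm is \<open>2 (u t, u' + R s) + (s - t) \<parallel>u' + R s\<parallel>\<^sup>2\<close>.\<close>

lemma has_L2_derivative_norm_square:
  assumes u: "\<And>s. s \<in> T \<Longrightarrow> u s \<in> L2 \<Omega>" and t: "t \<in> T" and u': "u' \<in> L2 \<Omega>"
    and der: "has_L2_derivative \<Omega> T t u u'"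
  shows "((\<lambda>s. l2_inner \<Omega> (u s) (u s)) has_real_derivative 2 * l2_inner \<Omega> (u t) u') (at t within T)"
proof -
  define R where "R s = (\<lambda>x. (u s x - u t x) /\<^sub>R (s - t) - u' x)" for s
  define \<rho> where "\<rho> s = l2_norm \<Omega> (R s)" for s
  define F where "F s = (l2_inner \<Omega> (u s) (u s) - l2_inner \<Omega> (u t) (u t)) / (s - t)" for s
  have ut: "u t \<in> L2 \<Omega>" using u t by blast
  have \<rho>: "(\<rho> \<longlongrightarrow> 0) (at t within T)"
    using der unfolding has_L2_derivative_def \<rho>_def R_def .
  have bound: "norm (F s - 2 * l2_inner \<Omega> (u t) u')
      \<le> 2 * (l2_norm \<Omega> (u t) * \<rho> s) + \<bar>s - t\<bar> * (l2_norm \<Omega> u' + \<rho> s)\<^sup>2"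
    if s: "s \<in> T" "s \<noteq> t" for s
  proof -
    have us: "u s \<in> L2 \<Omega>" using u s by blast
    have RL2: "R s \<in> L2 \<Omega>" unfolding R_def by (intro L2_diff L2_scaleR us ut u')
    have Q: "(\<lambda>x. u' x + R s x) \<in> L2 \<Omega>" by (intro L2_add u' RL2)
    have "u s = (\<lambda>x. u t x + (s - t) *\<^sub>R (u' x + R s x))"
      using s by (simp add: R_def)
    then have "l2_inner \<Omega> (u s) (u s) = l2_inner \<Omega> (u t) (u t)
        + 2 * (s - t) * l2_inner \<Omega> (u t) (\<lambda>x. u' x + R s x)
        + (s - t)\<^sup>2 * l2_inner \<Omega> (\<lambda>x. u' x + R s x) (\<lambda>x. u' x + R s x)"
      using l2_inner_expand[OF ut Q, of "s - t"] by simp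
    also have "l2_inner \<Omega> (u t) (\<lambda>x. u' x + R s x) = l2_inner \<Omega> (u t) u' + l2_inner \<Omega> (u t) (R s)"
      by (rule l2_inner_add_right[OF u' RL2 ut])
    finally have F: "F s - 2 * l2_inner \<Omega> (u t) u'
        = 2 * l2_inner \<Omega> (u t) (R s) + (s - t) * (l2_norm \<Omega> (\<lambda>x. u' x + R s x))\<^sup>2"
      using s unfolding F_def l2_norm_power2 by (simp add: field_simps power2_eq_square)
    have "(l2_norm \<Omega> (\<lambda>x. u' x + R s x))\<^sup>2 \<le> (l2_norm \<Omega> u' + \<rho> s)\<^sup>2"
      unfolding \<rho>_def by (intro power_mono l2_norm_triangle u' RL2) simp
    moreover have "\<bar>l2_inner \<Omega> (u t) (R s)\<bar> \<le> l2_norm \<Omega> (u t) * \<rho> s"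
      unfolding \<rho>_def by (rule l2_Cauchy_Schwarz[OF ut RL2])
    ultimately have "2 * \<bar>l2_inner \<Omega> (u t) (R s)\<bar> + \<bar>s - t\<bar> * (l2_norm \<Omega> (\<lambda>x. u' x + R s x))\<^sup>2
        \<le> 2 * (l2_norm \<Omega> (u t) * \<rho> s) + \<bar>s - t\<bar> * (l2_norm \<Omega> u' + \<rho> s)\<^sup>2"
      by (intro add_mono mult_left_mono) auto
    moreover have "norm (F s - 2 * l2_inner \<Omega> (u t) u')
        \<le> 2 * \<bar>l2_inner \<Omega> (u t) (R s)\<bar> + \<bar>s - t\<bar> * (l2_norm \<Omega> (\<lambda>x. u' x + R s x))\<^sup>2"
      unfolding F real_norm_def by (rule order_trans[OF abs_triangle_ineq]) (simp add: abs_mult)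
    ultimately show ?thesis by linarith
  qed
  have "((\<lambda>s. 2 * (l2_norm \<Omega> (u t) * \<rho> s) + \<bar>s - t\<bar> * (l2_norm \<Omega> u' + \<rho> s)\<^sup>2) \<longlongrightarrow>
      2 * (l2_norm \<Omega> (u t) * 0) + \<bar>t - t\<bar> * (l2_norm \<Omega> u' + 0)\<^sup>2) (at t within T)"
    by (intro tendsto_intros \<rho>)
  then have "((\<lambda>s. 2 * (l2_norm \<Omega> (u t) * \<rho> s) + \<bar>s - t\<bar> * (l2_norm \<Omega> u' + \<rho> s)\<^sup>2) \<longlongrightarrow> 0) (at t within T)"
    by simp
  then have "((\<lambda>s. F s - 2 * l2_inner \<Omega> (u t) u') \<longlongrightarrow> 0) (at t within T)"
    by (rule Lim_null_comparison[rotated]) (use bound in \<open>auto simp: eventually_at_filter\<close>)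
  then have "(F \<longlongrightarrow> 2 * l2_inner \<Omega> (u t) u') (at t within T)"
    by (rule LIM_zero_cancel)
  then show ?thesis
    unfolding has_field_derivative_iff F_def .
qed

lemma has_L2_derivative_operator:
  assumes V: "finite_dim \<Omega> V" and D: "ae_linear_on \<Omega> V D"
    and u: "\<And>s. s \<in> T \<Longrightarrow> u s \<in> V" and t: "t \<in> T" and u': "u' \<in> V"
    and der: "has_L2_derivative \<Omega> T t u u'"
  shows "has_L2_derivative \<Omega> T t (\<lambda>s. D (u s)) (D u')"
proof -
  obtain C where C: "\<And>f. f \<in> V \<Longrightarrow> l2_norm \<Omega> (D f) \<le> C * l2_norm \<Omega> f"
    using finite_dim_bounded_operator[OF V D] by blast
  define R where "R s = (\<lambda>x. (u s x - u t x) /\<^sub>R (s - t) - u' x)" for s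
  have "norm (l2_norm \<Omega> (\<lambda>x. (D (u s) x - D (u t) x) /\<^sub>R (s - t) - D u' x)) \<le> C * l2_norm \<Omega> (R s)"
    if s: "s \<in> T" for s
  proof -
    define q where "q = (\<lambda>x. u s x - u t x)"
    have q: "q \<in> V" unfolding q_def by (rule finite_dim_diff[OF V u[OF s] u[OF t]])
    have RV: "R s \<in> V"
      using finite_dim_combination[OF V q u', of "inverse (s - t)" "- 1"] by (simp add: R_def q_def)
    have "AE x in lebesgue_on \<Omega>. D q x = 1 *\<^sub>R D (u s) x + (- 1) *\<^sub>R D (u t) x"
      by (rule ae_linear_on_combination[OF D u[OF s] u[OF t] q]) (simp add: q_def)
    moreover have "AE x in lebesgue_on \<Omega>. D (R s) x = inverse (s - t) *\<^sub>R D q x + (- 1) *\<^sub>R D u' x"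
      by (rule ae_linear_on_combination[OF D q u' RV]) (simp add: q_def R_def)
    ultimately have "AE x in lebesgue_on \<Omega>. (D (u s) x - D (u t) x) /\<^sub>R (s - t) - D u' x = D (R s) x"
      by eventually_elim simp
    then have "l2_norm \<Omega> (\<lambda>x. (D (u s) x - D (u t) x) /\<^sub>R (s - t) - D u' x) = l2_norm \<Omega> (D (R s))"
      using ae_linear_on_L2[OF D] u[OF s] u[OF t] u' RV
      by (intro l2_norm_cong_AE L2_diff L2_scaleR) auto
    then show ?thesis using C[OF RV] by simp
  qed
  then have "\<forall>\<^sub>F s in at t within T.
      norm (l2_norm \<Omega> (\<lambda>x. (D (u s) x - D (u t) x) /\<^sub>R (s - t) - D u' x)) \<le> C * l2_norm \<Omega> (R s)"
    by (simp add: eventually_at_filter)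
  moreover have "((\<lambda>s. C * l2_norm \<Omega> (R s)) \<longlongrightarrow> 0) (at t within T)"
    using der unfolding has_L2_derivative_def R_def by (rule tendsto_mult_right_zero)
  ultimately show ?thesis
    unfolding has_L2_derivative_def by (rule Lim_null_comparison)
qed

text \<open>The difference quotients lie in \<open>V\<close> and approximate \<open>u'\<close>.\<close>

lemma has_L2_derivative_in_finite_dim:
  assumes V: "finite_dim \<Omega> V" and u: "\<And>s. s \<in> T \<Longrightarrow> u s \<in> V" and t: "t \<in> T" "t islimpt T"
    and u': "u' \<in> L2 \<Omega>" and der: "has_L2_derivative \<Omega> T t u u'"
  shows "u' \<in> V"
proof (rule finite_dim_closed[OF V u'])
  fix \<epsilon> :: real assume "\<epsilon> > 0"
  then have "\<forall>\<^sub>F s in at t within T. l2_norm \<Omega> (\<lambda>x. (u s x - u t x) /\<^sub>R (s - t) - u' x) < \<epsilon>"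
    using der unfolding has_L2_derivative_def by (auto dest: order_tendstoD)
  moreover have "\<forall>\<^sub>F s in at t within T. s \<in> T"
    by (simp add: eventually_at_filter)
  ultimately have "\<forall>\<^sub>F s in at t within T. s \<in> T \<and>
      l2_norm \<Omega> (\<lambda>x. (u s x - u t x) /\<^sub>R (s - t) - u' x) < \<epsilon>"
    by eventually_elim simp
  moreover have "at t within T \<noteq> bot"
    using t(2) by (simp add: trivial_limit_within)
  ultimately obtain s where s: "s \<in> T" "l2_norm \<Omega> (\<lambda>x. (u s x - u t x) /\<^sub>R (s - t) - u' x) < \<epsilon>"
    using eventually_happens' by blast
  have "(\<lambda>x. (u s x - u t x) /\<^sub>R (s - t)) \<in> V"
    using finite_dim_combination[OF V u[OF s(1)] u[OF t(1)], of "inverse (s - t)" "- inverse (s - t)"]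
    by (simp add: scaleR_diff_right)
  then show "\<exists>g\<in>V. l2_norm \<Omega> (\<lambda>x. g x - u' x) < \<epsilon>"
    by (rule bexI[rotated]) (rule s(2))
qed

lemma has_L2_derivative_AE_zero:
  assumes zero: "\<And>s. s \<in> T \<Longrightarrow> AE x in lebesgue_on \<Omega>. u s x = 0"
    and L2: "\<And>s. s \<in> T \<Longrightarrow> u s \<in> L2 \<Omega>" "u' \<in> L2 \<Omega>"
    and t: "t \<in> T" "t islimpt T" and der: "has_L2_derivative \<Omega> T t u u'"
  shows "AE x in lebesgue_on \<Omega>. u' x = 0"
proof -
  have "l2_norm \<Omega> (\<lambda>x. (u s x - u t x) /\<^sub>R (s - t) - u' x) = l2_norm \<Omega> u'" if "s \<in> T" for s
  proof -
    have "l2_norm \<Omega> (\<lambda>x. (u s x - u t x) /\<^sub>R (s - t) - u' x) = l2_norm \<Omega> (\<lambda>x. - u' x)"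
    proof (rule l2_norm_cong_AE)
      show "AE x in lebesgue_on \<Omega>. (u s x - u t x) /\<^sub>R (s - t) - u' x = - u' x"
        using zero[OF that] zero[OF t(1)] by eventually_elim simp
    qed (use L2 that t in \<open>auto intro!: L2_diff L2_scaleR L2_uminus\<close>)
    then show ?thesis using l2_norm_scaleR[of \<Omega> "-1" u'] by simp
  qed
  then have "\<forall>\<^sub>F s in at t within T.
      l2_norm \<Omega> (\<lambda>x. (u s x - u t x) /\<^sub>R (s - t) - u' x) = l2_norm \<Omega> u'"
    by (simp add: eventually_at_filter)
  then have "((\<lambda>s. l2_norm \<Omega> u') \<longlongrightarrow> 0) (at t within T)"
    using der unfolding has_L2_derivative_def by (simp add: filterlim_cong)
  then have "l2_norm \<Omega> u' = 0"
    using t(2) by (simp add: tendsto_const_iff trivial_limit_within)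
  then show ?thesis using L2(2) by (simp add: l2_norm_eq_0_iff)
qed

section \<open>Exactness of the discrete complexes\<close>

text \<open>A convex set is contractible, so its homology in positive degree is trivial, and a free group
  embeds into a trivial group only if it has no generators.\<close>

lemma betti_convex:
  fixes S :: "'a::euclidean_space set"
  assumes "convex S" "k > 0"
  shows "betti k (top_of_set S) = 0"
proof -
  let ?G = "homology_group (int k) (top_of_set S)"
  have "contractible_space (top_of_set S)"
    using assms(1) convex_imp_contractible by simp
  then have "trivial_group ?G"
    using trivial_reduced_homology_group_contractible_space[of "top_of_set S" "int k"] assms(2)
    by (simp add: un_reduced_homology_group)
  then have G: "carrier ?G = {\<one>\<^bsub>?G\<^esub>}" "group ?G" by (auto simp: trivial_group_def)
  let ?P = "\<lambda>r :: nat. \<exists>h. h \<in> mon (free_Abelian_group {..<r}) ?G"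
  have "r \<le> 0" if "?P r" for r :: nat
  proof (rule ccontr)
    assume r: "\<not> r \<le> 0"
    obtain h where h: "h \<in> hom (free_Abelian_group {..<r}) ?G"
      "inj_on h (carrier (free_Abelian_group {..<r}))"
      using \<open>?P r\<close> by (auto simp: mon_def)
    have c: "frag_of 0 \<in> carrier (free_Abelian_group {..<r})" "0 \<in> carrier (free_Abelian_group {..<r})"
      using r by auto
    then have "h (frag_of 0) = \<one>\<^bsub>?G\<^esub>" "h 0 = \<one>\<^bsub>?G\<^esub>"
      using h(1) G(1) by (auto simp: hom_def Pi_iff simp del: carrier_free_Abelian_group_iff)
    then have "frag_of (0::nat) = 0" using h(2) c by (metis inj_onD)
    then show False by simp
  qed
  moreover have "?P 0"
  proof
    show "(\<lambda>x. \<one>\<^bsub>?G\<^esub>) \<in> mon (free_Abelian_group {..<0::nat}) ?G"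
    proof -
      have "(\<lambda>x. \<one>\<^bsub>?G\<^esub>) \<in> hom (free_Abelian_group {..<0::nat}) ?G"
        by (rule trivial_hom[OF G(2)])
      moreover have "inj_on (\<lambda>x. \<one>\<^bsub>?G\<^esub>) (carrier (free_Abelian_group {..<0::nat}))"
        by (simp add: inj_on_def)
      ultimately show ?thesis by (simp only: mon_def mem_Collect_eq)
    qed
  qed
  ultimately show ?thesis
    unfolding betti_def by (intro Greatest_equality)
qed

lemma L2_dim_0: "L2_dim \<Omega> V 0 \<Longrightarrow> f \<in> V \<Longrightarrow> AE x in lebesgue_on \<Omega>. f x = 0"
  by (auto simp: L2_dim_def)

text \<open>The residual of the orthogonal projection onto the range of \<open>D\<close> is a harmonic form.\<close>

lemma exists_potential:
  assumes U: "finite_dim \<Omega> U" and W: "finite_dim \<Omega> W"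
    and D: "ae_linear_on \<Omega> W D" "D ` W \<subseteq> U" and E: "ae_linear_on \<Omega> U E"
    and complex: "\<And>\<psi>. \<psi> \<in> W \<Longrightarrow> AE x in lebesgue_on \<Omega>. E (D \<psi>) x = 0"
    and harmonic: "L2_dim \<Omega> {v\<in>U. (AE x in lebesgue_on \<Omega>. E v x = 0) \<and>
                    (\<forall>\<xi>\<in>W. l2_inner \<Omega> v (D \<xi>) = 0)} 0"
    and v: "v \<in> U" "AE x in lebesgue_on \<Omega>. E v x = 0"
  shows "\<exists>\<psi>\<in>W. AE x in lebesgue_on \<Omega>. v x = D \<psi> x"
proof -
  have "v \<in> L2 \<Omega>" using v(1) finite_dim_subset_L2[OF U] by blast
  then obtain \<psi> where \<psi>: "\<psi> \<in> W" "\<forall>\<xi>\<in>W. l2_inner \<Omega> (\<lambda>x. v x - D \<psi> x) (D \<xi>) = 0"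
    using exists_projection_onto_range[OF W D(1)] by blast
  have D\<psi>: "D \<psi> \<in> U" using D(2) \<psi>(1) by blast
  have r: "(\<lambda>x. v x - D \<psi> x) \<in> U" by (rule finite_dim_diff[OF U v(1) D\<psi>])
  have "AE x in lebesgue_on \<Omega>. E (\<lambda>x. v x - D \<psi> x) x = 1 *\<^sub>R E v x + (- 1) *\<^sub>R E (D \<psi>) x"
    by (rule ae_linear_on_combination[OF E v(1) D\<psi> r]) simp
  then have "AE x in lebesgue_on \<Omega>. E (\<lambda>x. v x - D \<psi> x) x = 0"
    using v(2) complex[OF \<psi>(1)] by eventually_elim simp
  then have "AE x in lebesgue_on \<Omega>. v x - D \<psi> x = 0"
    using r \<psi>(2) by (intro L2_dim_0[OF harmonic]) simp
  then show ?thesis using \<psi>(1) by auto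
qed

lemma dvg_adj_eq_grad:
  assumes "\<phi> \<in> test_fields \<Omega>"
  shows "dvg_adj \<phi> = grad (\<lambda>x. - \<phi> x)"
proof -
  have "pd i (\<lambda>x. - \<phi> x) x = - pd i \<phi> x" for i x
    by (intro pd_linear[OF bounded_linear_minus[OF bounded_linear_ident]] C_infinity_differentiable
        test_fields_C_infinity[OF assms])
  then show ?thesis by (simp add: dvg_adj_def grad_def fun_eq_iff vec_eq_iff)
qed

text \<open>Both weak operators move onto a test field, where the identity \<open>curl grad = 0\<close> is classical. The
  following two lemmas rest in the same way on \<open>div curl = 0\<close> and on its planar analogue.\<close>

lemma w_div_w_curl:
  assumes \<Omega>: "open \<Omega>" "bounded \<Omega>" and \<xi>: "\<xi> \<in> H curl \<Omega>"
  shows "AE x in lebesgue_on \<Omega>. w_div \<Omega> (w_curl \<Omega> \<xi>) x = 0"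
proof -
  interpret C: weak_operator \<Omega> curl by (rule weak_operator_curl[OF \<Omega>])
  interpret D: weak_operator \<Omega> "dvg_adj :: (real^3 \<Rightarrow> real) \<Rightarrow> _" by (rule weak_operator_dvg_adj[OF \<Omega>])
  have "l2_inner \<Omega> (w_curl \<Omega> \<xi>) (dvg_adj \<phi>) = l2_inner \<Omega> (\<lambda>x. 0) \<phi>"
    if \<phi>: "\<phi> \<in> test_fields \<Omega>" for \<phi> :: "real^3 \<Rightarrow> real"
  proof -
    have "curl (dvg_adj \<phi>) = (\<lambda>x. 0)"
      using curl_grad_eq_0[OF test_fields_C_infinity[OF test_fields_uminus[OF \<phi>]]]
      by (simp add: dvg_adj_eq_grad[OF \<phi>] fun_eq_iff)
    then show ?thesis
      using C.weak_adjoint[OF \<xi> test_fields_dvg_adj[OF \<phi>]]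
      by (simp add: w_curl_def l2_inner_def)
  qed
  then have "is_weak dvg_adj \<Omega> (w_curl \<Omega> \<xi>) (\<lambda>x. 0)"
    by (simp add: is_weak_def L2_zero)
  then show ?thesis unfolding w_div_def by (rule D.weak_AE_eqI)
qed

lemma w_curl_w_grad:
  assumes \<Omega>: "open \<Omega>" "bounded \<Omega>" and \<alpha>: "\<alpha> \<in> H grad_adj \<Omega>"
  shows "AE x in lebesgue_on \<Omega>. w_curl \<Omega> (w_grad \<Omega> \<alpha>) x = 0"
proof -
  interpret C: weak_operator \<Omega> curl by (rule weak_operator_curl[OF \<Omega>])
  interpret G: weak_operator \<Omega> "grad_adj :: (real^3 \<Rightarrow> real^3) \<Rightarrow> _" by (rule weak_operator_grad_adj[OF \<Omega>])
  have "l2_inner \<Omega> (w_grad \<Omega> \<alpha>) (curl \<phi>) = l2_inner \<Omega> (\<lambda>x. 0) \<phi>"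
    if \<phi>: "\<phi> \<in> test_fields \<Omega>" for \<phi> :: "real^3 \<Rightarrow> real^3"
  proof -
    have "grad_adj (curl \<phi>) = (\<lambda>x. 0)"
      using dvg_curl_eq_0[OF test_fields_C_infinity[OF \<phi>]] by (simp add: grad_adj_def fun_eq_iff)
    then show ?thesis
      using G.weak_adjoint[OF \<alpha> test_fields_curl[OF \<phi>]] by (simp add: w_grad_def l2_inner_def)
  qed
  then have "is_weak curl \<Omega> (w_grad \<Omega> \<alpha>) (\<lambda>x. 0)"
    by (simp add: is_weak_def L2_zero)
  then show ?thesis unfolding w_curl_def by (rule C.weak_AE_eqI)
qed

lemma w_div_grad_perp:
  assumes \<Omega>: "open \<Omega>" "bounded \<Omega>" and \<psi>: "\<psi> \<in> H grad_adj \<Omega>"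
  shows "AE x in lebesgue_on \<Omega>. w_div \<Omega> (grad_perp \<Omega> \<psi>) x = 0"
proof -
  interpret G: weak_operator \<Omega> "grad_adj :: (real^2 \<Rightarrow> real^2) \<Rightarrow> _" by (rule weak_operator_grad_adj[OF \<Omega>])
  interpret D: weak_operator \<Omega> "dvg_adj :: (real^2 \<Rightarrow> real) \<Rightarrow> _" by (rule weak_operator_dvg_adj[OF \<Omega>])
  have "l2_inner \<Omega> (grad_perp \<Omega> \<psi>) (dvg_adj \<phi>) = l2_inner \<Omega> (\<lambda>x. 0) \<phi>"
    if \<phi>: "\<phi> \<in> test_fields \<Omega>" for \<phi> :: "real^2 \<Rightarrow> real"
  proof -
    let ?p = "\<lambda>x. perp (grad \<phi> x)"
    have p: "?p \<in> test_fields \<Omega>"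
      by (rule test_fields_linear[OF bounded_linear_perp test_fields_grad[OF \<phi>]])
    have "perp a \<bullet> (- b) = a \<bullet> perp b" for a b :: "real^2"
      by (simp add: perp_def inner_vec_def sum_2)
    then have "l2_inner \<Omega> (grad_perp \<Omega> \<psi>) (dvg_adj \<phi>) = l2_inner \<Omega> (w_grad \<Omega> \<psi>) ?p"
      unfolding l2_inner_def grad_perp_def dvg_adj_def by presburger
    also have "\<dots> = l2_inner \<Omega> \<psi> (grad_adj ?p)"
      unfolding w_grad_def by (rule G.weak_adjoint[OF \<psi> p])
    also have "grad_adj ?p = (\<lambda>x. 0)"
      using dvg_perp_grad_eq_0[OF test_fields_C_infinity[OF \<phi>]] by (simp add: grad_adj_def fun_eq_iff)
    finally show ?thesis by (simp add: l2_inner_def)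
  qed
  then have "is_weak dvg_adj \<Omega> (grad_perp \<Omega> \<psi>) (\<lambda>x. 0)"
    by (simp add: is_weak_def L2_zero)
  then show ?thesis unfolding w_div_def by (rule D.weak_AE_eqI)
qed

section \<open>Transport of a scalar by a divergence free field\<close>

lemma L2_mult_bounded:
  fixes s :: "real^'n \<Rightarrow> real"
  assumes s: "s \<in> borel_measurable (lebesgue_on \<Omega>)" "\<And>x. \<bar>s x\<bar> \<le> 1" and f: "f \<in> L2 \<Omega>"
  shows "(\<lambda>x. s x *\<^sub>R f x) \<in> L2 \<Omega>" "l2_norm \<Omega> (\<lambda>x. s x *\<^sub>R f x) \<le> l2_norm \<Omega> f"
proof -
  have le: "(s x *\<^sub>R f x) \<bullet> (s x *\<^sub>R f x) \<le> f x \<bullet> f x" for x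
  proof -
    have "(s x)\<^sup>2 \<le> 1" using s(2)[of x] by (simp add: abs_square_le_1)
    then have "(s x)\<^sup>2 * (f x \<bullet> f x) \<le> 1 * (f x \<bullet> f x)" by (intro mult_right_mono) auto
    then show ?thesis by (simp add: power2_eq_square mult.assoc)
  qed
  have ff: "integrable (lebesgue_on \<Omega>) (\<lambda>x. f x \<bullet> f x)" by (rule L2_integrable_inner[OF f f])
  have meas: "(\<lambda>x. s x *\<^sub>R f x) \<in> borel_measurable (lebesgue_on \<Omega>)"
    using s(1) L2_measurable[OF f] by (rule borel_measurable_scaleR)
  have int: "integrable (lebesgue_on \<Omega>) (\<lambda>x. (s x *\<^sub>R f x) \<bullet> (s x *\<^sub>R f x))"
  proof (rule Bochner_Integration.integrable_bound[OF ff])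
    show "(\<lambda>x. (s x *\<^sub>R f x) \<bullet> (s x *\<^sub>R f x)) \<in> borel_measurable (lebesgue_on \<Omega>)"
      by (intro borel_measurable_inner meas)
    have "norm ((s x *\<^sub>R f x) \<bullet> (s x *\<^sub>R f x)) \<le> norm (f x \<bullet> f x)" for x
      using le[of x] inner_ge_zero[of "s x *\<^sub>R f x"] by (simp only: real_norm_def abs_of_nonneg inner_ge_zero)
    then show "AE x in lebesgue_on \<Omega>. norm ((s x *\<^sub>R f x) \<bullet> (s x *\<^sub>R f x)) \<le> norm (f x \<bullet> f x)"
      by (rule AE_I2)
  qed
  show "(\<lambda>x. s x *\<^sub>R f x) \<in> L2 \<Omega>" by (rule L2_I[OF meas int])
  show "l2_norm \<Omega> (\<lambda>x. s x *\<^sub>R f x) \<le> l2_norm \<Omega> f"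
    unfolding l2_norm_def l2_inner_def by (intro real_sqrt_le_mono integral_mono int ff le)
qed

text \<open>Subtracting \<open>1\<close> makes the field vanish where \<open>\<phi>\<close> does.\<close>

lemma cosine_test_field:
  fixes \<phi> :: "real^'n \<Rightarrow> real"
  assumes \<phi>: "\<phi> \<in> test_fields \<Omega>"
  shows "(\<lambda>x. cos (\<epsilon> * \<phi> x) - 1) \<in> test_fields \<Omega>"
    and "grad (\<lambda>x. cos (\<epsilon> * \<phi> x) - 1) x = - (\<epsilon> * sin (\<epsilon> * \<phi> x)) *\<^sub>R grad \<phi> x"
proof -
  have e: "C_infinity (\<lambda>x. \<epsilon> * \<phi> x)"
    using test_fields_C_infinity[OF test_fields_linear[OF bounded_linear_mult_right \<phi>]] .
  show "(\<lambda>x. cos (\<epsilon> * \<phi> x) - 1) \<in> test_fields \<Omega>"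
  proof (rule test_fieldsI[OF \<phi>])
    show "C_infinity (\<lambda>x. cos (\<epsilon> * \<phi> x) - 1)"
      using C_k_sin_cos[OF e] C_k_const by (intro C_infinity_diff) auto
    show "cos (\<epsilon> * \<phi> x) - 1 = 0" if "x \<notin> closure {x. \<phi> x \<noteq> 0}" for x
    proof -
      have "\<phi> x = 0" using that closure_subset[of "{x. \<phi> x \<noteq> 0}"] by blast
      then show ?thesis by simp
    qed
  qed
  have "pd i (\<lambda>x. cos (\<epsilon> * \<phi> x) - 1) x = - (\<epsilon> * sin (\<epsilon> * \<phi> x)) * pd i \<phi> x" for i
  proof -
    have "(\<phi> has_derivative frechet_derivative \<phi> (at x)) (at x)"
      by (rule differentiable_has_derivative[OF C_infinity_differentiable[OF test_fields_C_infinity[OF \<phi>]]])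
    then have "((\<lambda>x. cos (\<epsilon> * \<phi> x) - 1) has_derivative
        (\<lambda>h. - (\<epsilon> * sin (\<epsilon> * \<phi> x)) * frechet_derivative \<phi> (at x) h)) (at x)"
      by (auto intro!: derivative_eq_intros)
    from pd_eqI[OF this] show ?thesis by (simp add: pd_def)
  qed
  then show "grad (\<lambda>x. cos (\<epsilon> * \<phi> x) - 1) x = - (\<epsilon> * sin (\<epsilon> * \<phi> x)) *\<^sub>R grad \<phi> x"
    by (simp add: grad_def vec_eq_iff)
qed

lemma L2_tendsto_AE_subseq:
  fixes f :: "nat \<Rightarrow> real^'n \<Rightarrow> real"
  assumes f: "\<And>k. f k \<in> L2 \<Omega>" and g: "g \<in> L2 \<Omega>"
    and lim: "(\<lambda>k. l2_norm \<Omega> (\<lambda>x. f k x - g x)) \<longlonglongrightarrow> 0"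
  obtains r where "strict_mono r" "AE x in lebesgue_on \<Omega>. (\<lambda>n. f (r n) x) \<longlonglongrightarrow> g x"
proof -
  have L2: "(\<lambda>x. f k x - g x) \<in> L2 \<Omega>" for k by (intro L2_diff f g)
  have int: "integrable (lebesgue_on \<Omega>) (\<lambda>x. (f k x - g x)\<^sup>2)" for k
    using L2_integrable_inner[OF L2[of k] L2[of k]] by (simp add: power2_eq_square)
  have "(\<integral>x. norm ((f k x - g x)\<^sup>2) \<partial>lebesgue_on \<Omega>) = (l2_norm \<Omega> (\<lambda>x. f k x - g x))\<^sup>2" for k
    unfolding l2_norm_power2 l2_inner_def by (simp add: power2_eq_square)
  then have "(\<lambda>k. \<integral>x. norm ((f k x - g x)\<^sup>2) \<partial>lebesgue_on \<Omega>) \<longlonglongrightarrow> 0"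
    using tendsto_power[OF lim, of 2] by simp
  from tendsto_L1_AE_subseq[OF int this] obtain r where r: "strict_mono r"
    "AE x in lebesgue_on \<Omega>. (\<lambda>n. (f (r n) x - g x)\<^sup>2) \<longlonglongrightarrow> 0" by blast
  from r(2) have "AE x in lebesgue_on \<Omega>. (\<lambda>n. f (r n) x) \<longlonglongrightarrow> g x"
  proof eventually_elim
    case (elim x)
    from tendsto_real_sqrt[OF elim] have "(\<lambda>n. \<bar>f (r n) x - g x\<bar>) \<longlonglongrightarrow> 0" by simp
    then show ?case by (intro LIM_zero_cancel[of "\<lambda>n. f (r n) x"]) (simp add: tendsto_rabs_zero_iff)
  qed
  with r(1) show thesis by (rule that)
qed

text \<open>The integrand is \<open>- 1/\<epsilon>\<close> times the product of \<open>u\<close> with the gradient of \<open>cos(\<epsilon> \<omega>) - 1\<close>, and \<open>u\<close> is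
  orthogonal to gradients of test fields. The sine is bounded, so the passage to the limit along
  test fields \<open>\<phi>\<close> tending to \<open>\<omega>\<close> only involves integrable products of two \<open>L\<^sup>2\<close> fields.\<close>

lemma integral_sin_transport_eq_0:
  fixes \<omega> :: "real^'n \<Rightarrow> real" and u :: "real^'n \<Rightarrow> real^'n"
  assumes \<Omega>: "open \<Omega>" "bounded \<Omega>" and \<omega>: "\<omega> \<in> H1_0 \<Omega>"
    and u: "u \<in> H dvg_adj \<Omega>" "AE x in lebesgue_on \<Omega>. w_div \<Omega> u x = 0" and \<epsilon>: "\<epsilon> > 0"
  shows "(\<integral>x. sin (\<epsilon> * \<omega> x) * (u x \<bullet> w_grad \<Omega> \<omega> x) \<partial>lebesgue_on \<Omega>) = 0"
proof -
  let ?M = "lebesgue_on \<Omega>" and ?g = "w_grad \<Omega> \<omega>"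
  interpret G: weak_operator \<Omega> "grad_adj :: (real^'n \<Rightarrow> real^'n) \<Rightarrow> _" by (rule weak_operator_grad_adj[OF \<Omega>])
  interpret D: weak_operator \<Omega> "dvg_adj :: (real^'n \<Rightarrow> real) \<Rightarrow> _" by (rule weak_operator_dvg_adj[OF \<Omega>])
  have \<omega>H: "\<omega> \<in> H grad_adj \<Omega>" using \<omega> by (simp add: H1_0_def H0_def)
  have \<omega>L2: "\<omega> \<in> L2 \<Omega>" by (rule G.H_L2[OF \<omega>H])
  have uL2: "u \<in> L2 \<Omega>" by (rule D.H_L2[OF u(1)])
  have gL2: "?g \<in> L2 \<Omega>" unfolding w_grad_def by (rule G.weak_L2[OF \<omega>H])
  obtain \<phi> :: "nat \<Rightarrow> real^'n \<Rightarrow> real" where \<phi>: "\<And>k. \<phi> k \<in> test_fields \<Omega>"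
    and lim: "(\<lambda>k. l2_norm \<Omega> (\<lambda>x. \<phi> k x - \<omega> x)) \<longlonglongrightarrow> 0"
    and limg: "(\<lambda>k. l2_norm \<Omega> (\<lambda>x. grad (\<phi> k) x - ?g x)) \<longlonglongrightarrow> 0"
    using \<omega> by (auto simp: H1_0_def H0_def w_grad_def)
  have \<phi>L2: "\<phi> k \<in> L2 \<Omega>" and g\<phi>L2: "grad (\<phi> k) \<in> L2 \<Omega>" for k
    by (intro test_fields_L2[OF \<Omega>] test_fields_grad \<phi>)+
  define v where "v k = (\<lambda>x. sin (\<epsilon> * \<phi> k x) *\<^sub>R u x)" for k
  have meas: "(\<lambda>x. sin (\<epsilon> * f x)) \<in> borel_measurable ?M" if "f \<in> L2 \<Omega>" for f :: "real^'n \<Rightarrow> real"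
    using L2_measurable[OF that] by measurable
  have vL2: "v k \<in> L2 \<Omega>" and v_norm: "l2_norm \<Omega> (v k) \<le> l2_norm \<Omega> u" for k
    unfolding v_def by (intro L2_mult_bounded meas \<phi>L2 uL2 abs_sin_le_one)+
  have v0: "l2_inner \<Omega> (v k) (grad (\<phi> k)) = 0" for k
  proof -
    let ?\<psi> = "\<lambda>x. cos (\<epsilon> * \<phi> k x) - 1"
    have "0 = l2_inner \<Omega> ?\<psi> (w_div \<Omega> u)" using u(2) by (simp add: l2_inner_zero_AE)
    also have "\<dots> = l2_inner \<Omega> (w_div \<Omega> u) ?\<psi>" by (rule l2_inner_commute)
    also have "\<dots> = l2_inner \<Omega> u (dvg_adj ?\<psi>)"
      unfolding w_div_def by (rule D.weak_adjoint[OF u(1) cosine_test_field(1)[OF \<phi>]])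
    also have "\<dots> = l2_inner \<Omega> u (\<lambda>x. \<epsilon> *\<^sub>R (sin (\<epsilon> * \<phi> k x) *\<^sub>R grad (\<phi> k) x))"
      unfolding dvg_adj_def cosine_test_field(2)[OF \<phi>] by simp
    also have "\<dots> = \<epsilon> * l2_inner \<Omega> (v k) (grad (\<phi> k))"
      unfolding l2_inner_scaleR_right by (simp add: l2_inner_def v_def)
    finally show ?thesis using \<epsilon> by simp
  qed
  have "(\<lambda>k. l2_inner \<Omega> (v k) ?g) \<longlonglongrightarrow> 0"
  proof (rule Lim_null_comparison)
    have "norm (l2_inner \<Omega> (v k) ?g) \<le> l2_norm \<Omega> u * l2_norm \<Omega> (\<lambda>x. grad (\<phi> k) x - ?g x)" for k
    proof -
      have "l2_inner \<Omega> (v k) ?g = - l2_inner \<Omega> (v k) (\<lambda>x. grad (\<phi> k) x - ?g x)"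
        using v0[of k] l2_inner_diff_right[OF g\<phi>L2[of k] gL2 vL2[of k]] by simp
      also have "norm \<dots> \<le> l2_norm \<Omega> (v k) * l2_norm \<Omega> (\<lambda>x. grad (\<phi> k) x - ?g x)"
        using l2_Cauchy_Schwarz[OF vL2[of k] L2_diff[OF g\<phi>L2[of k] gL2]] by simp
      also have "\<dots> \<le> l2_norm \<Omega> u * l2_norm \<Omega> (\<lambda>x. grad (\<phi> k) x - ?g x)"
        by (intro mult_right_mono v_norm) simp
      finally show ?thesis .
    qed
    then show "\<forall>\<^sub>F k in sequentially. norm (l2_inner \<Omega> (v k) ?g)
        \<le> l2_norm \<Omega> u * l2_norm \<Omega> (\<lambda>x. grad (\<phi> k) x - ?g x)" by (rule always_eventually[OF allI])
    show "(\<lambda>k. l2_norm \<Omega> u * l2_norm \<Omega> (\<lambda>x. grad (\<phi> k) x - ?g x)) \<longlonglongrightarrow> 0"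
      by (rule tendsto_mult_right_zero[OF limg])
  qed
  moreover obtain r where r: "strict_mono r" "AE x in ?M. (\<lambda>n. \<phi> (r n) x) \<longlonglongrightarrow> \<omega> x"
    by (rule L2_tendsto_AE_subseq[OF \<phi>L2 \<omega>L2 lim])
  ultimately have "(\<lambda>n. l2_inner \<Omega> (v (r n)) ?g) \<longlonglongrightarrow> 0"
    using LIMSEQ_subseq_LIMSEQ[of "\<lambda>k. l2_inner \<Omega> (v k) ?g"] by (simp add: comp_def)
  moreover have "(\<lambda>n. l2_inner \<Omega> (v (r n)) ?g) \<longlonglongrightarrow> (\<integral>x. sin (\<epsilon> * \<omega> x) * (u x \<bullet> ?g x) \<partial>?M)"
    unfolding l2_inner_def
  proof (rule integral_dominated_convergence[where w = "\<lambda>x. \<bar>u x \<bullet> ?g x\<bar>"])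
    have ug: "integrable ?M (\<lambda>x. u x \<bullet> ?g x)" by (rule L2_integrable_inner[OF uL2 gL2])
    then show "integrable ?M (\<lambda>x. \<bar>u x \<bullet> ?g x\<bar>)" by (rule integrable_abs)
    show "(\<lambda>x. sin (\<epsilon> * \<omega> x) * (u x \<bullet> ?g x)) \<in> borel_measurable ?M"
      by (intro borel_measurable_times meas \<omega>L2 borel_measurable_integrable ug)
    show "(\<lambda>x. v (r n) x \<bullet> ?g x) \<in> borel_measurable ?M" for n
      by (rule borel_measurable_integrable[OF L2_integrable_inner[OF vL2 gL2]])
    show "AE x in ?M. (\<lambda>n. v (r n) x \<bullet> ?g x) \<longlonglongrightarrow> sin (\<epsilon> * \<omega> x) * (u x \<bullet> ?g x)"
      using r(2)
    proof eventually_elim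
      case (elim x)
      have "(\<lambda>n. sin (\<epsilon> * \<phi> (r n) x) * (u x \<bullet> ?g x)) \<longlonglongrightarrow> sin (\<epsilon> * \<omega> x) * (u x \<bullet> ?g x)"
        by (intro tendsto_mult tendsto_sin tendsto_const elim)
      then show ?case by (simp add: v_def)
    qed
    have "norm (v k x \<bullet> ?g x) \<le> \<bar>u x \<bullet> ?g x\<bar>" for k x
      using mult_right_mono[OF abs_sin_le_one[of "\<epsilon> * \<phi> k x"] abs_ge_zero[of "u x \<bullet> ?g x"]]
      by (simp add: v_def abs_mult)
    then show "AE x in ?M. norm (v (r n) x \<bullet> ?g x) \<le> \<bar>u x \<bullet> ?g x\<bar>" for n
      by (intro AE_I2)
  qed
  ultimately show ?thesis by (rule LIMSEQ_unique[symmetric])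
qed

text \<open>If the integrand is integrable, then it dominates \<open>sin(\<epsilon> \<omega>)/\<epsilon> u \<bullet> grad \<omega>\<close>, which converges to it
  for \<open>\<epsilon> \<rightarrow> 0\<close>. Otherwise its Bochner integral is zero by convention.\<close>

lemma integral_transport_eq_0:
  fixes \<omega> :: "real^'n \<Rightarrow> real" and u :: "real^'n \<Rightarrow> real^'n"
  assumes \<Omega>: "open \<Omega>" "bounded \<Omega>" and \<omega>: "\<omega> \<in> H1_0 \<Omega>"
    and u: "u \<in> H dvg_adj \<Omega>" "AE x in lebesgue_on \<Omega>. w_div \<Omega> u x = 0"
  shows "(\<integral>x. \<omega> x * (u x \<bullet> w_grad \<Omega> \<omega> x) \<partial>lebesgue_on \<Omega>) = 0"
proof (cases "integrable (lebesgue_on \<Omega>) (\<lambda>x. \<omega> x * (u x \<bullet> w_grad \<Omega> \<omega> x))")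
  case True
  let ?M = "lebesgue_on \<Omega>" and ?g = "w_grad \<Omega> \<omega>"
  interpret G: weak_operator \<Omega> "grad_adj :: (real^'n \<Rightarrow> real^'n) \<Rightarrow> _" by (rule weak_operator_grad_adj[OF \<Omega>])
  interpret D: weak_operator \<Omega> "dvg_adj :: (real^'n \<Rightarrow> real) \<Rightarrow> _" by (rule weak_operator_dvg_adj[OF \<Omega>])
  have \<omega>H: "\<omega> \<in> H grad_adj \<Omega>" using \<omega> by (simp add: H1_0_def H0_def)
  have meas: "(\<lambda>x. u x \<bullet> ?g x) \<in> borel_measurable ?M" "\<omega> \<in> borel_measurable ?M"
    using L2_measurable[OF D.H_L2[OF u(1)]] L2_measurable[OF G.weak_L2[OF \<omega>H]]
      L2_measurable[OF G.H_L2[OF \<omega>H]]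
    by (auto intro: borel_measurable_inner simp: w_grad_def)
  define h where "h n = inverse (real (Suc n))" for n
  have h: "h n > 0" for n by (simp add: h_def)
  have "(\<lambda>n. \<integral>x. (sin (h n * \<omega> x) * (u x \<bullet> ?g x)) / h n \<partial>?M) \<longlonglongrightarrow> (\<integral>x. \<omega> x * (u x \<bullet> ?g x) \<partial>?M)"
  proof (rule integral_dominated_convergence[where w = "\<lambda>x. \<bar>\<omega> x * (u x \<bullet> ?g x)\<bar>"])
    show "integrable ?M (\<lambda>x. \<bar>\<omega> x * (u x \<bullet> ?g x)\<bar>)" using True by (rule integrable_abs)
    show "(\<lambda>x. \<omega> x * (u x \<bullet> ?g x)) \<in> borel_measurable ?M"
      using True by (rule borel_measurable_integrable)
    show "(\<lambda>x. (sin (h n * \<omega> x) * (u x \<bullet> ?g x)) / h n) \<in> borel_measurable ?M" for n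
      using meas by measurable
    have "(\<lambda>n. (sin (h n * y) * z) / h n) \<longlonglongrightarrow> y * z" for y z :: real
    proof -
      have "((\<lambda>s. sin (s * y)) has_real_derivative y) (at 0)"
        by (auto intro!: derivative_eq_intros)
      then have "((\<lambda>s. sin (s * y) / s) \<longlongrightarrow> y) (at 0)"
        by (simp add: DERIV_def)
      moreover have "filterlim h (at 0) sequentially"
        unfolding h_def using LIMSEQ_inverse_real_of_nat by (intro filterlim_atI) auto
      ultimately have "(\<lambda>n. sin (h n * y) / h n) \<longlonglongrightarrow> y"
        by (rule filterlim_compose)
      from tendsto_mult[OF this tendsto_const[of z]] show ?thesis by simp
    qed
    then show "AE x in ?M. (\<lambda>n. (sin (h n * \<omega> x) * (u x \<bullet> ?g x)) / h n) \<longlonglongrightarrow> \<omega> x * (u x \<bullet> ?g x)"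
      by (intro AE_I2)
    have "norm ((sin (h n * y) * z) / h n) \<le> \<bar>y * z\<bar>" for n and y z :: real
    proof -
      have "\<bar>sin (h n * y)\<bar> * \<bar>z\<bar> \<le> \<bar>h n * y\<bar> * \<bar>z\<bar>"
        by (intro mult_right_mono abs_sin_x_le_abs_x) simp
      then show ?thesis using h[of n] by (simp add: abs_mult divide_le_eq mult_ac)
    qed
    then show "AE x in ?M. norm ((sin (h n * \<omega> x) * (u x \<bullet> ?g x)) / h n) \<le> \<bar>\<omega> x * (u x \<bullet> ?g x)\<bar>" for n
      by (intro AE_I2)
  qed
  moreover have "(\<integral>x. (sin (h n * \<omega> x) * (u x \<bullet> ?g x)) / h n \<partial>?M) = 0" for n
    using integral_sin_transport_eq_0[OF \<Omega> \<omega> u h] by simp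
  ultimately have "(\<lambda>n. 0) \<longlonglongrightarrow> (\<integral>x. \<omega> x * (u x \<bullet> ?g x) \<partial>?M)"
    by (simp only:)
  then show ?thesis by (rule LIMSEQ_unique[OF _ tendsto_const])
qed (rule not_integrable_integral_eq)

section \<open>Energy and enstrophy\<close>

lemma convex_polytopal_domain_simps:
  assumes "convex_polytopal_domain \<Omega>"
  shows "open \<Omega>" "bounded \<Omega>" "convex \<Omega>"
  using assms by (auto simp: convex_polytopal_domain_def)

lemma interval_islimpt:
  fixes T :: "real set"
  assumes "is_interval T" "interior T \<noteq> {}" "t \<in> T"
  shows "t islimpt T"
proof -
  have "T \<noteq> {t}" using assms(2) by auto
  then show ?thesis
    using connected_imp_perfect assms(1,3) is_interval_connected by blast
qed

lemma bounded_linear_symmetric_part: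
  "bounded_linear (\<lambda>M :: real^'n^'n. (1/2) *\<^sub>R (M + transpose M))"
proof -
  have "linear (\<lambda>M :: real^'n^'n. (1/2) *\<^sub>R (M + transpose M))"
    by (rule linearI) (simp_all add: vec_eq_iff transpose_def algebra_simps)
  then show ?thesis by (simp add: linear_conv_bounded_linear)
qed

lemma ae_linear_on_sym_grad:
  fixes \<Omega> :: "(real^'n) set"
  assumes "open \<Omega>" "bounded \<Omega>" "U \<subseteq> H1 \<Omega>"
  shows "ae_linear_on \<Omega> U (sym_grad \<Omega>)"
proof -
  interpret G: weak_operator \<Omega> "grad_adj :: (real^'n \<Rightarrow> real^'n^'n) \<Rightarrow> _"
    by (rule weak_operator_grad_adj[OF assms(1,2)])
  have "ae_linear_on \<Omega> U (w_grad \<Omega>)"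
    unfolding w_grad_def using assms(3) by (intro G.ae_linear_on_weak) (simp add: H1_def)
  from ae_linear_on_compose[OF bounded_linear_symmetric_part this]
  show ?thesis by (simp add: sym_grad_def[abs_def])
qed

lemma ae_linear_on_w_div:
  fixes \<Omega> :: "(real^'n) set"
  assumes "open \<Omega>" "bounded \<Omega>" "U \<subseteq> Hdiv_0 \<Omega>"
  shows "ae_linear_on \<Omega> U (w_div \<Omega>)"
proof -
  interpret D: weak_operator \<Omega> "dvg_adj :: (real^'n \<Rightarrow> real) \<Rightarrow> _"
    by (rule weak_operator_dvg_adj[OF assms(1,2)])
  show ?thesis
    unfolding w_div_def using assms(3) by (intro D.ae_linear_on_weak) (auto simp: Hdiv_0_def H0_def)
qed

text \<open>The part of the argument that does not depend on the dimension: the time derivative stays in the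
  discrete velocity space, stays divergence free, and may be taken under the symmetric gradient.\<close>

lemma solution_time_derivatives:
  assumes \<Omega>: "open \<Omega>" "bounded \<Omega>" and U: "finite_dim \<Omega> U" "U \<subseteq> H1 \<Omega> \<inter> Hdiv_0 \<Omega>"
    and der: "C1_in_time \<Omega> T u du" and u: "\<And>s. s \<in> T \<Longrightarrow> u s \<in> U"
    and div: "\<And>s. s \<in> T \<Longrightarrow> AE x in lebesgue_on \<Omega>. w_div \<Omega> (u s) x = 0"
    and t: "t \<in> T" "t islimpt T"
  shows "du t \<in> U" "AE x in lebesgue_on \<Omega>. w_div \<Omega> (du t) x = 0"
    and "((\<lambda>s. energy \<Omega> (u s)) has_real_derivative l2_inner \<Omega> (du t) (u t)) (at t within T)"
    and "((\<lambda>s. enstrophy \<Omega> (u s)) has_real_derivative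
           2 * l2_inner \<Omega> (sym_grad \<Omega> (u t)) (sym_grad \<Omega> (du t))) (at t within T)"
proof -
  have E: "ae_linear_on \<Omega> U (sym_grad \<Omega>)" using U(2) by (intro ae_linear_on_sym_grad \<Omega>) auto
  have D: "ae_linear_on \<Omega> U (w_div \<Omega>)" using U(2) by (intro ae_linear_on_w_div \<Omega>) auto
  have uL2: "u s \<in> L2 \<Omega>" if "s \<in> T" for s using u[OF that] finite_dim_subset_L2[OF U(1)] by blast
  have duL2: "du t \<in> L2 \<Omega>" and u': "has_L2_derivative \<Omega> T t u (du t)"
    using der t(1) by (auto simp: C1_in_time_def has_L2_derivative_def)
  show du: "du t \<in> U"
    by (rule has_L2_derivative_in_finite_dim[OF U(1) u t duL2 u'])
  show "AE x in lebesgue_on \<Omega>. w_div \<Omega> (du t) x = 0"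
    by (rule has_L2_derivative_AE_zero[OF div ae_linear_on_L2[OF D u] ae_linear_on_L2[OF D du] t
          has_L2_derivative_operator[OF U(1) D u t(1) du u']])
  have "((\<lambda>s. (1/2) * l2_inner \<Omega> (u s) (u s)) has_real_derivative
      (1/2) * (2 * l2_inner \<Omega> (u t) (du t))) (at t within T)"
    by (intro DERIV_cmult has_L2_derivative_norm_square uL2 t(1) duL2 u')
  then show "((\<lambda>s. energy \<Omega> (u s)) has_real_derivative l2_inner \<Omega> (du t) (u t)) (at t within T)"
    by (simp add: energy_def l2_norm_power2 l2_inner_commute)
  show "((\<lambda>s. enstrophy \<Omega> (u s)) has_real_derivative
      2 * l2_inner \<Omega> (sym_grad \<Omega> (u t)) (sym_grad \<Omega> (du t))) (at t within T)"
    unfolding enstrophy_def l2_norm_power2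
    by (intro has_L2_derivative_norm_square ae_linear_on_L2[OF E] u t(1) du
          has_L2_derivative_operator[OF U(1) E u t(1) du u'])
qed

text \<open>For the enstrophy, \<open>\<partial>\<^sub>t u = curl \<psi>\<close>, and the vorticity equation tested with \<open>\<psi>\<close> turns
  twice the inner product of the symmetric gradients of \<open>u\<close> and \<open>\<partial>\<^sub>t u\<close> into \<open>(curl \<omega>, \<partial>\<^sub>t u)\<close>. The momentum equation tested with \<open>curl \<omega>\<close> evaluates this,
  and the vorticity equation tested with \<open>\<omega>\<close> evaluates the viscous term.\<close>

lemma stokes_3d_balance:
  assumes dom: "convex_polytopal_domain \<Omega>" and cx: "stokes_complex_3d \<Omega> A W U P"
    and sol: "solution_3d \<Omega> Rey T A W U P \<alpha> \<omega> u p" and t: "t \<in> T" "t islimpt T"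
  shows "((\<lambda>s. energy \<Omega> (u s)) has_real_derivative - (2/Rey) * enstrophy \<Omega> (u t)) (at t within T)"
    and "((\<lambda>s. enstrophy \<Omega> (u s)) has_real_derivative
           advection_3d \<Omega> (u t) (\<omega> t) - (1/Rey) * (l2_norm \<Omega> (w_curl \<Omega> (\<omega> t)))\<^sup>2) (at t within T)"
proof -
  note \<Omega> = convex_polytopal_domain_simps(1,2)[OF dom]
  have fd: "finite_dim \<Omega> W" "finite_dim \<Omega> U"
    and sub: "A \<subseteq> H1_0 \<Omega>" "W \<subseteq> Hcurl_0 \<Omega>" "U \<subseteq> H1 \<Omega> \<inter> Hdiv_0 \<Omega>"
    and maps: "w_grad \<Omega> ` A \<subseteq> W" "w_curl \<Omega> ` W \<subseteq> U" "w_div \<Omega> ` U \<subseteq> P"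
    using cx by (auto simp: stokes_complex_3d_def)
  have "L2_dim \<Omega> {v\<in>U. (AE x in lebesgue_on \<Omega>. w_div \<Omega> v x = 0) \<and>
      (\<forall>\<xi>\<in>W. l2_inner \<Omega> v (w_curl \<Omega> \<xi>) = 0)} (betti 1 (top_of_set \<Omega>))"
    using cx unfolding stokes_complex_3d_def by blast
  then have harmonic: "L2_dim \<Omega> {v\<in>U. (AE x in lebesgue_on \<Omega>. w_div \<Omega> v x = 0) \<and>
      (\<forall>\<xi>\<in>W. l2_inner \<Omega> v (w_curl \<Omega> \<xi>) = 0)} 0"
    using betti_convex[OF convex_polytopal_domain_simps(3)[OF dom], of 1] by simp
  have val: "\<alpha> s \<in> A" "\<omega> s \<in> W" "u s \<in> U" "p s \<in> P" if "s \<in> T" for s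
    using sol that by (auto simp: solution_3d_def)
  obtain du where C1: "C1_in_time \<Omega> T u du" and
    eqs: "\<And>s \<beta> \<xi> v q. s \<in> T \<Longrightarrow> \<beta> \<in> A \<Longrightarrow> \<xi> \<in> W \<Longrightarrow> v \<in> U \<Longrightarrow> q \<in> P \<Longrightarrow>
      0 = l2_inner \<Omega> (\<omega> s) (w_grad \<Omega> \<beta>) \<and>
      l2_inner \<Omega> (w_curl \<Omega> (\<omega> s)) (w_curl \<Omega> \<xi>) =
        2 * l2_inner \<Omega> (sym_grad \<Omega> (u s)) (sym_grad \<Omega> (w_curl \<Omega> \<xi>))
        - l2_inner \<Omega> (w_grad \<Omega> (\<alpha> s)) \<xi> \<and>
      l2_inner \<Omega> (du s) v =
        l2_inner \<Omega> (\<lambda>x. cross3 (u s x) (\<omega> s x)) v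
        + l2_inner \<Omega> (\<lambda>x. (1/2) * (norm (u s x))\<^sup>2 + p s x) (w_div \<Omega> v)
        - (2/Rey) * l2_inner \<Omega> (sym_grad \<Omega> (u s)) (sym_grad \<Omega> v) \<and>
      0 = l2_inner \<Omega> (w_div \<Omega> (u s)) q"
    using sol unfolding solution_3d_def by blast
  have vorticity: "l2_inner \<Omega> (w_curl \<Omega> (\<omega> t)) (w_curl \<Omega> \<xi>) =
      2 * l2_inner \<Omega> (sym_grad \<Omega> (u t)) (sym_grad \<Omega> (w_curl \<Omega> \<xi>)) - l2_inner \<Omega> (w_grad \<Omega> (\<alpha> t)) \<xi>"
    if "\<xi> \<in> W" for \<xi>
    using eqs[OF t(1) val(1)[OF t(1)] that val(3,4)[OF t(1)]] by blast
  have momentum: "l2_inner \<Omega> (du t) v = l2_inner \<Omega> (\<lambda>x. cross3 (u t x) (\<omega> t x)) v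
      + l2_inner \<Omega> (\<lambda>x. (1/2) * (norm (u t x))\<^sup>2 + p t x) (w_div \<Omega> v)
      - (2/Rey) * l2_inner \<Omega> (sym_grad \<Omega> (u t)) (sym_grad \<Omega> v)" if "v \<in> U" for v
    using eqs[OF t(1) val(1,2)[OF t(1)] that val(4)[OF t(1)]] by blast
  have mass: "l2_inner \<Omega> (w_div \<Omega> (u s)) q = 0" if "s \<in> T" "q \<in> P" for s q
    using eqs[OF that(1) val(1-3)[OF that(1)] that(2)] by simp
  interpret C: weak_operator \<Omega> curl by (rule weak_operator_curl[OF \<Omega>])
  have WH: "W \<subseteq> H curl \<Omega>" using sub(2) by (auto simp: Hcurl_0_def H0_def)
  have K: "ae_linear_on \<Omega> W (w_curl \<Omega>)" unfolding w_curl_def by (rule C.ae_linear_on_weak[OF WH])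
  have E: "ae_linear_on \<Omega> U (sym_grad \<Omega>)" using sub(3) by (intro ae_linear_on_sym_grad \<Omega>) auto
  have D: "ae_linear_on \<Omega> U (w_div \<Omega>)" using sub(3) by (intro ae_linear_on_w_div \<Omega>) auto
  have div: "AE x in lebesgue_on \<Omega>. w_div \<Omega> (u s) x = 0" if s: "s \<in> T" for s
  proof -
    have "w_div \<Omega> (u s) \<in> P" using maps(3) val(3)[OF s] by blast
    then show ?thesis
      using mass[OF s] l2_inner_self_eq_0_iff[OF ae_linear_on_L2[OF D val(3)[OF s]]] by blast
  qed
  note der = solution_time_derivatives[OF \<Omega> fd(2) sub(3) C1 val(3) div t]
  have "l2_inner \<Omega> (du t) (u t) = - (2/Rey) * enstrophy \<Omega> (u t)"
  proof -
    have "l2_inner \<Omega> (\<lambda>x. cross3 (u t x) (\<omega> t x)) (u t) = 0"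
      by (simp add: l2_inner_def dot_cross_self)
    then show ?thesis
      using momentum[OF val(3)[OF t(1)]] l2_inner_zero_AE[OF div[OF t(1)]]
      by (simp add: enstrophy_def l2_norm_power2)
  qed
  then show "((\<lambda>s. energy \<Omega> (u s)) has_real_derivative - (2/Rey) * enstrophy \<Omega> (u t)) (at t within T)"
    using der(3) by simp
  have div_curl: "AE x in lebesgue_on \<Omega>. w_div \<Omega> (w_curl \<Omega> \<xi>) x = 0" if "\<xi> \<in> W" for \<xi>
    using that WH by (intro w_div_w_curl \<Omega>) blast
  obtain \<psi> where \<psi>: "\<psi> \<in> W" "AE x in lebesgue_on \<Omega>. du t x = w_curl \<Omega> \<psi> x"
    using exists_potential[where D = "w_curl \<Omega>" and E = "w_div \<Omega>" and v = "du t",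
        OF fd(2,1) K maps(2) D div_curl harmonic der(1,2)] by auto
  have curlU: "w_curl \<Omega> \<xi> \<in> U" if "\<xi> \<in> W" for \<xi> using maps(2) that by blast
  have UL2: "v \<in> L2 \<Omega>" if "v \<in> U" for v using finite_dim_subset_L2[OF fd(2)] that by blast
  \<comment> \<open>The vorticity equation tested with the curl free field \<open>grad \<alpha>\<close> reduces to \<open>\<parallel>grad \<alpha>\<parallel>\<^sup>2 = 0\<close>.\<close>
  have "AE x in lebesgue_on \<Omega>. w_grad \<Omega> (\<alpha> t) x = 0"
  proof -
    let ?g = "w_grad \<Omega> (\<alpha> t)"
    have g: "?g \<in> W" using maps(1) val(1)[OF t(1)] by blast
    have "\<alpha> t \<in> H grad_adj \<Omega>" using sub(1) val(1)[OF t(1)] by (auto simp: H1_0_def H0_def)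
    then have c: "AE x in lebesgue_on \<Omega>. w_curl \<Omega> ?g x = 0" by (rule w_curl_w_grad[OF \<Omega>])
    have "l2_inner \<Omega> ?g ?g = 0"
      using vorticity[OF g] l2_inner_zero_AE[OF c] l2_inner_zero_AE[OF ae_linear_on_zero[OF E curlU[OF g] c]]
      by simp
    moreover have "?g \<in> L2 \<Omega>" using g finite_dim_subset_L2[OF fd(1)] by blast
    ultimately show ?thesis by (simp add: l2_inner_self_eq_0_iff)
  qed
  then have "l2_inner \<Omega> (w_grad \<Omega> (\<alpha> t)) \<xi> = 0" for \<xi>
    by (subst l2_inner_commute) (rule l2_inner_zero_AE)
  then have vorticity': "2 * l2_inner \<Omega> (sym_grad \<Omega> (u t)) (sym_grad \<Omega> (w_curl \<Omega> \<xi>)) =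
      l2_inner \<Omega> (w_curl \<Omega> (\<omega> t)) (w_curl \<Omega> \<xi>)" if "\<xi> \<in> W" for \<xi>
    using vorticity[OF that] by simp
  let ?c = "w_curl \<Omega> (\<omega> t)"
  have c: "?c \<in> U" by (rule curlU[OF val(2)[OF t(1)]])
  have "AE x in lebesgue_on \<Omega>. sym_grad \<Omega> (du t) x = sym_grad \<Omega> (w_curl \<Omega> \<psi>) x"
    by (rule ae_linear_on_cong[OF E der(1) curlU[OF \<psi>(1)] \<psi>(2)])
  then have "2 * l2_inner \<Omega> (sym_grad \<Omega> (u t)) (sym_grad \<Omega> (du t))
      = 2 * l2_inner \<Omega> (sym_grad \<Omega> (u t)) (sym_grad \<Omega> (w_curl \<Omega> \<psi>))"
    using ae_linear_on_L2[OF E] val(3)[OF t(1)] der(1) curlU[OF \<psi>(1)]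
    by (intro arg_cong[of _ _ "(*) 2"] l2_inner_cong_AE) auto
  also have "\<dots> = l2_inner \<Omega> ?c (w_curl \<Omega> \<psi>)" by (rule vorticity'[OF \<psi>(1)])
  also have "\<dots> = l2_inner \<Omega> (du t) ?c"
    using \<psi>(2) UL2[OF der(1)] UL2[OF c] UL2[OF curlU[OF \<psi>(1)]]
    by (subst l2_inner_commute) (intro l2_inner_cong_AE, auto)
  also have "\<dots> = advection_3d \<Omega> (u t) (\<omega> t) - (1/Rey) * (l2_norm \<Omega> ?c)\<^sup>2"
  proof -
    have "l2_inner \<Omega> (\<lambda>x. cross3 (u t x) (\<omega> t x)) ?c = advection_3d \<Omega> (u t) (\<omega> t)"
      unfolding l2_inner_def advection_3d_def
      by (intro Bochner_Integration.integral_cong refl) (simp add: cross3_simps)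
    then show ?thesis
      using momentum[OF c] l2_inner_zero_AE[OF div_curl[OF val(2)[OF t(1)]]] vorticity'[OF val(2)[OF t(1)]]
      by (simp add: l2_norm_power2)
  qed
  finally show "((\<lambda>s. enstrophy \<Omega> (u s)) has_real_derivative
           advection_3d \<Omega> (u t) (\<omega> t) - (1/Rey) * (l2_norm \<Omega> ?c)\<^sup>2) (at t within T)"
    using der(4) by simp
qed

text \<open>The argument is that of three dimensions with \<open>curl\<close> replaced by the rotated gradient. Since the
  rotation is an isometry, the vorticity equation can be written with rotated gradients only.\<close>

lemma stokes_2d_balance:
  assumes dom: "convex_polytopal_domain \<Omega>" and cx: "stokes_complex_2d \<Omega> W U P"
    and sol: "solution_2d \<Omega> Rey T W U P \<omega> u p" and t: "t \<in> T" "t islimpt T"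
  shows "((\<lambda>s. energy \<Omega> (u s)) has_real_derivative - (2/Rey) * enstrophy \<Omega> (u t)) (at t within T)"
    and "((\<lambda>s. enstrophy \<Omega> (u s)) has_real_derivative
           advection_2d \<Omega> (u t) (\<omega> t) - (1/Rey) * (l2_norm \<Omega> (curl_2d \<Omega> (\<omega> t)))\<^sup>2) (at t within T)"
    and "advection_2d \<Omega> (u t) (\<omega> t) = 0"
proof -
  note \<Omega> = convex_polytopal_domain_simps(1,2)[OF dom]
  have fd: "finite_dim \<Omega> W" "finite_dim \<Omega> U"
    and sub: "W \<subseteq> H1_0 \<Omega>" "U \<subseteq> H1 \<Omega> \<inter> Hdiv_0 \<Omega>"
    and maps: "grad_perp \<Omega> ` W \<subseteq> U" "w_div \<Omega> ` U \<subseteq> P"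
    using cx by (auto simp: stokes_complex_2d_def)
  have "L2_dim \<Omega> {v\<in>U. (AE x in lebesgue_on \<Omega>. w_div \<Omega> v x = 0) \<and>
      (\<forall>\<xi>\<in>W. l2_inner \<Omega> v (grad_perp \<Omega> \<xi>) = 0)} (betti 1 (top_of_set \<Omega>))"
    using cx unfolding stokes_complex_2d_def by blast
  then have harmonic: "L2_dim \<Omega> {v\<in>U. (AE x in lebesgue_on \<Omega>. w_div \<Omega> v x = 0) \<and>
      (\<forall>\<xi>\<in>W. l2_inner \<Omega> v (grad_perp \<Omega> \<xi>) = 0)} 0"
    using betti_convex[OF convex_polytopal_domain_simps(3)[OF dom], of 1] by simp
  have val: "\<omega> s \<in> W" "u s \<in> U" "p s \<in> P" if "s \<in> T" for s
    using sol that by (auto simp: solution_2d_def)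
  obtain du where C1: "C1_in_time \<Omega> T u du" and
    eqs: "\<And>s \<xi> v q. s \<in> T \<Longrightarrow> \<xi> \<in> W \<Longrightarrow> v \<in> U \<Longrightarrow> q \<in> P \<Longrightarrow>
      l2_inner \<Omega> (w_grad \<Omega> (\<omega> s)) (w_grad \<Omega> \<xi>) =
        - 2 * l2_inner \<Omega> (sym_grad \<Omega> (u s)) (sym_grad \<Omega> (grad_perp \<Omega> \<xi>)) \<and>
      l2_inner \<Omega> (du s) v =
        - l2_inner \<Omega> (\<lambda>x. \<omega> s x *\<^sub>R perp (u s x)) v
        + l2_inner \<Omega> (\<lambda>x. (1/2) * (norm (u s x))\<^sup>2 + p s x) (w_div \<Omega> v)
        - (2/Rey) * l2_inner \<Omega> (sym_grad \<Omega> (u s)) (sym_grad \<Omega> v) \<and>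
      0 = l2_inner \<Omega> (w_div \<Omega> (u s)) q"
    using sol unfolding solution_2d_def by blast
  have perp_perp: "perp a \<bullet> perp b = a \<bullet> b" for a b
    by (simp add: perp_def inner_vec_def sum_2)
  have vorticity: "2 * l2_inner \<Omega> (sym_grad \<Omega> (u t)) (sym_grad \<Omega> (grad_perp \<Omega> \<xi>))
      = - l2_inner \<Omega> (grad_perp \<Omega> (\<omega> t)) (grad_perp \<Omega> \<xi>)"
    if "\<xi> \<in> W" for \<xi>
    using eqs[OF t(1) that val(2,3)[OF t(1)]]
    by (simp add: l2_inner_def grad_perp_def perp_perp)
  have momentum: "l2_inner \<Omega> (du t) v = - l2_inner \<Omega> (\<lambda>x. \<omega> t x *\<^sub>R perp (u t x)) v
      + l2_inner \<Omega> (\<lambda>x. (1/2) * (norm (u t x))\<^sup>2 + p t x) (w_div \<Omega> v)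
      - (2/Rey) * l2_inner \<Omega> (sym_grad \<Omega> (u t)) (sym_grad \<Omega> v)" if "v \<in> U" for v
    using eqs[OF t(1) val(1)[OF t(1)] that val(3)[OF t(1)]] by blast
  have mass: "l2_inner \<Omega> (w_div \<Omega> (u s)) q = 0" if "s \<in> T" "q \<in> P" for s q
    using eqs[OF that(1) val(1,2)[OF that(1)] that(2)] by simp
  interpret G: weak_operator \<Omega> "grad_adj :: (real^2 \<Rightarrow> real^2) \<Rightarrow> _" by (rule weak_operator_grad_adj[OF \<Omega>])
  have WH: "W \<subseteq> H grad_adj \<Omega>" using sub(1) by (auto simp: H1_0_def H0_def)
  have K: "ae_linear_on \<Omega> W (grad_perp \<Omega>)"
    using ae_linear_on_compose[OF bounded_linear_perp G.ae_linear_on_weak[OF WH]]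
    by (simp add: grad_perp_def[abs_def] w_grad_def)
  have E: "ae_linear_on \<Omega> U (sym_grad \<Omega>)" using sub(2) by (intro ae_linear_on_sym_grad \<Omega>) auto
  have D: "ae_linear_on \<Omega> U (w_div \<Omega>)" using sub(2) by (intro ae_linear_on_w_div \<Omega>) auto
  have div: "AE x in lebesgue_on \<Omega>. w_div \<Omega> (u s) x = 0" if s: "s \<in> T" for s
  proof -
    have "w_div \<Omega> (u s) \<in> P" using maps(2) val(2)[OF s] by blast
    then show ?thesis
      using mass[OF s] l2_inner_self_eq_0_iff[OF ae_linear_on_L2[OF D val(2)[OF s]]] by blast
  qed
  note der = solution_time_derivatives[OF \<Omega> fd(2) sub(2) C1 val(2) div t]
  have "l2_inner \<Omega> (du t) (u t) = - (2/Rey) * enstrophy \<Omega> (u t)"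
  proof -
    have "l2_inner \<Omega> (\<lambda>x. \<omega> t x *\<^sub>R perp (u t x)) (u t) = 0"
      by (simp add: l2_inner_def perp_def inner_vec_def sum_2)
    then show ?thesis
      using momentum[OF val(2)[OF t(1)]] l2_inner_zero_AE[OF div[OF t(1)]]
      by (simp add: enstrophy_def l2_norm_power2)
  qed
  then show "((\<lambda>s. energy \<Omega> (u s)) has_real_derivative - (2/Rey) * enstrophy \<Omega> (u t)) (at t within T)"
    using der(3) by simp
  have div_curl: "AE x in lebesgue_on \<Omega>. w_div \<Omega> (grad_perp \<Omega> \<xi>) x = 0" if "\<xi> \<in> W" for \<xi>
    using that WH by (intro w_div_grad_perp \<Omega>) blast
  obtain \<psi> where \<psi>: "\<psi> \<in> W" "AE x in lebesgue_on \<Omega>. du t x = grad_perp \<Omega> \<psi> x"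
    using exists_potential[where D = "grad_perp \<Omega>" and E = "w_div \<Omega>" and v = "du t",
        OF fd(2,1) K maps(1) D div_curl harmonic der(1,2)] by auto
  have gpU: "grad_perp \<Omega> \<xi> \<in> U" if "\<xi> \<in> W" for \<xi> using maps(1) that by blast
  have UL2: "v \<in> L2 \<Omega>" if "v \<in> U" for v using finite_dim_subset_L2[OF fd(2)] that by blast
  let ?c = "grad_perp \<Omega> (\<omega> t)"
  have c: "?c \<in> U" by (rule gpU[OF val(1)[OF t(1)]])
  have adv: "in_plane (u t x) \<bullet> cross3 (normal_to_plane (\<omega> t x)) (in_plane (curl_2d \<Omega> (\<omega> t) x))
      = \<omega> t x * (u t x \<bullet> w_grad \<Omega> (\<omega> t) x)" for x
    by (simp add: in_plane_def normal_to_plane_def curl_2d_def grad_perp_def perp_def cross3_def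
        inner_vec_def sum_3 sum_2 algebra_simps)
  have "AE x in lebesgue_on \<Omega>. sym_grad \<Omega> (du t) x = sym_grad \<Omega> (grad_perp \<Omega> \<psi>) x"
    by (rule ae_linear_on_cong[OF E der(1) gpU[OF \<psi>(1)] \<psi>(2)])
  then have "2 * l2_inner \<Omega> (sym_grad \<Omega> (u t)) (sym_grad \<Omega> (du t))
      = 2 * l2_inner \<Omega> (sym_grad \<Omega> (u t)) (sym_grad \<Omega> (grad_perp \<Omega> \<psi>))"
    using ae_linear_on_L2[OF E] val(2)[OF t(1)] der(1) gpU[OF \<psi>(1)]
    by (intro arg_cong[of _ _ "(*) 2"] l2_inner_cong_AE) auto
  also have "\<dots> = - l2_inner \<Omega> ?c (grad_perp \<Omega> \<psi>)" by (rule vorticity[OF \<psi>(1)])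
  also have "l2_inner \<Omega> ?c (grad_perp \<Omega> \<psi>) = l2_inner \<Omega> (du t) ?c"
    using \<psi>(2) UL2[OF der(1)] UL2[OF c] UL2[OF gpU[OF \<psi>(1)]]
    by (subst l2_inner_commute) (intro l2_inner_cong_AE, auto)
  also have "- l2_inner \<Omega> (du t) ?c
      = advection_2d \<Omega> (u t) (\<omega> t) - (1/Rey) * (l2_norm \<Omega> (curl_2d \<Omega> (\<omega> t)))\<^sup>2"
  proof -
    have "l2_inner \<Omega> (\<lambda>x. \<omega> t x *\<^sub>R perp (u t x)) ?c = advection_2d \<Omega> (u t) (\<omega> t)"
      unfolding l2_inner_def advection_2d_def adv by (simp add: grad_perp_def perp_perp)
    moreover have "(l2_norm \<Omega> (curl_2d \<Omega> (\<omega> t)))\<^sup>2 = l2_inner \<Omega> ?c ?c"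
      unfolding l2_norm_power2 by (simp add: l2_inner_def curl_2d_def)
    ultimately show ?thesis
      using momentum[OF c] l2_inner_zero_AE[OF div_curl[OF val(1)[OF t(1)]]] vorticity[OF val(1)[OF t(1)]]
      by simp
  qed
  finally show "((\<lambda>s. enstrophy \<Omega> (u s)) has_real_derivative
           advection_2d \<Omega> (u t) (\<omega> t) - (1/Rey) * (l2_norm \<Omega> (curl_2d \<Omega> (\<omega> t)))\<^sup>2) (at t within T)"
    using der(4) by simp
  show "advection_2d \<Omega> (u t) (\<omega> t) = 0"
    unfolding advection_2d_def adv
    using sub val[OF t(1)]
    by (intro integral_transport_eq_0[OF \<Omega> _ _ div[OF t(1)]]) (auto simp: Hdiv_0_def H0_def)
qed

lemma antimono_on_interval_if_derivative_nonpos: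
  fixes f :: "real \<Rightarrow> real"
  assumes T: "is_interval T" and f: "\<And>t. t \<in> T \<Longrightarrow> (f has_real_derivative f' t) (at t within T)"
    and nonpos: "\<And>t. t \<in> T \<Longrightarrow> f' t \<le> 0"
  shows "antimono_on T f"
proof (rule monotone_onI)
  fix a b assume ab: "a \<in> T" "b \<in> T" "a \<le> b"
  have sub: "{a..b} \<subseteq> T" using mem_is_interval_1_I[OF T ab(1,2)] by auto
  show "f b \<le> f a"
  proof (rule DERIV_nonpos_imp_decreasing_open[OF ab(3)])
    show "\<exists>y. (f has_real_derivative y) (at x) \<and> y \<le> 0" if x: "a < x" "x < b" for x
    proof -
      have xT: "x \<in> T" using sub x by auto
      have "(f has_real_derivative f' x) (at x within {a<..<b})"
        using sub by (intro DERIV_subset[OF f[OF xT]]) auto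
      then have "(f has_real_derivative f' x) (at x)"
        using x by (simp add: at_within_open[of x "{a<..<b}"])
      then show ?thesis using nonpos[OF xT] by blast
    qed
    have "continuous_on T f"
      by (rule DERIV_continuous_on[OF f])
    then show "continuous_on {a..b} f" using sub by (rule continuous_on_subset)
  qed
qed

theorem theorem2p4:
  fixes Rey :: real and T :: "real set"
  assumes "Rey > 0" and "is_interval T" and "interior T \<noteq> {}"
  shows
    "(\<forall>\<Omega> A W U P \<alpha> \<omega> u p.
        convex_polytopal_domain \<Omega> \<longrightarrow> stokes_complex_3d \<Omega> A W U P \<longrightarrow>
        solution_3d \<Omega> Rey T A W U P \<alpha> \<omega> u p \<longrightarrow>
        (\<forall>t\<in>T.
           ((\<lambda>s. energy \<Omega> (u s)) has_real_derivative
              - (2/Rey) * enstrophy \<Omega> (u t)) (at t within T) \<and>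
           - (2/Rey) * enstrophy \<Omega> (u t) \<le> 0 \<and>
           ((\<lambda>s. enstrophy \<Omega> (u s)) has_real_derivative
              advection_3d \<Omega> (u t) (\<omega> t) - (1/Rey) * (l2_norm \<Omega> (w_curl \<Omega> (\<omega> t)))\<^sup>2)
              (at t within T)))
     \<and>
     (\<forall>\<Omega> W U P \<omega> u p.
        convex_polytopal_domain \<Omega> \<longrightarrow> stokes_complex_2d \<Omega> W U P \<longrightarrow>
        solution_2d \<Omega> Rey T W U P \<omega> u p \<longrightarrow>
        (\<forall>t\<in>T.
           ((\<lambda>s. energy \<Omega> (u s)) has_real_derivative
              - (2/Rey) * enstrophy \<Omega> (u t)) (at t within T) \<and>
           - (2/Rey) * enstrophy \<Omega> (u t) \<le> 0 \<and>
           ((\<lambda>s. enstrophy \<Omega> (u s)) has_real_derivative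
              advection_2d \<Omega> (u t) (\<omega> t) - (1/Rey) * (l2_norm \<Omega> (curl_2d \<Omega> (\<omega> t)))\<^sup>2)
              (at t within T) \<and>
           advection_2d \<Omega> (u t) (\<omega> t) = 0) \<and>
        antimono_on T (\<lambda>t. enstrophy \<Omega> (u t)))"
proof -
  note lim = interval_islimpt[OF assms(2,3)]
  have dissipation: "- (2/Rey) * enstrophy \<Omega> v \<le> 0"
    for \<Omega> :: "(real^'n) set" and v :: "real^'n \<Rightarrow> real^'n"
    using assms(1) by (simp add: enstrophy_def)
  have antimono: "antimono_on T (\<lambda>t. enstrophy \<Omega> (u t))"
    if "convex_polytopal_domain \<Omega>" "stokes_complex_2d \<Omega> W U P" "solution_2d \<Omega> Rey T W U P \<omega> u p"
    for \<Omega> W U P \<omega> u p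
  proof (rule antimono_on_interval_if_derivative_nonpos[OF assms(2)])
    show "((\<lambda>s. enstrophy \<Omega> (u s)) has_real_derivative
        - (1/Rey) * (l2_norm \<Omega> (curl_2d \<Omega> (\<omega> t)))\<^sup>2) (at t within T)" if "t \<in> T" for t
      using stokes_2d_balance(2,3)[OF \<open>convex_polytopal_domain \<Omega>\<close> \<open>stokes_complex_2d \<Omega> W U P\<close>
          \<open>solution_2d \<Omega> Rey T W U P \<omega> u p\<close> that lim[OF that]] by simp
    show "- (1/Rey) * (l2_norm \<Omega> (curl_2d \<Omega> (\<omega> t)))\<^sup>2 \<le> 0" for t
      using assms(1) by simp
  qed
  show ?thesis
  proof (intro conjI allI impI ballI)
    fix \<Omega> A W U P \<alpha> \<omega> u p t
    assume *: "convex_polytopal_domain \<Omega>" "stokes_complex_3d \<Omega> A W U P"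
      "solution_3d \<Omega> Rey T A W U P \<alpha> \<omega> u p" "t \<in> T"
    note b = stokes_3d_balance[OF * lim[OF *(4)]]
    show "((\<lambda>s. energy \<Omega> (u s)) has_real_derivative - (2/Rey) * enstrophy \<Omega> (u t)) (at t within T)"
      by (rule b(1))
    show "- (2/Rey) * enstrophy \<Omega> (u t) \<le> 0" by (rule dissipation)
    show "((\<lambda>s. enstrophy \<Omega> (u s)) has_real_derivative
        advection_3d \<Omega> (u t) (\<omega> t) - (1/Rey) * (l2_norm \<Omega> (w_curl \<Omega> (\<omega> t)))\<^sup>2) (at t within T)"
      by (rule b(2))
  next
    fix \<Omega> W U P \<omega> u p t
    assume *: "convex_polytopal_domain \<Omega>" "stokes_complex_2d \<Omega> W U P"
      "solution_2d \<Omega> Rey T W U P \<omega> u p" "t \<in> T"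
    note b = stokes_2d_balance[OF * lim[OF *(4)]]
    show "((\<lambda>s. energy \<Omega> (u s)) has_real_derivative - (2/Rey) * enstrophy \<Omega> (u t)) (at t within T)"
      by (rule b(1))
    show "- (2/Rey) * enstrophy \<Omega> (u t) \<le> 0" by (rule dissipation)
    show "((\<lambda>s. enstrophy \<Omega> (u s)) has_real_derivative
        advection_2d \<Omega> (u t) (\<omega> t) - (1/Rey) * (l2_norm \<Omega> (curl_2d \<Omega> (\<omega> t)))\<^sup>2) (at t within T)"
      by (rule b(2))
    show "advection_2d \<Omega> (u t) (\<omega> t) = 0" by (rule b(3))
  next
    fix \<Omega> W U P \<omega> u p
    assume "convex_polytopal_domain \<Omega>" "stokes_complex_2d \<Omega> W U P" "solution_2d \<Omega> Rey T W U P \<omega> u p"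
    then show "antimono_on T (\<lambda>t. enstrophy \<Omega> (u t))" by (rule antimono)
  qed
qed

end
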